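(* Let $k$ be a field of characteristic $p>0$. Let $G$ be an affine algebraic $k$-group and let $T$ be a subgroup of $G$. Then $T$ is a maximal toroid of $G$ if and only if $T$ is connected and there exists a positive integer $r$ such that, for every $i\geq r$, the $i$'th Frobenius kernel $T_i$ is a maximal toroid of $G_i$.
   Context: An affine algebraic $k$-group is an affine group scheme of finite type over $k$ (not assumed smooth). A subgroup of $G$ is a locally closed (automatically closed) $k$-subgroup scheme, not assumed smooth. A toroid is a connected affine algebraic $k$-group of multiplicative type (i.e. diagonalisable over an algebraic closure of $k$), not assumed smooth. A toroid of $G$ is a subgroup of $G$ isomorphic to a toroid; a maximal toroid of $G$ is a toroid of $G$ not strictly contained in any other toroid of $G$. For an algebraic $k$-group $H$, its $i$'th Frobenius kernel $H_i$ is the kernel of the $i$-fold relative Frobenius homomorphism $H\to H^{(p^i)}$. *)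

theory Defs
  imports
    "HOL-Library.Poly_Mapping"
    "HOL-Analysis.Abstract_Topology"
    "HOL-Algebra.Algebraic_Closure_Type"
begin

section \<open>Polynomials and ideals\<close>

text \<open>
  \<open>('x, 'k) mpoly\<close> is the polynomial ring over \<open>'k\<close> in the variables indexed by \<open>'x\<close>: finitely
  supported functions from monomials \<open>'x \<Rightarrow>\<^sub>0 nat\<close> to coefficients, with the convolution product.
\<close>

type_synonym ('x, 'k) mpoly = "('x \<Rightarrow>\<^sub>0 nat) \<Rightarrow>\<^sub>0 'k"

definition const :: "'k::zero \<Rightarrow> ('x, 'k) mpoly" where
  "const c = Poly_Mapping.single 0 c"

definition var :: "'x \<Rightarrow> ('x, 'k::zero_neq_one) mpoly" where
  "var x = Poly_Mapping.single (Poly_Mapping.single x 1) 1"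

text \<open>
  The value of \<open>p\<close> in a ring \<open>'r\<close>, the coefficients being sent to \<open>'r\<close> by \<open>h\<close> and the variables
  by \<open>v\<close>.
\<close>

definition peval :: "('k::zero \<Rightarrow> 'r) \<Rightarrow> ('x \<Rightarrow> 'r) \<Rightarrow> ('x, 'k) mpoly \<Rightarrow> 'r::comm_semiring_1" where
  "peval h v p = (\<Sum>m\<in>Poly_Mapping.keys p.
     h (Poly_Mapping.lookup p m) * (\<Prod>x\<in>Poly_Mapping.keys m. v x ^ Poly_Mapping.lookup m x))"

definition subst :: "('x \<Rightarrow> ('y, 'k) mpoly) \<Rightarrow> ('x, 'k::comm_semiring_1) mpoly \<Rightarrow> ('y, 'k) mpoly" where
  "subst = peval const"

definition is_ideal :: "'a::comm_ring_1 set \<Rightarrow> bool" where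
  "is_ideal I \<longleftrightarrow> module.subspace (*) I"

definition ideal_gen :: "'a::comm_ring_1 set \<Rightarrow> 'a set" where
  "ideal_gen S = module.span (*) S"

definition is_prime_ideal :: "'a::comm_ring_1 set \<Rightarrow> bool" where
  "is_prime_ideal P \<longleftrightarrow>
     is_ideal P \<and> 1 \<notin> P \<and> (\<forall>a b. a * b \<in> P \<longrightarrow> a \<in> P \<or> b \<in> P)"


section \<open>Closed subschemes of affine space\<close>

text \<open>
  An ideal \<open>I\<close> of a polynomial ring \<open>R\<close> stands for the closed subscheme \<open>Spec (R / I)\<close> of affine
  space; the points of \<open>Spec (R / I)\<close> are the prime ideals of \<open>R\<close> containing \<open>I\<close>, with the
  Zariski topology. Larger ideals are smaller subschemes.
\<close>

definition Spec :: "'a::comm_ring_1 set \<Rightarrow> 'a set set" where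
  "Spec I = {P. is_prime_ideal P \<and> I \<subseteq> P}"

definition zariski :: "'a::comm_ring_1 set \<Rightarrow> 'a set topology" where
  "zariski I = topology (\<lambda>U. \<exists>S. U = {P \<in> Spec I. \<not> S \<subseteq> P})"

lemma openin_zariski: "openin (zariski I) U \<longleftrightarrow> (\<exists>S. U = {P \<in> Spec I. \<not> S \<subseteq> P})"
proof -
  let ?op = "\<lambda>U. \<exists>S. U = {P \<in> Spec I. \<not> S \<subseteq> P}"
  have "istopology ?op"
    unfolding istopology_def
  proof (intro conjI allI impI)
    fix U V assume "?op U" "?op V"
    then obtain S T where ST: "U = {P \<in> Spec I. \<not> S \<subseteq> P}" "V = {P \<in> Spec I. \<not> T \<subseteq> P}" by blast
    have "s * t \<in> P" if "P \<in> Spec I" "s \<in> P \<or> t \<in> P" for P s t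
    proof -
      have "module.subspace (*) P"
        using that(1) by (auto simp: Spec_def is_prime_ideal_def is_ideal_def)
      moreover have "Modules.module ((*) :: 'a \<Rightarrow> 'a \<Rightarrow> 'a)"
        by (rule Modules.module.intro) (simp_all add: algebra_simps)
      ultimately have "c * x \<in> P" if "x \<in> P" for c x
        using that Modules.module.subspace_scale by fastforce
      from this[of s t] this[of t s] show ?thesis
        using that(2) by (auto simp: mult.commute)
    qed
    moreover have "s \<in> P \<or> t \<in> P" if "P \<in> Spec I" "s * t \<in> P" for P s t
      using that by (auto simp: Spec_def is_prime_ideal_def)
    ultimately have "U \<inter> V = {P \<in> Spec I. \<not> {s * t | s t. s \<in> S \<and> t \<in> T} \<subseteq> P}"
      unfolding ST by blast
    then show "?op (U \<inter> V)" by blast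
  next
    fix \<U> assume *: "\<forall>U\<in>\<U>. ?op U"
    then obtain S where "\<forall>U\<in>\<U>. U = {P \<in> Spec I. \<not> S U \<subseteq> P}" by metis
    then have "\<Union>\<U> = (\<Union>U\<in>\<U>. {P \<in> Spec I. \<not> S U \<subseteq> P})" by simp
    also have "\<dots> = {P \<in> Spec I. \<not> (\<Union>U\<in>\<U>. S U) \<subseteq> P}" by auto
    finally have "\<Union>\<U> = {P \<in> Spec I. \<not> (\<Union>U\<in>\<U>. S U) \<subseteq> P}" .
    then show "?op (\<Union>\<U>)" by blast
  qed
  then show ?thesis
    by (simp add: zariski_def topology_inverse')
qed

text \<open>The fibre product over the base field: the ideal generated by \<open>I(x)\<close> and \<open>J(y)\<close>.\<close>

definition prod_ideal ::
  "('x, 'k::comm_ring_1) mpoly set \<Rightarrow> ('y, 'k) mpoly set \<Rightarrow> ('x + 'y, 'k) mpoly set" where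
  "prod_ideal I J =
     ideal_gen (subst (\<lambda>x. var (Inl x)) ` I \<union> subst (\<lambda>y. var (Inr y)) ` J)"


section \<open>Affine algebraic groups\<close>

text \<open>
  An affine group scheme of finite type over \<open>'k\<close> is presented as the closed subscheme of affine
  space over \<open>'k\<close> (with coordinates indexed by a finite type \<open>'x\<close>) given by the ideal \<open>rel\<close>,
  with multiplication, identity and inversion given by polynomials. In the comultiplication
  \<open>mlt\<close> the variables \<open>Inl x\<close> and \<open>Inr x\<close> are the coordinates of the first and second factor.
  The ideal is arbitrary, so the group need not be reduced.
\<close>

record (overloaded) ('x, 'k) group_scheme =
  rel :: "(('x \<Rightarrow>\<^sub>0 nat) \<Rightarrow>\<^sub>0 'k::zero) set"
  mlt :: "'x \<Rightarrow> (('x + 'x) \<Rightarrow>\<^sub>0 nat) \<Rightarrow>\<^sub>0 'k"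
  unt :: "'x \<Rightarrow> 'k"
  ivs :: "'x \<Rightarrow> ('x \<Rightarrow>\<^sub>0 nat) \<Rightarrow>\<^sub>0 'k"

text \<open>
  The first four conditions say that \<open>rel G\<close> is an ideal and that the structure maps are morphisms
  of schemes \<open>G \<times> G \<rightarrow> G\<close>, \<open>Spec k \<rightarrow> G\<close> and \<open>G \<rightarrow> G\<close>; the others are the group axioms, in
  coordinates and modulo the ideals of \<open>G \<times> (G \<times> G)\<close> and \<open>G\<close>.
\<close>

definition alg_group :: "('x::finite, 'k::field) group_scheme \<Rightarrow> bool" where
  "alg_group G \<longleftrightarrow>
     is_ideal (rel G) \<and>
     (\<forall>f\<in>rel G. subst (mlt G) f \<in> prod_ideal (rel G) (rel G)) \<and>
     (\<forall>f\<in>rel G. peval id (unt G) f = 0) \<and>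
     (\<forall>f\<in>rel G. subst (ivs G) f \<in> rel G) \<and>
     (let a = (\<lambda>x. var (Inl x));
          b = (\<lambda>x. var (Inr (Inl x)));
          c = (\<lambda>x. var (Inr (Inr x)));
          m = (\<lambda>u v x. subst (case_sum u v) (mlt G x))
      in \<forall>x. m (m a b) c x - m a (m b c) x
               \<in> prod_ideal (rel G) (prod_ideal (rel G) (rel G))) \<and>
     (let e = (\<lambda>x. const (unt G x));
          m = (\<lambda>u v x. subst (case_sum u v) (mlt G x))
      in \<forall>x. m e var x - var x \<in> rel G \<and> m var e x - var x \<in> rel G \<and>
             m (ivs G) var x - e x \<in> rel G \<and> m var (ivs G) x - e x \<in> rel G)"

text \<open>
  A closed subscheme of \<open>G\<close> is the same as an ideal containing \<open>rel G\<close>; it is a subgroup if the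
  group structure of \<open>G\<close> restricts to it. Equality and inclusion of subgroups are thus equality
  and reverse inclusion of the ideals.
\<close>

definition closed_subgroup ::
  "('x::finite, 'k::field) group_scheme \<Rightarrow> ('x, 'k) group_scheme \<Rightarrow> bool" where
  "closed_subgroup T G \<longleftrightarrow>
     alg_group G \<and> alg_group T \<and> rel G \<subseteq> rel T \<and> T = G\<lparr>rel := rel T\<rparr>"

definition connected_group :: "('x::finite, 'k::field) group_scheme \<Rightarrow> bool" where
  "connected_group G \<longleftrightarrow> connected_space (zariski (rel G))"

text \<open>Base change along a ring homomorphism \<open>h\<close> of base fields.\<close>

definition base_change ::
  "('k::field \<Rightarrow> 'l::field) \<Rightarrow> ('x::finite, 'k) group_scheme \<Rightarrow> ('x, 'l) group_scheme" where
  "base_change h G =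
     \<lparr>rel = ideal_gen (Poly_Mapping.map h ` rel G),
      mlt = (\<lambda>x. Poly_Mapping.map h (mlt G x)),
      unt = (\<lambda>x. h (unt G x)),
      ivs = (\<lambda>x. Poly_Mapping.map h (ivs G x))\<rparr>"


section \<open>Groups of multiplicative type and toroids\<close>

text \<open>
  The polynomial \<open>f\<close> represents a group-like element of the Hopf algebra \<open>\<O>(G)\<close>: a unit whose
  comultiplication \<open>f(x y)\<close> equals \<open>f(x) f(y)\<close>.
\<close>

definition group_like :: "('x::finite, 'k::field) group_scheme \<Rightarrow> ('x, 'k) mpoly \<Rightarrow> bool" where
  "group_like G f \<longleftrightarrow>
     (\<exists>g. f * g - 1 \<in> rel G) \<and>
     subst (mlt G) f - subst (\<lambda>x. var (Inl x)) f * subst (\<lambda>x. var (Inr x)) f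
       \<in> prod_ideal (rel G) (rel G)"

text \<open>\<open>\<O>(G)\<close> is spanned by its group-like elements as a vector space.\<close>

definition diagonalisable :: "('x::finite, 'k::field) group_scheme \<Rightarrow> bool" where
  "diagonalisable G \<longleftrightarrow>
     (\<forall>f. \<exists>g \<in> module.span (\<lambda>c p. const c * p) {g. group_like G g}. f - g \<in> rel G)"

definition multiplicative_type :: "('x::finite, 'k::field) group_scheme \<Rightarrow> bool" where
  "multiplicative_type G \<longleftrightarrow> diagonalisable (base_change to_ac G)"

definition toroid :: "('x::finite, 'k::field) group_scheme \<Rightarrow> bool" where
  "toroid G \<longleftrightarrow> alg_group G \<and> connected_group G \<and> multiplicative_type G"

definition toroid_of ::
  "('x::finite, 'k::field) group_scheme \<Rightarrow> ('x, 'k) group_scheme \<Rightarrow> bool" where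
  "toroid_of T G \<longleftrightarrow> closed_subgroup T G \<and> toroid T"

definition maximal_toroid_of ::
  "('x::finite, 'k::field) group_scheme \<Rightarrow> ('x, 'k) group_scheme \<Rightarrow> bool" where
  "maximal_toroid_of T G \<longleftrightarrow>
     toroid_of T G \<and> \<not> (\<exists>S. toroid_of S G \<and> closed_subgroup T S \<and> S \<noteq> T)"


section \<open>Frobenius kernels\<close>

text \<open>
  The kernel of a homomorphism from \<open>G\<close> to \<open>H\<close> with coordinate polynomials \<open>\<phi>\<close>: the fibre
  over the identity of \<open>H\<close>.
\<close>

definition hom_kernel ::
  "('x::finite, 'k::field) group_scheme \<Rightarrow> ('y::finite, 'k) group_scheme \<Rightarrow>
   ('y \<Rightarrow> ('x, 'k) mpoly) \<Rightarrow> ('x, 'k) group_scheme" where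
  "hom_kernel G H \<phi> =
     G\<lparr>rel := ideal_gen (rel G \<union> {\<phi> y - const (unt H y) | y. True})\<rparr>"

text \<open>
  The target \<open>G\<^sup>(\<^sup>p\<^sup>^\<^sup>i\<^sup>)\<close> of the \<open>i\<close>-fold relative Frobenius, for \<open>p\<close> the characteristic of \<open>'k\<close>,
  is the base change of \<open>G\<close> along \<open>c \<mapsto> c ^ (p ^ i)\<close>; the homomorphism raises every coordinate
  to the power \<open>p ^ i\<close>.
\<close>

definition frobenius_twist ::
  "nat \<Rightarrow> ('x::finite, 'k::field) group_scheme \<Rightarrow> ('x, 'k) group_scheme" where
  "frobenius_twist i G = base_change (\<lambda>c. c ^ (CHAR('k) ^ i)) G"

definition frobenius_kernel ::
  "nat \<Rightarrow> ('x::finite, 'k::field) group_scheme \<Rightarrow> ('x, 'k) group_scheme" where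
  "frobenius_kernel i G =
     hom_kernel G (frobenius_twist i G) (\<lambda>x. var x ^ (CHAR('k) ^ i))"

end

theory Submission
  imports Defs
begin

text \<open>
  Write \<open>H\<^sub>i\<close> for the \<open>i\<close>-th Frobenius kernel of \<open>H\<close>. Two facts carry the proof.

  The first is density (\<open>frobenius_kernels_dense\<close>): a function on a connected group \<open>H\<close> that
  vanishes on every \<open>H\<^sub>i\<close> is zero. By Krull's intersection theorem the functions that vanish on
  every \<open>H\<^sub>i\<close> vanish in a neighbourhood of the identity. They are the ideal of a closed subgroup,
  so by translation they vanish in a neighbourhood of each point of that subgroup. The subgroup is
  therefore open and closed in \<open>H\<close>, and it is all of \<open>H\<close>.

  The second is a criterion for diagonalisability (\<open>diagonalisable_if_charts\<close>): it suffices that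
  every finite-dimensional space of functions on \<open>H\<close> stays intact after restriction along some
  homomorphism from a diagonalisable group. If \<open>f\<close> restricts to \<open>\<Sum> c\<^sub>\<chi> \<chi>\<close> with group-like \<open>\<chi>\<close>, then
  \<open>f (x y)\<close> restricts to \<open>\<Sum> c\<^sub>\<chi> \<chi> x \<chi> y\<close>, and a functional in \<open>y\<close> that isolates one \<open>\<chi>\<close> exhibits it
  as the restriction of a function in the span of the translates of \<open>f\<close>. That function is
  group-like.

  Suppose that \<open>T\<close> is connected and that \<open>T\<^sub>i\<close> is a maximal toroid of \<open>G\<^sub>i\<close> for all large \<open>i\<close>. A
  decreasing sequence of subspaces of a finite-dimensional space becomes constant, so by density
  every finite-dimensional space of functions on \<open>T\<close> restricts injectively to some \<open>T\<^sub>i\<close>. This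
  survives extension of the base field, and the criterion shows that \<open>T\<close> is of multiplicative
  type. If a toroid \<open>S\<close> of \<open>G\<close> contains \<open>T\<close>, then \<open>S\<^sub>i\<close> is a toroid of \<open>G\<^sub>i\<close> that contains \<open>T\<^sub>i\<close>, so
  \<open>S\<^sub>i = T\<^sub>i\<close> for all large \<open>i\<close>, and density gives \<open>S = T\<close>.

  Suppose conversely that \<open>T\<close> is a maximal toroid of \<open>G\<close>. The centralisers of the \<open>T\<^sub>i\<close> in \<open>G\<close>
  decrease, so by Hilbert's basis theorem they are constant from some \<open>r\<close> on, and by density they
  then centralise \<open>T\<close> (\<open>commuting_from_frobenius_kernel\<close>). For \<open>i \<ge> r\<close> let \<open>S\<close> be a toroid of \<open>G\<^sub>i\<close>
  that contains \<open>T\<^sub>i\<close>. It is commutative, so it centralises \<open>T\<^sub>i\<close> and hence \<open>T\<close>. The product \<open>T S\<close>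
  is then a subgroup. It is of multiplicative type by the criterion, applied to \<open>T \<times> S \<rightarrow> T S\<close>, and
  it is connected because \<open>S\<close> is infinitesimal, so that \<open>T S\<close> has the same underlying space as
  \<open>T\<close>. By maximality \<open>T S = T\<close>, so \<open>S\<close> is contained in \<open>T\<close> and in \<open>G\<^sub>i\<close>, hence in \<open>T\<^sub>i\<close>.

  Quotient rings and tensor products are not formed as types. Elements of a quotient are
  polynomials up to congruence, ideals of products are tested by applying linear functionals to
  one factor (\<open>mem_prod_ideal_iff_sliceR\<close>), and identities in Hopf algebras are verified as
  identities in the group of points with polynomial coordinates (\<open>pmul_assoc\<close> and the lemmas
  around it).
\<close>

section \<open>Ideals and congruences\<close>

lemma ring_as_module: "Modules.module ((*) :: 'a::comm_ring_1 \<Rightarrow> 'a \<Rightarrow> 'a)"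
  by (rule Modules.module.intro) (simp_all add: algebra_simps)

lemma is_idealI:
  fixes I :: "'a::comm_ring_1 set"
  assumes "0 \<in> I" "\<And>a b. a \<in> I \<Longrightarrow> b \<in> I \<Longrightarrow> a + b \<in> I" "\<And>c a. a \<in> I \<Longrightarrow> c * a \<in> I"
  shows "is_ideal I"
  unfolding is_ideal_def Modules.module.subspace_def[OF ring_as_module] using assms by auto

context
  fixes I :: "'a::comm_ring_1 set"
  assumes I: "is_ideal I"
begin

lemma ideal_0: "0 \<in> I"
  using I unfolding is_ideal_def Modules.module.subspace_def[OF ring_as_module] by auto

lemma ideal_add: "a \<in> I \<Longrightarrow> b \<in> I \<Longrightarrow> a + b \<in> I"
  using I unfolding is_ideal_def Modules.module.subspace_def[OF ring_as_module] by auto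

lemma ideal_mult_left: "a \<in> I \<Longrightarrow> c * a \<in> I"
  using I unfolding is_ideal_def Modules.module.subspace_def[OF ring_as_module] by auto

lemma ideal_mult_right: "a \<in> I \<Longrightarrow> a * c \<in> I"
  using ideal_mult_left[of a c] by (simp add: mult.commute)

lemma ideal_uminus: "a \<in> I \<Longrightarrow> - a \<in> I"
  using ideal_mult_left[of a "-1"] by simp

lemma ideal_diff: "a \<in> I \<Longrightarrow> b \<in> I \<Longrightarrow> a - b \<in> I"
  using ideal_add[of a "- b"] ideal_uminus[of b] by simp

lemma ideal_sum: "(\<And>i. i \<in> A \<Longrightarrow> f i \<in> I) \<Longrightarrow> sum f A \<in> I"
  by (induction A rule: infinite_finite_induct) (auto intro: ideal_0 ideal_add)

lemma ideal_diffD: "a - b \<in> I \<Longrightarrow> b \<in> I \<Longrightarrow> a \<in> I"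
  using ideal_add[of "a - b" b] by simp

end

lemma is_ideal_ideal_gen: "is_ideal (ideal_gen S)"
  unfolding is_ideal_def ideal_gen_def by (rule Modules.module.subspace_span[OF ring_as_module])

lemma ideal_gen_base: "a \<in> S \<Longrightarrow> a \<in> ideal_gen S"
  unfolding ideal_gen_def by (rule Modules.module.span_base[OF ring_as_module])

lemma ideal_gen_least: "S \<subseteq> I \<Longrightarrow> is_ideal I \<Longrightarrow> ideal_gen S \<subseteq> I"
  unfolding ideal_gen_def is_ideal_def by (rule Modules.module.span_minimal[OF ring_as_module])

lemma ideal_gen_mono: "S \<subseteq> S' \<Longrightarrow> ideal_gen S \<subseteq> ideal_gen S'"
  by (meson ideal_gen_least is_ideal_ideal_gen ideal_gen_base subset_iff)

lemma ideal_gen_induct [consumes 1, case_names zero step]: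
  assumes "a \<in> ideal_gen S" "P 0" "\<And>c s b. s \<in> S \<Longrightarrow> P b \<Longrightarrow> P (c * s + b)"
  shows "P a"
  using assms(1) unfolding ideal_gen_def
  by (rule Modules.module.span_induct_alt[OF ring_as_module]) (use assms in auto)

lemma is_ideal_Inter: "(\<And>I. I \<in> F \<Longrightarrow> is_ideal I) \<Longrightarrow> is_ideal (\<Inter>F)"
  by (rule is_idealI) (auto intro: ideal_0 ideal_add ideal_mult_left)

text \<open>
  Congruence modulo an ideal lets the quotient rings, which are not types, be used through
  calculational reasoning.
\<close>

definition cong_mod :: "'a::comm_ring_1 set \<Rightarrow> 'a \<Rightarrow> 'a \<Rightarrow> bool" where
  "cong_mod K a b \<longleftrightarrow> a - b \<in> K"

context
  fixes K :: "'a::comm_ring_1 set"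
  assumes K: "is_ideal K"
begin

lemma cong_mod_refl: "cong_mod K a a"
  by (simp add: cong_mod_def ideal_0[OF K])

lemma cong_mod_sym: "cong_mod K a b \<Longrightarrow> cong_mod K b a"
  unfolding cong_mod_def using ideal_uminus[OF K, of "a - b"] by simp

lemma cong_mod_trans: "cong_mod K a b \<Longrightarrow> cong_mod K b c \<Longrightarrow> cong_mod K a c"
  unfolding cong_mod_def using ideal_add[OF K, of "a - b" "b - c"] by simp

lemma cong_mod_add: "cong_mod K a b \<Longrightarrow> cong_mod K c d \<Longrightarrow> cong_mod K (a + c) (b + d)"
  unfolding cong_mod_def using ideal_add[OF K, of "a - b" "c - d"] by (simp add: algebra_simps)

lemma cong_mod_mult: "cong_mod K a b \<Longrightarrow> cong_mod K c d \<Longrightarrow> cong_mod K (a * c) (b * d)"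
  unfolding cong_mod_def
  using ideal_add[OF K ideal_mult_right[OF K, of "a - b" c] ideal_mult_left[OF K, of "c - d" b]]
  by (simp add: algebra_simps)

lemma cong_mod_power: "cong_mod K a b \<Longrightarrow> cong_mod K (a ^ n) (b ^ n)"
  by (induction n) (auto intro: cong_mod_mult cong_mod_refl)

lemma cong_mod_sum: "(\<And>i. i \<in> A \<Longrightarrow> cong_mod K (f i) (g i)) \<Longrightarrow> cong_mod K (sum f A) (sum g A)"
  by (induction A rule: infinite_finite_induct) (auto intro: cong_mod_add cong_mod_refl)

lemma cong_mod_mem: "cong_mod K a b \<Longrightarrow> a \<in> K \<longleftrightarrow> b \<in> K"
  unfolding cong_mod_def
  using ideal_diffD[OF K, of a b] ideal_diff[OF K, of a "a - b"] by auto

end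

lemma cong_mod_mono: "K \<subseteq> K' \<Longrightarrow> cong_mod K a b \<Longrightarrow> cong_mod K' a b"
  by (auto simp: cong_mod_def)

section \<open>Evaluation of polynomials\<close>

abbreviation "lookup \<equiv> Poly_Mapping.lookup"
abbreviation "keys \<equiv> Poly_Mapping.keys"
abbreviation "single \<equiv> Poly_Mapping.single"

definition ring_map :: "('a::comm_ring_1 \<Rightarrow> 'b::comm_ring_1) \<Rightarrow> bool" where
  "ring_map h \<longleftrightarrow> h 0 = 0 \<and> h 1 = 1 \<and> (\<forall>a b. h (a + b) = h a + h b) \<and> (\<forall>a b. h (a * b) = h a * h b)"

context
  fixes h :: "'a::comm_ring_1 \<Rightarrow> 'b::comm_ring_1"
  assumes h: "ring_map h"
begin

lemma ring_map_0: "h 0 = 0" and ring_map_1: "h 1 = 1"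
  and ring_map_add: "h (a + b) = h a + h b" and ring_map_mult: "h (a * b) = h a * h b"
  using h by (auto simp: ring_map_def)

lemma ring_map_uminus: "h (- a) = - h a"
  using ring_map_add[of "- a" a] by (simp add: ring_map_0 eq_neg_iff_add_eq_0)

lemma ring_map_diff: "h (a - b) = h a - h b"
  using ring_map_add[of a "- b"] by (simp add: ring_map_uminus)

lemma ring_map_sum: "h (sum f A) = (\<Sum>i\<in>A. h (f i))"
  by (induction A rule: infinite_finite_induct) (auto simp: ring_map_0 ring_map_add)

lemma ring_map_power: "h (a ^ n) = h a ^ n"
  by (induction n) (auto simp: ring_map_1 ring_map_mult)

lemma ring_map_vimage_ideal: "is_ideal K \<Longrightarrow> is_ideal (h -` K)"
  by (rule is_idealI)
     (auto simp: ring_map_0 ring_map_add ring_map_mult intro: ideal_0 ideal_add ideal_mult_left)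

end

lemma ring_map_id: "ring_map id"
  by (simp add: ring_map_def)

lemma ring_map_comp: "ring_map F \<Longrightarrow> ring_map G \<Longrightarrow> ring_map (\<lambda>x. F (G x))"
  by (simp add: ring_map_def)

lemma const_0 [simp]: "const 0 = 0" by (simp add: const_def)
lemma const_1 [simp]: "const 1 = 1" by (simp add: const_def)
lemma const_add: "const (a + b) = const a + const b" by (simp add: const_def single_add)
lemma const_mult: "const (a * b) = const a * const b" by (simp add: const_def mult_single)

lemma ring_map_const: "ring_map (const :: 'k::comm_ring_1 \<Rightarrow> ('x, 'k) mpoly)"
  by (simp add: ring_map_def const_add const_mult)

lemmas const_power = ring_map_power[OF ring_map_const]
lemmas const_diff = ring_map_diff[OF ring_map_const]

abbreviation monom :: "('x \<Rightarrow>\<^sub>0 nat) \<Rightarrow> ('x, 'k::zero_neq_one) mpoly" where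
  "monom m \<equiv> single m 1"

lemma single_eq_const_mult: "single m (c::'k::comm_ring_1) = const c * monom m"
  by (simp add: const_def mult_single)

lemma poly_mapping_sum_single:
  fixes p :: "'a \<Rightarrow>\<^sub>0 'b::comm_monoid_add"
  shows "p = (\<Sum>m\<in>keys p. single m (lookup p m))"
    (is "p = ?s")
proof (rule poly_mapping_eqI)
  fix k
  have "lookup ?s k
    = (\<Sum>m\<in>keys p. if m = k then lookup p k else 0)"
    unfolding lookup_sum by (rule sum.cong) (auto simp: lookup_single when_def)
  also have "\<dots> = lookup p k"
    by (auto simp: in_keys_iff)
  finally show "lookup p k = lookup ?s k" ..
qed

lemma poly_mapping_add_induct [case_names zero single add]:
  fixes p :: "'a \<Rightarrow>\<^sub>0 'b::comm_monoid_add"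
  assumes "P 0" "\<And>m c. P (single m c)" "\<And>p q. P p \<Longrightarrow> P q \<Longrightarrow> P (p + q)"
  shows "P p"
proof -
  have "P (\<Sum>m\<in>A. single m (lookup p m))" for A
    by (induction A rule: infinite_finite_induct) (auto intro: assms)
  then show ?thesis by (subst poly_mapping_sum_single)
qed

lemma mpoly_induct [case_names const var add mult]:
  fixes p :: "('x, 'k::comm_ring_1) mpoly"
  assumes "\<And>c. P (const c)" "\<And>x. P (var x)"
    "\<And>p q. P p \<Longrightarrow> P q \<Longrightarrow> P (p + q)" "\<And>p q. P p \<Longrightarrow> P q \<Longrightarrow> P (p * q)"
  shows "P p"
proof (induction p rule: poly_mapping_add_induct)
  case zero then show ?case using assms(1)[of 0] by simp
next
  case (single m c)
  have pow: "P (monom (single x n))" for x n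
  proof (induction n)
    case 0 then show ?case using assms(1)[of 1] by simp
  next
    case (Suc n)
    have "monom (single x (Suc n))
        = (var x * monom (single x n) :: ('x, 'k) mpoly)"
      by (simp add: var_def mult_single flip: single_add)
    then show ?case using Suc assms(2,4) by metis
  qed
  have "P (monom m)"
  proof (induction m rule: poly_mapping_add_induct)
    case zero then show ?case using assms(1)[of 1] by simp
  next
    case (single x n) show ?case by (rule pow)
  next
    case (add p q)
    then show ?case using assms(4)[of "monom p" "monom q"] by (simp add: mult_single)
  qed
  then show ?case unfolding single_eq_const_mult[of m c] by (intro assms)
next
  case (add p q) then show ?case by (intro assms)
qed

text \<open>
  The slices and the homogeneous components used below are linear but not multiplicative; they are
  all instances of this construction.
\<close>

definition lin_ext ::
  "('k::comm_ring_1 \<Rightarrow> 'r::comm_ring_1) \<Rightarrow> (('x \<Rightarrow>\<^sub>0 nat) \<Rightarrow> 'r) \<Rightarrow> ('x, 'k) mpoly \<Rightarrow> 'r" where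
  "lin_ext h w p = (\<Sum>m\<in>keys p. h (lookup p m) * w m)"

context
  fixes h :: "'k::comm_ring_1 \<Rightarrow> 'r::comm_ring_1"
  assumes h: "ring_map h"
begin

lemma lin_ext_superset:
  "finite A \<Longrightarrow> keys p \<subseteq> A \<Longrightarrow>
    lin_ext h w p = (\<Sum>m\<in>A. h (lookup p m) * w m)"
  unfolding lin_ext_def by (rule sum.mono_neutral_left) (auto simp: in_keys_iff ring_map_0[OF h])

lemma lin_ext_add: "lin_ext h w (p + q) = lin_ext h w p + lin_ext h w q"
proof -
  let ?A = "keys p \<union> keys q \<union> keys (p + q)"
  show ?thesis
    by (subst (1 2 3) lin_ext_superset[of ?A])
       (auto simp: lookup_add ring_map_add[OF h] sum.distrib algebra_simps)
qed

lemma lin_ext_0: "lin_ext h w 0 = 0"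
  by (simp add: lin_ext_def)

lemma lin_ext_single: "lin_ext h w (single m c) = h c * w m"
  by (subst lin_ext_superset[of "{m}"]) auto

lemma lin_ext_const_mult: "lin_ext h w (const c * p) = h c * lin_ext h w p"
proof (induction p rule: poly_mapping_add_induct)
  case (single m d)
  then show ?case by (simp add: const_def mult_single lin_ext_single ring_map_mult[OF h])
qed (simp_all add: lin_ext_0 lin_ext_add distrib_left)

end

definition monom_val :: "('x::finite \<Rightarrow> 'r::comm_ring_1) \<Rightarrow> ('x \<Rightarrow>\<^sub>0 nat) \<Rightarrow> 'r" where
  "monom_val v m = (\<Prod>x\<in>UNIV. v x ^ lookup m x)"

lemma peval_eq_lin_ext:
  fixes h :: "'k::comm_ring_1 \<Rightarrow> 'r::comm_ring_1" and v :: "'x::finite \<Rightarrow> 'r"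
  shows "peval h v = lin_ext h (monom_val v)"
proof -
  have "(\<Prod>x\<in>keys m. v x ^ lookup m x) = monom_val v m" for m
    unfolding monom_val_def by (rule prod.mono_neutral_left) (auto simp: in_keys_iff)
  then show ?thesis unfolding peval_def lin_ext_def fun_eq_iff by simp
qed

lemma monom_val_add: "monom_val v (m + n) = monom_val v m * monom_val v n"
  by (simp add: monom_val_def lookup_add power_add prod.distrib)

lemma monom_val_0: "monom_val v 0 = 1"
  by (simp add: monom_val_def)

context
  fixes h :: "'k::comm_ring_1 \<Rightarrow> 'r::comm_ring_1" and v :: "'x::finite \<Rightarrow> 'r"
  assumes h: "ring_map h"
begin

lemma peval_add: "peval h v (p + q) = peval h v p + peval h v q"
  unfolding peval_eq_lin_ext by (rule lin_ext_add[OF h])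

lemma peval_const: "peval h v (const c) = h c"
  unfolding peval_eq_lin_ext const_def lin_ext_single[OF h] by (simp add: monom_val_0)

lemma peval_var: "peval h v (var x) = v x"
proof -
  have "monom_val v (single x 1) = (\<Prod>y\<in>UNIV. if y = x then v x else 1)"
    unfolding monom_val_def by (rule prod.cong) (auto simp: lookup_single when_def)
  then show ?thesis
    unfolding peval_eq_lin_ext var_def lin_ext_single[OF h] by (simp add: ring_map_1[OF h])
qed

lemma peval_single_mult:
  "peval h v (single m c * q) = peval h v (single m c) * peval h v q"
proof (induction q rule: poly_mapping_add_induct)
  case zero then show ?case by (simp add: peval_eq_lin_ext lin_ext_0[OF h])
next
  case (single n d)
  then show ?case
    by (simp add: peval_eq_lin_ext mult_single lin_ext_single[OF h] ring_map_mult[OF h]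
        monom_val_add)
next
  case (add p q) then show ?case by (simp add: distrib_left peval_add)
qed

lemma peval_mult: "peval h v (p * q) = peval h v p * peval h v q"
proof (induction p rule: poly_mapping_add_induct)
  case zero then show ?case by (simp add: peval_eq_lin_ext lin_ext_0[OF h])
next
  case (single m c) then show ?case by (rule peval_single_mult)
next
  case (add p q) then show ?case by (simp add: distrib_right peval_add)
qed

lemma ring_map_peval: "ring_map (peval h v)"
  unfolding ring_map_def using peval_const[of 0] peval_const[of 1]
  by (simp add: peval_add peval_mult ring_map_0[OF h] ring_map_1[OF h])

end

lemma ring_map_subst: "ring_map (subst (u :: 'x::finite \<Rightarrow> ('y, 'k::comm_ring_1) mpoly))"
  unfolding subst_def by (rule ring_map_peval[OF ring_map_const])

lemmas subst_add = ring_map_add[OF ring_map_subst]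
  and subst_mult = ring_map_mult[OF ring_map_subst]
  and subst_diff = ring_map_diff[OF ring_map_subst]
  and subst_0 = ring_map_0[OF ring_map_subst]
  and subst_sum = ring_map_sum[OF ring_map_subst]
  and subst_power = ring_map_power[OF ring_map_subst]

lemma subst_const [simp]: "subst (u :: 'x::finite \<Rightarrow> ('y, 'k::comm_ring_1) mpoly) (const c)
    = const c"
  unfolding subst_def by (rule peval_const[OF ring_map_const])

lemma subst_var [simp]: "subst (u :: 'x::finite \<Rightarrow> ('y, 'k::comm_ring_1) mpoly) (var x) = u x"
  unfolding subst_def by (rule peval_var[OF ring_map_const])

definition eval_at :: "('x::finite \<Rightarrow> 'k::comm_ring_1) \<Rightarrow> ('x, 'k) mpoly \<Rightarrow> 'k" where
  "eval_at = peval id"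

lemma ring_map_eval_at: "ring_map (eval_at (e :: 'x::finite \<Rightarrow> 'k::comm_ring_1))"
  unfolding eval_at_def by (rule ring_map_peval[OF ring_map_id])

lemmas eval_at_simps = ring_map_0[OF ring_map_eval_at] ring_map_1[OF ring_map_eval_at]
  ring_map_add[OF ring_map_eval_at] ring_map_mult[OF ring_map_eval_at]
  ring_map_diff[OF ring_map_eval_at] ring_map_power[OF ring_map_eval_at]
  ring_map_sum[OF ring_map_eval_at]

lemma eval_at_const [simp]: "eval_at (e :: 'x::finite \<Rightarrow> 'k::comm_ring_1) (const c) = c"
  unfolding eval_at_def using peval_const[OF ring_map_id, of e c] by simp

lemma eval_at_var [simp]: "eval_at (e :: 'x::finite \<Rightarrow> 'k::comm_ring_1) (var x) = e x"
  unfolding eval_at_def using peval_var[OF ring_map_id, of e x] by simp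

lemma ring_map_mpoly_eqI:
  fixes F G :: "('x, 'k::comm_ring_1) mpoly \<Rightarrow> 'r::comm_ring_1"
  assumes F: "ring_map F" and G: "ring_map G"
    and "\<And>c. F (const c) = G (const c)" "\<And>x. F (var x) = G (var x)"
  shows "F p = G p"
  by (induction p rule: mpoly_induct)
     (use assms in \<open>simp_all add: ring_map_add[OF F] ring_map_add[OF G]
        ring_map_mult[OF F] ring_map_mult[OF G]\<close>)

lemma subst_subst:
  fixes u :: "'y::finite \<Rightarrow> ('z, 'k::comm_ring_1) mpoly" and v :: "'x::finite \<Rightarrow> ('y, 'k) mpoly"
  shows "subst u (subst v f) = subst (\<lambda>x. subst u (v x)) f"
  by (rule ring_map_mpoly_eqI) (auto intro: ring_map_comp ring_map_subst)

lemma eval_at_subst: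
  fixes e :: "'y::finite \<Rightarrow> 'k::comm_ring_1" and v :: "'x::finite \<Rightarrow> ('y, 'k) mpoly"
  shows "eval_at e (subst v f) = eval_at (\<lambda>x. eval_at e (v x)) f"
  by (rule ring_map_mpoly_eqI) (auto intro: ring_map_comp ring_map_subst ring_map_eval_at)

lemma subst_var_id [simp]: "subst var (f :: ('x::finite, 'k::comm_ring_1) mpoly) = f"
  by (rule ring_map_mpoly_eqI[OF ring_map_subst ring_map_id[unfolded id_def]]) auto

lemma subst_const_point:
  "subst (\<lambda>x. const (e x)) f = const (eval_at (e :: 'x::finite \<Rightarrow> 'k::comm_ring_1) f)"
  by (rule ring_map_mpoly_eqI[OF ring_map_subst ring_map_comp[OF ring_map_const ring_map_eval_at]])
     auto

lemma cong_mod_subst: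
  fixes u v :: "'x::finite \<Rightarrow> ('y, 'k::comm_ring_1) mpoly"
  assumes K: "is_ideal K" and "\<And>x. cong_mod K (u x) (v x)"
  shows "cong_mod K (subst u f) (subst v f)"
  by (induction f rule: mpoly_induct)
     (use assms in \<open>auto simp: subst_add subst_mult intro: cong_mod_refl cong_mod_add
         cong_mod_mult\<close>)

section \<open>Linear functionals on polynomial rings\<close>

interpretation mp: vector_space "\<lambda>c (p :: ('x, 'k::field) mpoly). const c * p"
  by unfold_locales (simp_all add: algebra_simps const_add const_mult)

definition lin_form :: "(('x, 'k::field) mpoly \<Rightarrow> 'k) \<Rightarrow> bool" where
  "lin_form \<phi> \<longleftrightarrow> (\<forall>a b. \<phi> (a + b) = \<phi> a + \<phi> b) \<and> (\<forall>c a. \<phi> (const c * a) = c * \<phi> a)"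

context
  fixes \<phi> :: "('x, 'k::field) mpoly \<Rightarrow> 'k"
  assumes \<phi>: "lin_form \<phi>"
begin

lemma lin_form_add: "\<phi> (a + b) = \<phi> a + \<phi> b" and lin_form_scale: "\<phi> (const c * a) = c * \<phi> a"
  using \<phi> by (auto simp: lin_form_def)

lemma lin_form_0: "\<phi> 0 = 0"
  using lin_form_scale[of 0 0] by simp

end

definition annih :: "('x, 'k::field) mpoly set \<Rightarrow> (('x, 'k) mpoly \<Rightarrow> 'k) set" where
  "annih I = {\<phi>. lin_form \<phi> \<and> (\<forall>f\<in>I. \<phi> f = 0)}"

lemma annih_antimono: "I \<subseteq> J \<Longrightarrow> annih J \<subseteq> annih I"
  by (auto simp: annih_def)

lemma lin_form_representation:
  assumes "mp.independent B" "mp.span B = UNIV"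
  shows "lin_form (\<lambda>p. mp.representation B p b)"
  unfolding lin_form_def using assms
  by (auto simp: mp.representation_add mp.representation_scale)

lemma is_ideal_mp_subspace: "is_ideal I \<Longrightarrow> mp.subspace I"
  by (auto simp: mp.subspace_def intro: ideal_0 ideal_add ideal_mult_left)

lemma separating_form:
  fixes V :: "('x, 'k::field) mpoly set"
  assumes V: "mp.subspace V" and a: "a \<notin> V"
  obtains \<phi> where "\<phi> \<in> annih V" "\<phi> a = 1"
proof -
  obtain B where B: "B \<subseteq> V" "mp.independent B" "V \<subseteq> mp.span B"
    using mp.maximal_independent_subset[of V] by metis
  then have span: "mp.span B = V"
    using V mp.span_minimal by blast
  then have indep: "mp.independent (insert a B)"
    using a B mp.independent_insertI by metis
  define C where "C = mp.extend_basis (insert a B)"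
  have C: "mp.independent C" "mp.span C = UNIV" "insert a B \<subseteq> C"
    unfolding C_def using mp.independent_extend_basis[OF indep] mp.span_extend_basis[OF indep]
      mp.extend_basis_superset[OF indep] by auto
  let ?\<phi> = "\<lambda>p. mp.representation C p a"
  have "?\<phi> f = 0" if "f \<in> V" for f
  proof -
    have "mp.representation C f = mp.representation B f"
      using mp.representation_extend[OF C(1), of f B] that span C(3) by auto
    moreover have "a \<notin> B" using a B by auto
    ultimately show ?thesis using mp.representation_ne_zero by metis
  qed
  moreover have "?\<phi> a = 1"
    using mp.representation_basis[OF C(1), of a] C(3) by auto
  ultimately show ?thesis
    using that[of ?\<phi>] lin_form_representation[OF C(1,2)] by (auto simp: annih_def)
qed

text \<open>
  For a family that is linearly independent modulo \<open>K\<close> this provides the dual functionals on the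
  quotient by \<open>K\<close>, one at a time.
\<close>

lemma separating_form_modulo:
  fixes b :: "'i \<Rightarrow> ('x, 'k::field) mpoly"
  assumes K: "is_ideal K" and A: "finite A"
    and a: "\<And>c. a - (\<Sum>i\<in>A. const (c i) * b i) \<notin> K"
  obtains \<psi> where "\<psi> \<in> annih K" "\<psi> a = 1" "\<And>i. i \<in> A \<Longrightarrow> \<psi> (b i) = 0"
proof -
  let ?V = "{v. \<exists>c. v - (\<Sum>i\<in>A. const (c i) * b i) \<in> K}"
  have KV: "v \<in> ?V" if "v \<in> K" for v using that by (auto intro!: exI[of _ "\<lambda>_. 0"])
  have "mp.subspace ?V"
  proof (rule mp.subspaceI)
    show "0 \<in> ?V" by (rule KV[OF ideal_0[OF K]])
  next
    fix x y assume "x \<in> ?V" "y \<in> ?V"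
    then obtain c d where "x - (\<Sum>i\<in>A. const (c i) * b i) \<in> K" "y - (\<Sum>i\<in>A. const (d i) * b i) \<in> K"
      by auto
    from ideal_add[OF K this] have "x + y - (\<Sum>i\<in>A. const (c i + d i) * b i) \<in> K"
      by (simp add: const_add distrib_right sum.distrib add_diff_add)
    then show "x + y \<in> ?V" by (auto intro!: exI[of _ "\<lambda>i. c i + d i"])
  next
    fix e x assume "x \<in> ?V"
    then obtain c where "x - (\<Sum>i\<in>A. const (c i) * b i) \<in> K" by auto
    from ideal_mult_left[OF K this, of "const e"]
    have "const e * x - (\<Sum>i\<in>A. const (e * c i) * b i) \<in> K"
      by (simp only: const_mult right_diff_distrib sum_distrib_left mult.assoc)
    then show "const e * x \<in> ?V" by (auto intro!: exI[of _ "\<lambda>i. e * c i"])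
  qed
  moreover have "a \<notin> ?V" using a by blast
  ultimately obtain \<psi> where \<psi>: "\<psi> \<in> annih ?V" "\<psi> a = 1" by (rule separating_form)
  have "\<psi> (b i) = 0" if i: "i \<in> A" for i
  proof -
    have "(\<Sum>j\<in>A. const (if j = i then 1 else 0) * b j) = (\<Sum>j\<in>A. if j = i then b j else 0)"
      by (rule sum.cong) auto
    also have "\<dots> = b i" using i A by simp
    finally have "b i \<in> ?V"
      by (auto intro!: exI[of _ "\<lambda>j. if j = i then 1 else 0"] simp: ideal_0[OF K])
    then show ?thesis using \<psi>(1) by (simp add: annih_def)
  qed
  moreover have "\<psi> \<in> annih K" using \<psi>(1) KV by (auto simp: annih_def)
  ultimately show ?thesis using that \<psi>(2) by blast
qed

lemma mem_iff_annih:
  assumes "mp.subspace V"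
  shows "a \<in> V \<longleftrightarrow> (\<forall>\<phi>\<in>annih V. \<phi> a = 0)"
  using separating_form[OF assms, of a]
  by (metis (mono_tags, lifting) annih_def mem_Collect_eq zero_neq_one)

section \<open>The tensor product of two polynomial rings\<close>

abbreviation in1 :: "('x::finite, 'k::comm_ring_1) mpoly \<Rightarrow> ('x + 'y, 'k) mpoly" where
  "in1 \<equiv> subst (\<lambda>x. var (Inl x))"

abbreviation in2 :: "('y::finite, 'k::comm_ring_1) mpoly \<Rightarrow> ('x + 'y, 'k) mpoly" where
  "in2 \<equiv> subst (\<lambda>y. var (Inr y))"

abbreviation left_part :: "(('x + 'y) \<Rightarrow>\<^sub>0 nat) \<Rightarrow> ('x \<Rightarrow>\<^sub>0 nat)" where
  "left_part \<equiv> Poly_Mapping.map_key Inl"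

abbreviation right_part :: "(('x + 'y) \<Rightarrow>\<^sub>0 nat) \<Rightarrow> ('y \<Rightarrow>\<^sub>0 nat)" where
  "right_part \<equiv> Poly_Mapping.map_key Inr"

lemma lookup_left_part [simp]: "lookup (left_part m) x = lookup m (Inl x)"
  by (rule map_key.rep_eq[OF inj_Inl, THEN fun_cong, simplified])

lemma lookup_right_part [simp]: "lookup (right_part m) x = lookup m (Inr x)"
  by (rule map_key.rep_eq[OF inj_Inr, THEN fun_cong, simplified])

lemma subst_monom:
  "subst (u :: 'x::finite \<Rightarrow> ('y, 'k::comm_ring_1) mpoly) (monom m)
    = (\<Prod>x\<in>UNIV. u x ^ lookup m x)"
  unfolding subst_def peval_eq_lin_ext lin_ext_single[OF ring_map_const]
      by (simp add: monom_val_def)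

lemma monom_eq_prod_var:
  "(monom m :: ('x::finite, 'k::comm_ring_1) mpoly) = (\<Prod>x\<in>UNIV. var x ^ lookup m x)"
  using subst_monom[of var m] by simp

lemma monom_split:
  "(monom m :: ('x::finite + 'y::finite, 'k::comm_ring_1) mpoly)
    = in1 (monom (left_part m)) * in2 (monom (right_part m))"
proof -
  have "(monom m :: ('x + 'y, 'k) mpoly)
      = (\<Prod>z\<in>UNIV <+> UNIV. var z ^ lookup m z)"
    by (subst monom_eq_prod_var) simp
  also have "\<dots> = (\<Prod>x\<in>UNIV. var (Inl x) ^ lookup m (Inl x))
      * (\<Prod>y\<in>UNIV. var (Inr y) ^ lookup m (Inr y))"
    by (subst prod.Plus) (auto simp: o_def)
  finally show ?thesis by (simp add: subst_monom)
qed

lemma tensor_induct [case_names zero tensor add]: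
  fixes g :: "('x::finite + 'y::finite, 'k::comm_ring_1) mpoly"
  assumes "P 0" "\<And>a b. P (in1 a * in2 b)" "\<And>p q. P p \<Longrightarrow> P q \<Longrightarrow> P (p + q)"
  shows "P g"
proof (induction g rule: poly_mapping_add_induct)
  case (single m c)
  have "single m c = in1 (const c * monom (left_part m)) * in2 (monom (right_part m))"
    unfolding single_eq_const_mult[of m c] monom_split[of m] by (simp add: subst_mult mult.assoc)
  then show ?case using assms(2) by metis
qed (use assms in auto)

lemma tensor_sum_form:
  fixes g :: "('x::finite + 'y::finite, 'k::comm_ring_1) mpoly"
  shows "\<exists>n a b. g = (\<Sum>i<(n::nat). in1 (a i) * in2 (b i))" (is "?P g")
proof (induction g rule: tensor_induct)
  case zero
  show ?case by (rule exI[of _ 0]) simp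
next
  case (tensor a b)
  show ?case by (rule exI[of _ 1], rule exI[of _ "\<lambda>_. a"], rule exI[of _ "\<lambda>_. b"]) simp
next
  case (add p q)
  have step: "?P (r + in1 c * in2 d)" if "?P r" for r c d
  proof -
    from that obtain n a b where r: "r = (\<Sum>i<(n::nat). in1 (a i) * in2 (b i))" by auto
    have "(\<Sum>i<Suc n. in1 ((a(n := c)) i) * in2 ((b(n := d)) i)) = r + in1 c * in2 d"
      unfolding r by simp
    then show ?thesis by (intro exI) (rule sym)
  qed
  obtain n a b where q: "q = (\<Sum>i<(n::nat). in1 (a i) * in2 (b i))" using add by auto
  have "?P (p + (\<Sum>i<j. in1 (a i) * in2 (b i)))" for j
  proof (induction j)
    case 0 then show ?case using add by simp
  next
    case (Suc j)
    then show ?case using step[OF Suc, of "a j" "b j"] by (simp only: sum.lessThan_Suc add.assoc)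
  qed
  then show ?case unfolding q .
qed

subsection \<open>Slices\<close>

text \<open>
  The map \<open>id \<otimes> \<psi>\<close> on the tensor product, for a linear functional \<open>\<psi>\<close> on the second factor, and
  the map \<open>\<phi> \<otimes> id\<close> for a functional on the first. Testing with slices replaces all arguments with
  bases of tensor products and quotients.
\<close>

definition sliceR ::
  "(('y::finite, 'k::field) mpoly \<Rightarrow> 'k) \<Rightarrow> ('x::finite + 'y, 'k) mpoly \<Rightarrow> ('x, 'k) mpoly" where
  "sliceR \<psi> = lin_ext const (\<lambda>m. monom (left_part m) * const (\<psi> (monom (right_part m))))"

definition sliceL ::
  "(('x::finite, 'k::field) mpoly \<Rightarrow> 'k) \<Rightarrow> ('x + 'y::finite, 'k) mpoly \<Rightarrow> ('y, 'k) mpoly" where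
  "sliceL \<phi> = lin_ext const (\<lambda>m. const (\<phi> (monom (left_part m))) * monom (right_part m))"

lemma sliceR_add: "sliceR \<psi> (p + q) = sliceR \<psi> p + sliceR \<psi> q"
  and sliceL_add: "sliceL \<phi> (p + q) = sliceL \<phi> p + sliceL \<phi> q"
  and sliceR_0: "sliceR \<psi> 0 = 0" and sliceL_0: "sliceL \<phi> 0 = 0"
  by (simp_all add: sliceR_def sliceL_def lin_ext_add[OF ring_map_const] lin_ext_0[OF
      ring_map_const])

lemma sliceR_const_mult: "sliceR \<psi> (const c * p) = const c * sliceR \<psi> p"
  and sliceL_const_mult: "sliceL \<phi> (const c * p) = const c * sliceL \<phi> p"
  by (simp_all add: sliceR_def sliceL_def lin_ext_const_mult[OF ring_map_const])

lemma sliceR_diff: "sliceR \<psi> (p - q) = sliceR \<psi> p - sliceR \<psi> q"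
  using sliceR_add[of \<psi> "p - q" q] by simp

lemma sliceL_diff: "sliceL \<phi> (p - q) = sliceL \<phi> p - sliceL \<phi> q"
  using sliceL_add[of \<phi> "p - q" q] by simp

lemma sliceR_sum: "sliceR \<psi> (sum f A) = (\<Sum>i\<in>A. sliceR \<psi> (f i))"
  by (induction A rule: infinite_finite_induct) (auto simp: sliceR_0 sliceR_add)

lemma sliceL_sum: "sliceL \<phi> (sum f A) = (\<Sum>i\<in>A. sliceL \<phi> (f i))"
  by (induction A rule: infinite_finite_induct) (auto simp: sliceL_0 sliceL_add)

lemma monom_tensor_monom:
  fixes m :: "'x::finite \<Rightarrow>\<^sub>0 nat" and n :: "'y::finite \<Rightarrow>\<^sub>0 nat"
  obtains k where "left_part k = m" "right_part k = n"
    "in1 (monom m) * in2 (monom n) = (monom k :: ('x + 'y, 'k::comm_ring_1) mpoly)"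
proof -
  define k where "k = Abs_poly_mapping (case_sum (lookup m) (lookup n))"
  have "lookup k = case_sum (lookup m) (lookup n)"
    unfolding k_def by (rule lookup_Abs_poly_mapping) simp
  then have k: "left_part k = m" "right_part k = n"
    by (auto intro!: poly_mapping_eqI)
  then show ?thesis
    using that[OF k] monom_split[of k, where ?'k = 'k] by simp
qed

lemma lin_ext_tensor:
  fixes a :: "('x::finite, 'k::comm_ring_1) mpoly" and b :: "('y::finite, 'k) mpoly"
  shows "lin_ext const (\<lambda>m. v (left_part m) * w (right_part m)) (in1 a * in2 b)
    = lin_ext const v a * (lin_ext const w b :: ('z, 'k) mpoly)"
proof (induction a rule: poly_mapping_add_induct)
  case zero then show ?case by (simp add: subst_0 lin_ext_0[OF ring_map_const])
next
  case (single m c)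
  show ?case
  proof (induction b rule: poly_mapping_add_induct)
    case zero then show ?case by (simp add: subst_0 lin_ext_0[OF ring_map_const])
  next
    case (single n d)
    obtain k where k: "left_part k = m" "right_part k = n"
      "in1 (monom m) * in2 (monom n) = (monom k :: ('x + 'y, 'k) mpoly)"
      using monom_tensor_monom[of m n] by metis
    have "in1 (single m c) * in2 (single n d)
        = const (c * d) * (in1 (monom m) * in2 (monom n) :: ('x + 'y, 'k) mpoly)"
      unfolding single_eq_const_mult[of m c] single_eq_const_mult[of n d]
      by (simp add: subst_mult const_mult)
    then show ?case
      unfolding k(3) by (simp only: lin_ext_const_mult[OF ring_map_const]
          lin_ext_single[OF ring_map_const] k(1,2) const_mult const_1 mult_1 mult.assoc
              mult.left_commute)
  next
    case (add p q)
    then show ?case by (simp add: subst_add distrib_left lin_ext_add[OF ring_map_const])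
  qed
next
  case (add p q)
  then show ?case by (simp add: subst_add distrib_right lin_ext_add[OF ring_map_const])
qed

lemma lin_ext_monom: "lin_ext const monom p = (p :: ('x, 'k::comm_ring_1) mpoly)"
  by (induction p rule: poly_mapping_add_induct)
     (simp_all add: lin_ext_0[OF ring_map_const] lin_ext_add[OF ring_map_const]
       lin_ext_single[OF ring_map_const] flip: single_eq_const_mult)

lemma lin_ext_lin_form:
  assumes "lin_form \<psi>"
  shows "lin_ext const (\<lambda>m. const (\<psi> (monom m))) p = const (\<psi> p)"
proof (induction p rule: poly_mapping_add_induct)
  case (single m c)
  show ?case unfolding single_eq_const_mult[of m c]
    by (simp add: lin_ext_const_mult[OF ring_map_const] lin_ext_single[OF ring_map_const]
        lin_form_scale[OF assms] const_mult)
qed (simp_all add: lin_ext_0[OF ring_map_const] lin_ext_add[OF ring_map_const] lin_form_0[OF assms]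
    lin_form_add[OF assms] const_add)

lemma sliceR_tensor: "lin_form \<psi> \<Longrightarrow> sliceR \<psi> (in1 a * in2 b) = const (\<psi> b) * a"
  unfolding sliceR_def
  by (subst lin_ext_tensor[where v = monom])
     (simp add: lin_ext_monom lin_ext_lin_form mult.commute)

lemma sliceL_tensor: "lin_form \<phi> \<Longrightarrow> sliceL \<phi> (in1 a * in2 b) = const (\<phi> a) * b"
  unfolding sliceL_def
  by (subst lin_ext_tensor[where w = monom]) (simp add: lin_ext_monom lin_ext_lin_form)

text \<open>
  Both sides are the value of \<open>\<phi> \<otimes> \<psi>\<close>. This transfers statements about slices on one side to the
  other side.
\<close>

lemma slice_pairing:
  assumes "lin_form \<phi>" "lin_form \<psi>"
  shows "\<phi> (sliceR \<psi> g) = \<psi> (sliceL \<phi> g)"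
proof (induction g rule: tensor_induct)
  case (tensor a b)
  then show ?case
    using assms by (simp add: sliceR_tensor sliceL_tensor lin_form_scale)
qed (use assms in \<open>simp_all add: sliceR_0 sliceL_0 lin_form_0 sliceR_add sliceL_add lin_form_add\<close>)

subsection \<open>The ideal of a product\<close>

lemma is_ideal_prod_ideal: "is_ideal (prod_ideal I J)"
  unfolding prod_ideal_def by (rule is_ideal_ideal_gen)

lemma in1_mem_prod_ideal: "f \<in> I \<Longrightarrow> in1 f \<in> prod_ideal I J"
  unfolding prod_ideal_def by (rule ideal_gen_base) auto

lemma in2_mem_prod_ideal: "f \<in> J \<Longrightarrow> in2 f \<in> prod_ideal I J"
  unfolding prod_ideal_def by (rule ideal_gen_base) auto

lemma prod_ideal_mono: "I \<subseteq> I' \<Longrightarrow> J \<subseteq> J' \<Longrightarrow> prod_ideal I J \<subseteq> prod_ideal I' J'"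
  unfolding prod_ideal_def by (rule ideal_gen_mono) auto

lemma ring_map_prod_ideal:
  assumes "ring_map F" "is_ideal K" "\<And>f. f \<in> I \<Longrightarrow> F (in1 f) \<in> K" "\<And>f. f \<in> J \<Longrightarrow> F (in2 f) \<in> K"
    and "g \<in> prod_ideal I J"
  shows "F g \<in> K"
proof -
  have "prod_ideal I J \<subseteq> F -` K"
    unfolding prod_ideal_def
    by (rule ideal_gen_least) (use assms in \<open>auto intro: ring_map_vimage_ideal\<close>)
  then show ?thesis using assms(5) by auto
qed

lemma subst_prod_ideal:
  fixes u :: "'x::finite \<Rightarrow> ('z, 'k::comm_ring_1) mpoly" and v :: "'y::finite \<Rightarrow> ('z, 'k) mpoly"
  assumes "is_ideal K" "\<And>f. f \<in> I \<Longrightarrow> subst u f \<in> K" "\<And>f. f \<in> J \<Longrightarrow> subst v f \<in> K"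
    and "g \<in> prod_ideal I J"
  shows "subst (case_sum u v) g \<in> K"
  by (rule ring_map_prod_ideal[OF ring_map_subst]) (use assms in \<open>auto simp: subst_subst\<close>)

lemma sliceR_mem:
  assumes I: "is_ideal I" and J: "is_ideal J" and \<psi>: "\<psi> \<in> annih J" and g: "g \<in> prod_ideal I J"
  shows "sliceR \<psi> g \<in> I"
proof -
  have \<psi>': "lin_form \<psi>" using \<psi> by (auto simp: annih_def)
  have 1: "sliceR \<psi> (c * in1 a) \<in> I" if "a \<in> I" for c a
  proof (induction c rule: tensor_induct)
    case (tensor p q)
    have "in1 p * in2 q * in1 a = in1 (p * a) * in2 q"
      by (simp add: subst_mult algebra_simps)
    then show ?case using that by (simp add: sliceR_tensor[OF \<psi>'] ideal_mult_left[OF I])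
  qed (simp_all add: sliceR_0 distrib_right sliceR_add ideal_0[OF I] ideal_add[OF I])
  have 2: "sliceR \<psi> (c * in2 b) \<in> I" if "b \<in> J" for c b
  proof (induction c rule: tensor_induct)
    case (tensor p q)
    have "in1 p * in2 q * in2 b = in1 p * in2 (q * b)"
      by (simp add: subst_mult algebra_simps)
    moreover have "\<psi> (q * b) = 0" using ideal_mult_left[OF J that] \<psi> by (auto simp: annih_def)
    ultimately show ?case by (simp add: sliceR_tensor[OF \<psi>'] ideal_0[OF I])
  qed (simp_all add: sliceR_0 distrib_right sliceR_add ideal_0[OF I] ideal_add[OF I])
  show ?thesis using g unfolding prod_ideal_def
    by (induction rule: ideal_gen_induct)
       (auto simp: sliceR_0 sliceR_add ideal_0[OF I] intro!: ideal_add[OF I] 1 2)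
qed

text \<open>
  A representation of \<open>g\<close> modulo \<open>prod_ideal I J\<close> as a sum of as few tensors \<open>a i \<otimes> b i\<close> as
  possible has \<open>b\<close> linearly independent modulo \<open>J\<close>, so that each \<open>a i\<close> is a slice of \<open>g\<close> modulo
  \<open>I\<close>.
\<close>

lemma mem_prod_idealI_sliceR:
  fixes g :: "('x::finite + 'y::finite, 'k::field) mpoly"
  assumes I: "is_ideal I" and J: "is_ideal J" and g: "\<And>\<psi>. \<psi> \<in> annih J \<Longrightarrow> sliceR \<psi> g \<in> I"
  shows "g \<in> prod_ideal I J"
proof -
  let ?P = "\<lambda>n. \<exists>a b. cong_mod (prod_ideal I J) g (\<Sum>i<(n::nat). in1 (a i) * in2 (b i))"
  obtain n0 a0 b0 where "g = (\<Sum>i<(n0::nat). in1 (a0 i) * in2 (b0 i))"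
    using tensor_sum_form[of g] by auto
  then have "?P n0"
    using cong_mod_refl[OF is_ideal_prod_ideal, of I J g] by auto
  then have ex: "\<exists>n. ?P n" ..
  define n where "n = (LEAST n. ?P n)"
  have "?P n" unfolding n_def by (rule LeastI_ex[OF ex])
  then obtain a b where ab: "cong_mod (prod_ideal I J) g (\<Sum>i<n. in1 (a i) * in2 (b i))" by auto
  have "n = 0"
  proof (rule ccontr)
    assume "n \<noteq> 0"
    then obtain l where n: "n = Suc l" by (cases n) auto
    have "b l - (\<Sum>i\<in>{..<l}. const (c i) * b i) \<notin> J" for c
    proof
      assume c: "b l - (\<Sum>i<l. const (c i) * b i) \<in> J"
      let ?r = "b l - (\<Sum>i<l. const (c i) * b i)"
      let ?a' = "\<lambda>i. a i + const (c i) * a l"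
      have "in1 (?a' i) * in2 (b i) = in1 (a i) * in2 (b i) + in1 (a l) * (const (c i) * in2 (b
          i))" for i
        by (simp only: subst_add subst_mult subst_const distrib_right) (simp only: mult.assoc
            mult.left_commute)
      then have "(\<Sum>i<l. in1 (?a' i) * in2 (b i))
          = (\<Sum>i<l. in1 (a i) * in2 (b i)) + in1 (a l) * (\<Sum>i<l. const (c i) * in2 (b i))"
        by (simp only: sum.distrib sum_distrib_left)
      moreover have "(in2 ?r :: ('x + 'y, 'k) mpoly) = in2 (b l) - (\<Sum>i<l. const (c i) * in2 (b i))"
        by (simp only: subst_diff subst_sum subst_mult subst_const)
      ultimately have "(\<Sum>i<n. in1 (a i) * in2 (b i)) - (\<Sum>i<l. in1 (?a' i) * in2 (b i))
          = in1 (a l) * in2 ?r"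
        unfolding n sum.lessThan_Suc by (simp only: right_diff_distrib) simp
      moreover have "in1 (a l) * in2 ?r \<in> prod_ideal I J"
        by (rule ideal_mult_left[OF is_ideal_prod_ideal in2_mem_prod_ideal[OF c]])
      ultimately have "cong_mod (prod_ideal I J) (\<Sum>i<n. in1 (a i) * in2 (b i)) (\<Sum>i<l. in1 (?a' i)
          * in2 (b i))"
        by (simp add: cong_mod_def)
      from cong_mod_trans[OF is_ideal_prod_ideal ab this] have "?P l" by (intro exI)
      then have "n \<le> l" unfolding n_def by (rule Least_le)
      then show False using n by simp
    qed
    then obtain \<psi> where \<psi>J: "\<psi> \<in> annih J" and \<psi>l: "\<psi> (b l) = 1"
      and \<psi>b: "\<And>i. i \<in> {..<l} \<Longrightarrow> \<psi> (b i) = 0"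
      by (rule separating_form_modulo[OF J finite_lessThan, of "b l" b]) blast
    then have lf: "lin_form \<psi>" by (auto simp: annih_def)
    have "sliceR \<psi> (\<Sum>i<n. in1 (a i) * in2 (b i)) = a l"
      unfolding n by (simp add: sliceR_add sliceR_sum sliceR_tensor[OF lf] \<psi>b \<psi>l)
    moreover have "sliceR \<psi> (g - (\<Sum>i<n. in1 (a i) * in2 (b i))) \<in> I"
      using sliceR_mem[OF I J \<psi>J] ab by (simp add: cong_mod_def)
    ultimately have "a l \<in> I"
      using ideal_diff[OF I g[OF \<psi>J], of "sliceR \<psi> (g - (\<Sum>i<n. in1 (a i) * in2 (b i)))"]
      by (simp add: sliceR_diff)
    then have "in1 (a l) * in2 (b l) \<in> prod_ideal I J"
      by (intro ideal_mult_right[OF is_ideal_prod_ideal] in1_mem_prod_ideal)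
    then have "cong_mod (prod_ideal I J) (\<Sum>i<n. in1 (a i) * in2 (b i)) (\<Sum>i<l. in1 (a i) * in2 (b
        i))"
      unfolding n by (simp add: cong_mod_def)
    from cong_mod_trans[OF is_ideal_prod_ideal ab this] have "?P l" by (intro exI)
    then have "n \<le> l" unfolding n_def by (rule Least_le)
    then show False using n by simp
  qed
  then show ?thesis using ab by (simp add: cong_mod_def)
qed

lemma mem_prod_ideal_iff_sliceR:
  assumes "is_ideal I" "is_ideal J"
  shows "g \<in> prod_ideal I J \<longleftrightarrow> (\<forall>\<psi>\<in>annih J. sliceR \<psi> g \<in> I)"
  using assms by (auto intro: sliceR_mem mem_prod_idealI_sliceR)

lemma mem_prod_ideal_iff_sliceL:
  assumes I: "is_ideal I" and J: "is_ideal J"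
  shows "g \<in> prod_ideal I J \<longleftrightarrow> (\<forall>\<phi>\<in>annih I. sliceL \<phi> g \<in> J)"
proof -
  have pair: "\<phi> (sliceR \<psi> g) = \<psi> (sliceL \<phi> g)" if "\<phi> \<in> annih I" "\<psi> \<in> annih J" for \<phi> \<psi>
    using that slice_pairing[of \<phi> \<psi> g] by (auto simp: annih_def)
  have "g \<in> prod_ideal I J \<longleftrightarrow> (\<forall>\<psi>\<in>annih J. \<forall>\<phi>\<in>annih I. \<phi> (sliceR \<psi> g) = 0)"
    unfolding mem_prod_ideal_iff_sliceR[OF I J] mem_iff_annih[OF is_ideal_mp_subspace[OF I]] ..
  also have "\<dots> \<longleftrightarrow> (\<forall>\<phi>\<in>annih I. \<forall>\<psi>\<in>annih J. \<psi> (sliceL \<phi> g) = 0)"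
    using pair by (metis (full_types))
  also have "\<dots> \<longleftrightarrow> (\<forall>\<phi>\<in>annih I. sliceL \<phi> g \<in> J)"
    unfolding mem_iff_annih[OF is_ideal_mp_subspace[OF J]] ..
  finally show ?thesis .
qed

lemma sliceL_mem:
  "is_ideal I \<Longrightarrow> is_ideal J \<Longrightarrow> \<phi> \<in> annih I \<Longrightarrow> g \<in> prod_ideal I J \<Longrightarrow> sliceL \<phi> g \<in> J"
  using mem_prod_ideal_iff_sliceL by metis

lemma lin_form_subst:
  fixes v :: "'x::finite \<Rightarrow> ('y::finite, 'k::field) mpoly"
  shows "lin_form \<psi> \<Longrightarrow> lin_form (\<lambda>f. \<psi> (subst v f))"
  by (auto simp: lin_form_def subst_add subst_mult)

lemma sliceR_subst:
  fixes u :: "'x::finite \<Rightarrow> ('z::finite, 'k::field) mpoly" and v :: "'y::finite \<Rightarrow> ('w::finite, 'k)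
      mpoly"
  assumes \<psi>: "lin_form \<psi>"
  shows "sliceR \<psi> (subst (case_sum (\<lambda>x. in1 (u x)) (\<lambda>y. in2 (v y))) g)
    = subst u (sliceR (\<lambda>f. \<psi> (subst v f)) g)"
proof (induction g rule: tensor_induct)
  case (tensor a b)
  have "subst (case_sum (\<lambda>x. in1 (u x)) (\<lambda>y. in2 (v y))) (in1 a * in2 b)
      = in1 (subst u a) * in2 (subst v b)"
    by (simp add: subst_mult subst_subst)
  then show ?case by (simp add: sliceR_tensor[OF \<psi>] sliceR_tensor[OF lin_form_subst[OF \<psi>]]
      subst_mult)
qed (simp_all add: subst_0 sliceR_0 subst_add sliceR_add)

text \<open>
  Tensor products of injections are injective. A functional \<open>\<psi>\<close> that kills \<open>M\<close> gives the
  functional \<open>\<psi> \<circ> subst v\<close>, whose slices of \<open>g\<close> lie in the first preimage. Instead of extending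
  all functionals along \<open>v\<close>, the proof continues with slices on the other side.
\<close>

lemma prod_ideal_vimage:
  fixes u :: "'x::finite \<Rightarrow> ('z::finite, 'k::field) mpoly" and v :: "'y::finite \<Rightarrow> ('w::finite, 'k)
      mpoly"
  assumes K: "is_ideal K" and M: "is_ideal M"
    and g: "subst (case_sum (\<lambda>x. in1 (u x)) (\<lambda>y. in2 (v y))) g \<in> prod_ideal K M"
  shows "g \<in> prod_ideal {f. subst u f \<in> K} {f. subst v f \<in> M}"
proof -
  have I: "is_ideal {f. subst u f \<in> K}" and J: "is_ideal {f. subst v f \<in> M}"
    using ring_map_vimage_ideal[OF ring_map_subst K, of u] ring_map_vimage_ideal[OF
        ring_map_subst M, of v]
    by (simp_all add: vimage_def)
  show ?thesis unfolding mem_prod_ideal_iff_sliceL[OF I J]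
  proof
    fix \<phi> assume \<phi>: "\<phi> \<in> annih {f. subst u f \<in> K}"
    have "\<psi> (subst v (sliceL \<phi> g)) = 0" if \<psi>: "\<psi> \<in> annih M" for \<psi>
    proof -
      have lf: "lin_form \<psi>" "lin_form \<phi>" using \<psi> \<phi> by (auto simp: annih_def)
      have "subst u (sliceR (\<lambda>f. \<psi> (subst v f)) g) \<in> K"
        using sliceR_mem[OF K M \<psi> g] by (simp add: sliceR_subst[OF lf(1)])
      then have "\<phi> (sliceR (\<lambda>f. \<psi> (subst v f)) g) = 0" using \<phi> by (auto simp: annih_def)
      then show ?thesis using slice_pairing[OF lf(2) lin_form_subst[OF lf(1)]] by metis
    qed
    then show "sliceL \<phi> g \<in> {f. subst v f \<in> M}"
      using mem_iff_annih[OF is_ideal_mp_subspace[OF M]] by auto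
  qed
qed

text \<open>
  A functional that kills \<open>J n\<close> kills all later \<open>J m\<close>, so its slices of \<open>g\<close> lie in the
  intersection of the \<open>I m\<close>. The functionals that kill only the intersection of the \<open>J n\<close> are not
  reached in this way, so the second half of the proof slices on the other side, by functionals
  that kill the intersection of the \<open>I n\<close>.
\<close>

lemma prod_ideal_INT:
  fixes I :: "nat \<Rightarrow> ('x::finite, 'k::field) mpoly set" and J :: "nat \<Rightarrow> ('y::finite, 'k) mpoly set"
  assumes I: "\<And>n. is_ideal (I n)" and J: "\<And>n. is_ideal (J n)"
    and dI: "decseq I" and dJ: "decseq J" and g: "\<And>n. g \<in> prod_ideal (I n) (J n)"
  shows "g \<in> prod_ideal (\<Inter>n. I n) (\<Inter>n. J n)"
proof -
  have II: "is_ideal (\<Inter>n. I n)" and JJ: "is_ideal (\<Inter>n. J n)"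
    using I J by (auto intro!: is_ideal_Inter)
  have 1: "sliceR \<psi> g \<in> I m" if \<psi>: "\<psi> \<in> annih (J n)" for \<psi> n m
  proof -
    have "J (max m n) \<subseteq> J n" "I (max m n) \<subseteq> I m"
      using dJ dI by (auto simp: decseq_def)
    then show ?thesis using sliceR_mem[OF I J _ g, of \<psi> "max m n"] \<psi> annih_antimono by blast
  qed
  show ?thesis unfolding mem_prod_ideal_iff_sliceL[OF II JJ]
  proof (intro ballI INT_I)
    fix \<phi> n assume \<phi>: "\<phi> \<in> annih (\<Inter>n. I n)"
    have "\<psi> (sliceL \<phi> g) = 0" if \<psi>: "\<psi> \<in> annih (J n)" for \<psi>
    proof -
      have lf: "lin_form \<psi>" "lin_form \<phi>" using \<psi> \<phi> by (auto simp: annih_def)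
      have "\<phi> (sliceR \<psi> g) = 0" using 1[OF \<psi>] \<phi> by (auto simp: annih_def)
      then show ?thesis using slice_pairing[OF lf(2,1)] by metis
    qed
    then show "sliceL \<phi> g \<in> J n"
      using mem_iff_annih[OF is_ideal_mp_subspace[OF J]] by auto
  qed
qed

section \<open>Hilbert's basis theorem\<close>

lemma incseq_subseq_nat:
  fixes f :: "nat \<Rightarrow> nat"
  shows "\<exists>r. strict_mono r \<and> incseq (\<lambda>n. f (r n))"
proof -
  obtain r where r: "strict_mono r" "monoseq (\<lambda>n. f (r n))"
    using seq_monosub[of f] by auto
  show ?thesis
  proof (cases "incseq (\<lambda>n. f (r n))")
    case True then show ?thesis using r by auto
  next
    case False
    then have dec: "decseq (\<lambda>n. f (r n))"
      using r(2) unfolding monoseq_iff by simp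
    obtain N where N: "\<And>n. f (r N) \<le> f (r n)"
      using ex_has_least_nat[of "\<lambda>_. True" _ "\<lambda>n. f (r n)"] by auto
    have "f (r (N + n)) = f (r N)" for n
      using N[of "N + n"] decseqD[OF dec, of N "N + n"] by simp
    then have "incseq (\<lambda>n. f (r (N + n)))" by (simp add: incseq_def)
    moreover have "strict_mono (\<lambda>n. r (N + n))"
      using r(1) by (simp add: strict_mono_def)
    ultimately show ?thesis by blast
  qed
qed

lemma incseq_subseq_family:
  fixes s :: "nat \<Rightarrow> 'z \<Rightarrow> nat"
  assumes "finite Z"
  shows "\<exists>r. strict_mono r \<and> (\<forall>z\<in>Z. incseq (\<lambda>n. s (r n) z))"
  using assms
proof (induction Z rule: finite_induct)
  case empty
  show ?case by (rule exI[of _ id]) (simp add: strict_mono_def)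
next
  case (insert z Z)
  then obtain r where r: "strict_mono r" "\<And>z. z \<in> Z \<Longrightarrow> incseq (\<lambda>n. s (r n) z)" by auto
  obtain t where t: "strict_mono t" "incseq (\<lambda>n. s (r (t n)) z)"
    using incseq_subseq_nat[of "\<lambda>n. s (r n) z"] by auto
  have "incseq (\<lambda>n. s (r (t n)) y)" if "y \<in> Z" for y
    unfolding incseq_def using r(2)[OF that] t(1) by (simp add: incseq_def strict_mono_less_eq)
  moreover have "strict_mono (\<lambda>n. r (t n))"
    using r(1) t(1) by (simp add: strict_mono_def)
  ultimately show ?case using t(2) by (intro exI[of _ "\<lambda>n. r (t n)"]) auto
qed

text \<open>
  Dickson's lemma. The minimal elements form an antichain, and an infinite antichain would contain
  a sequence of distinct monomials, two of which are comparable by the previous lemma.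
\<close>

lemma finite_minimal_monomials:
  fixes A :: "('z::finite \<Rightarrow>\<^sub>0 nat) set"
  shows "\<exists>F. finite F \<and> F \<subseteq> A \<and>
    (\<forall>a\<in>A. \<exists>f\<in>F. \<forall>z. lookup f z \<le> lookup a z)"
proof -
  let ?le = "\<lambda>f a. \<forall>z. lookup f z \<le> lookup a z"
  define F where "F = {a\<in>A. \<forall>b\<in>A. ?le b a \<longrightarrow> b = a}"
  have "finite F"
  proof (rule ccontr)
    assume "infinite F"
    then obtain s :: "nat \<Rightarrow> 'z \<Rightarrow>\<^sub>0 nat" where s: "inj s" "range s \<subseteq> F"
      using infinite_countable_subset by blast
    obtain r where r: "strict_mono r" "\<forall>z\<in>UNIV. incseq (\<lambda>n. lookup (s (r n)) z)"
      using incseq_subseq_family[of UNIV "\<lambda>n. lookup (s n)"] by auto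
    have "?le (s (r 0)) (s (r 1))"
      using r(2) by (auto simp: incseq_def)
    moreover have "s (r 0) \<in> A" "s (r 1) \<in> F" using s(2) by (auto simp: F_def)
    ultimately have "s (r 0) = s (r 1)" unfolding F_def by blast
    then have "r 0 = r 1" using s(1) by (simp add: inj_eq)
    then show False using strict_monoD[OF r(1), of 0 1] by simp
  qed
  moreover have "\<exists>f\<in>F. ?le f a" if "a \<in> A" for a
    using that
  proof (induction "\<Sum>z\<in>UNIV. lookup a z" arbitrary: a rule: less_induct)
    case less
    show ?case
    proof (cases "a \<in> F")
      case True then show ?thesis by auto
    next
      case False
      then obtain b where b: "b \<in> A" "?le b a" "b \<noteq> a" using less.prems by (auto simp: F_def)
      then obtain z where "lookup b z \<noteq> lookup a z"
        using poly_mapping_eqI[of b a] by auto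
      then have "lookup b z < lookup a z" using b(2) le_neq_implies_less by blast
      then have "(\<Sum>z\<in>UNIV. lookup b z) < (\<Sum>z\<in>UNIV. lookup a z)"
        using b(2) by (intro sum_strict_mono_ex1) auto
      then obtain f where "f \<in> F" "?le f b" using less.hyps[of b] b(1) by auto
      then show ?thesis using b(2) order_trans by blast
    qed
  qed
  ultimately show ?thesis by (intro exI[of _ F]) (auto simp: F_def)
qed

text \<open>
  Sending the variables to distinct primes orders the monomials by natural numbers: the order is
  well-founded and total for free, and it is compatible with multiplication.
\<close>

lemma multiplicative_monomial_order:
  obtains N :: "('z::finite \<Rightarrow>\<^sub>0 nat) \<Rightarrow> nat"
  where "inj N" "\<And>m n. N (m + n) = N m * N n"
proof -
  obtain g :: "'z \<Rightarrow> nat" where g: "inj g"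
    using finite_imp_inj_to_nat_seg[of "UNIV :: 'z set"] by auto
  define pr where "pr z = enumerate {p::nat. prime p} (g z)" for z
  have inf: "infinite {p::nat. prime p}" by (rule primes_infinite)
  have pr: "prime (pr z)" for z
    using enumerate_in_set[OF inf] by (simp add: pr_def)
  have inj_pr: "inj pr"
    using g strict_mono_eq[OF strict_mono_enumerate[OF inf]] by (auto simp: inj_def pr_def)
  define N where "N m = (\<Prod>z\<in>UNIV. pr z ^ lookup m z)" for m :: "'z \<Rightarrow>\<^sub>0 nat"
  have mult: "multiplicity (pr z) (N m) = lookup m z" for z m
  proof -
    have *: "N m = (\<Prod>p\<in>range pr. p ^ lookup m (inv_into UNIV pr p))"
      unfolding N_def by (subst prod.reindex[OF inj_pr]) (simp add: inv_into_f_f[OF inj_pr])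
    have "multiplicity (pr z) (N m)
        = (if pr z \<in> range pr then lookup m (inv_into UNIV pr (pr z)) else 0)"
      using pr by (subst *, subst multiplicity_prod_prime_powers) auto
    then show ?thesis by (simp add: inv_into_f_f[OF inj_pr])
  qed
  have "inj N"
    by (rule injI) (metis mult poly_mapping_eqI)
  moreover have "N (m + n) = N m * N n" for m n
    by (simp add: N_def lookup_add power_add prod.distrib)
  ultimately show ?thesis using that by blast
qed

lemma lookup_single_mult:
  fixes g :: "('z, 'k::comm_ring_1) mpoly"
  shows "lookup (single d c * g) (d + k) = c * lookup g k"
proof (induction g rule: poly_mapping_add_induct)
  case (single m e)
  then show ?case by (simp add: mult_single lookup_single when_def)
qed (simp_all add: distrib_left lookup_add)

lemma keys_single_mult:
  fixes g :: "('z, 'k::comm_ring_1) mpoly"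
  assumes "n \<in> keys (single d c * g)"
  obtains k where "k \<in> keys g" "n = d + k"
  using assms keys_mult[of "single d c" g] by (force split: if_splits)

text \<open>
  Division with remainder: by Dickson's lemma finitely many elements of \<open>I\<close> suffice for the
  leading monomial of each element of \<open>I\<close> to be divisible by the leading monomial of one of them.
  Subtracting a multiple of that one lowers the leading monomial.
\<close>

theorem hilbert_basis:
  fixes I :: "('z::finite, 'k::field) mpoly set"
  assumes I: "is_ideal I"
  obtains G where "finite G" "G \<subseteq> I" "ideal_gen G = I"
proof -
  obtain N :: "('z \<Rightarrow>\<^sub>0 nat) \<Rightarrow> nat" where N: "inj N" "\<And>m n. N (m + n) = N m * N n"
    using multiplicative_monomial_order by blast
  \<comment> \<open>the leading monomials of \<open>I\<close>, with monic witnesses\<close>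
  let ?lead = "\<lambda>f m. f \<in> I \<and> lookup f m = 1 \<and> (\<forall>n\<in>keys f. N n \<le> N m)"
  obtain F where F: "finite F" "F \<subseteq> {m. \<exists>f. ?lead f m}"
    "\<forall>a\<in>{m. \<exists>f. ?lead f m}. \<exists>f\<in>F. \<forall>z. lookup f z \<le> lookup a z"
    using finite_minimal_monomials[of "{m. \<exists>f. ?lead f m}"] by blast
  then have "\<forall>m\<in>F. \<exists>f. ?lead f m" by blast
  then obtain g where g: "\<forall>m\<in>F. ?lead (g m) m" by (rule bchoice[THEN exE])
  have "f \<in> ideal_gen (g ` F)" if "f \<in> I" "\<forall>n\<in>keys f. N n < b" for f b
    using that
  proof (induction b arbitrary: f)
    case 0
    then have "keys f = {}" by auto
    then show ?case using ideal_0[OF is_ideal_ideal_gen] by simp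
  next
    case (Suc b)
    show ?case
    proof (cases "\<exists>m\<in>keys f. N m = b")
      case False
      then have "\<forall>n\<in>keys f. N n < b" using Suc.prems(2) less_Suc_eq by blast
      then show ?thesis using Suc by blast
    next
      case True
      then obtain m where m: "m \<in> keys f" "N m = b" by blast
      define c where "c = lookup f m"
      have c: "c \<noteq> 0" using m by (simp add: c_def in_keys_iff)
      have lk: "lookup (const d * f) n = d * lookup f n" for d n
        using lookup_single_mult[of 0 d f n] by (simp add: const_def)
      have "?lead (const (inverse c) * f) m"
      proof (intro conjI ballI)
        show "const (inverse c) * f \<in> I" by (rule ideal_mult_left[OF I Suc.prems(1)])
        show "lookup (const (inverse c) * f) m = 1" using c by (simp add: lk c_def)
      next
        fix n assume "n \<in> keys (const (inverse c) * f)"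
        then have "n \<in> keys f" by (simp add: in_keys_iff lk)
        then show "N n \<le> N m" using Suc.prems(2) m by (auto simp: less_Suc_eq_le)
      qed
      then obtain k where k: "k \<in> F" "\<forall>z. lookup k z \<le> lookup m z"
        using F(3) by blast
      have m_eq: "m = (m - k) + k"
        by (rule poly_mapping_eqI) (use k(2) in \<open>simp add: lookup_add lookup_minus\<close>)
      define h where "h = single (m - k) c * g k"
      have gk: "?lead (g k) k" using g k(1) by blast
      have "lookup h m = c"
        unfolding h_def by (subst m_eq, subst lookup_single_mult) (use gk in simp)
      have N_h: "N n \<le> b" if "n \<in> keys h" for n
      proof -
        obtain j where j: "j \<in> keys (g k)" "n = (m - k) + j"
          using \<open>n \<in> keys h\<close> unfolding h_def by (rule keys_single_mult)
        have "N n = N (m - k) * N j" using j N(2) by simp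
        also have "\<dots> \<le> N (m - k) * N k" using gk j(1) by simp
        also have "\<dots> = b" using m(2) N(2)[of "m - k" k] m_eq by simp
        finally show ?thesis .
      qed
      have "\<forall>n\<in>keys (f - h). N n < b"
      proof
        fix n assume n: "n \<in> keys (f - h)"
        then have "n \<in> keys f \<or> n \<in> keys h"
          by (auto simp: in_keys_iff lookup_minus)
        then have "N n \<le> b" using N_h Suc.prems(2) less_Suc_eq_le by blast
        moreover have "n \<noteq> m"
          using n \<open>lookup h m = c\<close> by (auto simp: in_keys_iff lookup_minus c_def)
        then have "N n \<noteq> b" using N(1) m(2) by (auto simp: inj_eq)
        ultimately show "N n < b" by simp
      qed
      moreover have "f - h \<in> I"
        unfolding h_def using gk Suc.prems(1) by (intro ideal_diff[OF I] ideal_mult_left[OF I]) auto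
      ultimately have "f - h \<in> ideal_gen (g ` F)" by (intro Suc.IH) auto
      moreover have "h \<in> ideal_gen (g ` F)"
        unfolding h_def using k(1) by (intro ideal_mult_left[OF is_ideal_ideal_gen]
            ideal_gen_base) auto
      ultimately show ?thesis by (rule ideal_diffD[OF is_ideal_ideal_gen])
    qed
  qed
  then have "I \<subseteq> ideal_gen (g ` F)"
  proof (intro subsetI)
    fix f assume f: "f \<in> I"
    have "\<forall>n\<in>keys f. N n < Suc (Max (N ` keys f))"
      by (auto intro!: le_imp_less_Suc Max_ge)
    then show "f \<in> ideal_gen (g ` F)"
      using f \<open>\<And>f b. f \<in> I \<Longrightarrow> \<forall>n\<in>keys f. N n < b \<Longrightarrow> f \<in> ideal_gen (g ` F)\<close> by blast
  qed
  moreover have "g ` F \<subseteq> I" using g by blast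
  ultimately have "ideal_gen (g ` F) = I" using ideal_gen_least[OF _ I] by blast
  then show ?thesis using that[of "g ` F"] F(1) \<open>g ` F \<subseteq> I\<close> by simp
qed

lemma ideal_chain_stabilises:
  fixes I :: "nat \<Rightarrow> ('z::finite, 'k::field) mpoly set"
  assumes I: "\<And>n. is_ideal (I n)" and inc: "incseq I"
  obtains N where "\<And>n. n \<ge> N \<Longrightarrow> I n = I N"
proof -
  have mono: "I m \<subseteq> I n" if "m \<le> n" for m n using inc that by (auto simp: incseq_def)
  have "is_ideal (\<Union>n. I n)"
  proof (rule is_idealI)
    fix a b assume "a \<in> (\<Union>n. I n)" "b \<in> (\<Union>n. I n)"
    then obtain m n where "a \<in> I m" "b \<in> I n" by auto
    then have "a \<in> I (max m n)" "b \<in> I (max m n)"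
        using mono[of m "max m n"] mono[of n "max m n"] by auto
    then show "a + b \<in> (\<Union>n. I n)" using ideal_add[OF I] by blast
  qed (use ideal_0[OF I] ideal_mult_left[OF I] in blast)+
  then obtain G where G: "finite G" "G \<subseteq> (\<Union>n. I n)" "ideal_gen G = (\<Union>n. I n)"
    by (rule hilbert_basis)
  have "\<exists>N. G \<subseteq> I N"
    using G(1,2)
  proof (induction G rule: finite_induct)
    case (insert a G)
    then obtain m n where "a \<in> I m" "G \<subseteq> I n" by auto
    then have "insert a G \<subseteq> I (max m n)" using mono[of m "max m n"] mono[of n "max m n"] by auto
    then show ?case ..
  qed auto
  then obtain N where "G \<subseteq> I N" ..
  then have "(\<Union>n. I n) \<subseteq> I N" using G(3) ideal_gen_least[OF _ I] by metis
  then have "I n = I N" if "n \<ge> N" for n using mono[OF that] by blast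
  then show ?thesis using that by blast
qed

section \<open>Krull's intersection theorem\<close>

lemma ideal_gen_Un_image:
  assumes I: "is_ideal I" and A: "finite A" and f: "f \<in> ideal_gen (I \<union> g ` A)"
  shows "\<exists>c. f - (\<Sum>j\<in>A. c j * g j) \<in> I"
  using f
proof (induction rule: ideal_gen_induct)
  case zero
  show ?case by (rule exI[of _ "\<lambda>_. 0"]) (simp add: ideal_0[OF I])
next
  case (step d s b)
  then obtain c where c: "b - (\<Sum>j\<in>A. c j * g j) \<in> I" by blast
  from step(1) show ?case
  proof
    assume "s \<in> I"
    then have "d * s + (b - (\<Sum>j\<in>A. c j * g j)) \<in> I" using c
        by (intro ideal_add[OF I] ideal_mult_left[OF I])
    then show ?thesis by (intro exI[of _ c]) (simp add: add_diff_eq)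
  next
    assume "s \<in> g ` A"
    then obtain i where i: "i \<in> A" "s = g i" by blast
    have "(\<Sum>j\<in>A. (c j + (if j = i then d else 0)) * g j)
        = (\<Sum>j\<in>A. c j * g j) + (\<Sum>j\<in>A. if j = i then d * g j else 0)"
      unfolding sum.distrib[symmetric] by (rule sum.cong) (auto simp: distrib_right)
    also have "\<dots> = (\<Sum>j\<in>A. c j * g j) + d * s"
      using i A by simp
    finally show ?thesis using c by (intro exI[of _ "\<lambda>j. c j + (if j = i then d else 0)"]) simp
  qed
qed

text \<open>
  The proof of Krull's theorem adds a second copy of the variables, for the generators of the
  maximal ideal, and uses the grading by the degree in the second copy alone.
\<close>

definition right_degree :: "(('x + 'y::finite) \<Rightarrow>\<^sub>0 nat) \<Rightarrow> nat" where
  "right_degree m = (\<Sum>y\<in>UNIV. lookup m (Inr y))"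

definition right_component ::
  "nat \<Rightarrow> ('x + 'y::finite, 'k::comm_ring_1) mpoly \<Rightarrow> ('x + 'y, 'k) mpoly" where
  "right_component d = lin_ext const (\<lambda>m. if right_degree m = d then monom m else 0)"

lemma right_component_0: "right_component d 0 = 0"
  and right_component_add: "right_component d (p + q) = right_component d p + right_component d q"
  by (simp_all add: right_component_def lin_ext_0[OF ring_map_const] lin_ext_add[OF ring_map_const])

lemma right_component_sum: "right_component d (sum f A) = (\<Sum>i\<in>A. right_component d (f i))"
  by (induction A rule: infinite_finite_induct) (auto simp: right_component_0 right_component_add)

lemma right_component_single:
  "right_component d (single m c) = (if right_degree m = d then single m c else 0)"
  unfolding right_component_def lin_ext_single[OF ring_map_const]
      by (simp add: single_eq_const_mult[of m c])

text \<open>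
  Homogeneity of degree \<open>d\<close> in the second group of variables, in the form in which it is used:
  multiplication by \<open>f\<close> shifts the homogeneous components by \<open>d\<close>.
\<close>

definition right_homogeneous :: "nat \<Rightarrow> ('x + 'y::finite, 'k::comm_ring_1) mpoly \<Rightarrow> bool" where
  "right_homogeneous d f \<longleftrightarrow> (\<forall>D Q. right_component (D + d) (Q * f) = right_component D Q * f)"

lemma right_homogeneous_single: "right_homogeneous (right_degree m) (single m c)"
  unfolding right_homogeneous_def
proof (intro allI)
  fix D Q
  show "right_component (D + right_degree m) (Q * single m c)
      = right_component D Q * single m c"
  proof (induction Q rule: poly_mapping_add_induct)
    case (single n e)
    have "right_degree (n + m) = right_degree n + right_degree m"
      by (simp add: right_degree_def lookup_add sum.distrib)
    then show ?case by (simp add: mult_single right_component_single)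
  qed (simp_all add: right_component_0 right_component_add distrib_right)
qed

lemma right_homogeneous_add:
  "right_homogeneous d f \<Longrightarrow> right_homogeneous d g \<Longrightarrow> right_homogeneous d (f + g)"
  by (simp add: right_homogeneous_def distrib_left right_component_add)

lemma right_homogeneous_sum:
  "(\<And>i. i \<in> A \<Longrightarrow> right_homogeneous d (f i)) \<Longrightarrow> right_homogeneous d (sum f A)"
proof (induction A rule: infinite_finite_induct)
  case (insert a A)
  then show ?case by (simp add: right_homogeneous_add)
qed (simp_all add: right_homogeneous_def right_component_0)

lemma right_homogeneous_mult:
  assumes "right_homogeneous d f" "right_homogeneous d' g"
  shows "right_homogeneous (d + d') (f * g)"
  unfolding right_homogeneous_def
proof (intro allI)
  fix D Q
  have "right_component (D + (d + d')) (Q * (f * g)) = right_component ((D + d) + d') ((Q * f) * g)"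
    by (simp only: add.assoc mult.assoc)
  also have "\<dots> = right_component D Q * f * g"
    using assms by (simp only: right_homogeneous_def)
  finally show "right_component (D + (d + d')) (Q * (f * g)) = right_component D Q * (f * g)"
    by (simp only: mult.assoc)
qed

lemma right_homogeneous_power:
  "right_homogeneous d f \<Longrightarrow> right_homogeneous (n * d) (f ^ n)"
proof (induction n)
  case 0
  show ?case using right_homogeneous_single[of 0 1] by (simp add: right_degree_def)
qed (simp add: right_homogeneous_mult)

lemma right_homogeneous_in1: "right_homogeneous 0 (in1 f)"
proof (induction f rule: mpoly_induct)
  case (const c)
  show ?case using right_homogeneous_single[of 0 c] unfolding subst_const
      by (simp add: right_degree_def const_def)
next
  case (var x)
  show ?case using right_homogeneous_single[of "single (Inl x) 1" 1] unfolding subst_var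
    by (simp add: right_degree_def var_def lookup_single when_def)
next
  case (add p q) then show ?case by (simp add: subst_add right_homogeneous_add)
next
  case (mult p q) then show ?case using right_homogeneous_mult[of 0 _ 0] by (simp add: subst_mult)
qed

lemma right_homogeneous_var: "right_homogeneous 1 (var (Inr y))"
  using right_homogeneous_single[of "single (Inr y) 1" 1]
  by (simp add: right_degree_def var_def lookup_single when_def)

lemma right_component_homogeneous: "right_homogeneous d f \<Longrightarrow> right_component d f = f"
proof -
  assume "right_homogeneous d f"
  then have "right_component (0 + d) (1 * f) = right_component 0 1 * f"
    unfolding right_homogeneous_def by blast
  moreover have "right_component 0 (1 :: ('a + 'b, 'c) mpoly) = 1"
    using right_component_single[of 0 0 1] by (simp add: right_degree_def)
  ultimately show ?thesis by simp
qed

lemma eval_at_right_component: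
  fixes Q :: "('x::finite + 'y::finite, 'k::comm_ring_1) mpoly"
  assumes "d > 0"
  shows "eval_at (case_sum e (\<lambda>_. 0)) (right_component d Q) = 0"
proof (induction Q rule: poly_mapping_add_induct)
  case zero then show ?case by (simp add: right_component_0 eval_at_simps)
next
  case (single m c)
  show ?case
  proof (cases "right_degree m = d")
    case True
    then obtain y where "lookup m (Inr y) \<noteq> 0"
      using assms unfolding right_degree_def by (metis less_numeral_extra(3) sum.neutral)
    then have "(\<Prod>z\<in>UNIV. case_sum e (\<lambda>_. 0) z ^ lookup m z) = 0"
      by (intro prod_zero bexI[of _ "Inr y"]) (auto simp: zero_power)
    then have "eval_at (case_sum e (\<lambda>_. 0)) (single m c) = 0"
      unfolding eval_at_def peval_eq_lin_ext lin_ext_single[OF ring_map_id] monom_val_def by simp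
    then show ?thesis using True by (simp add: right_component_single)
  qed (simp add: right_component_single eval_at_simps)
next
  case (add p q)
  then show ?case by (simp add: right_component_add eval_at_simps)
qed

text \<open>
  The function \<open>b\<close> is, modulo \<open>I\<close>, the value at \<open>var x - const (e x)\<close> of forms \<open>P i\<close> of degree
  \<open>q i\<close> in new variables. The basis theorem expresses some \<open>P n\<close> through \<open>P j\<close> with \<open>j < n\<close>, and
  comparing degrees the coefficients can be taken homogeneous of degree \<open>q n - q j > 0\<close>. Their
  values lie in the maximal ideal of \<open>e\<close>, so evaluating the relation gives \<open>b = a b\<close> modulo \<open>I\<close>
  with \<open>a\<close> in that ideal.
\<close>

theorem krull_intersection:
  fixes I :: "('x::finite, 'k::field) mpoly set" and q :: "nat \<Rightarrow> nat"
  assumes I: "is_ideal I" and q: "strict_mono q"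
    and b: "\<And>i. b \<in> ideal_gen (I \<union> (\<lambda>x. (var x - const (e x)) ^ q i) ` UNIV)"
  obtains a where "eval_at e a = 0" "(1 - a) * b \<in> I"
proof -
  have "\<exists>c. b - (\<Sum>x\<in>UNIV. c x * (var x - const (e x)) ^ q i) \<in> I" for i
    by (rule ideal_gen_Un_image[OF I _ b]) simp
  then have "\<forall>i. \<exists>c. b - (\<Sum>x\<in>UNIV. c x * (var x - const (e x)) ^ q i) \<in> I" by blast
  from choice[OF this] obtain c where c: "\<And>i. b - (\<Sum>x\<in>UNIV. c i x * (var x
      - const (e x)) ^ q i) \<in> I"
    by blast
  define P where "P i = (\<Sum>x\<in>UNIV. in1 (c i x) * var (Inr x) ^ q i)" for i :: nat
  define \<theta> where "\<theta> = subst (case_sum var (\<lambda>x. var x - const (e x)) :: 'x + 'x \<Rightarrow> ('x, 'k) mpoly)"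
  have \<theta>: "ring_map \<theta>" unfolding \<theta>_def by (rule ring_map_subst)
  have \<theta>P: "cong_mod I b (\<theta> (P i))" for i
  proof -
    have "\<theta> (P i) = (\<Sum>x\<in>UNIV. c i x * (var x - const (e x)) ^ q i)"
      unfolding P_def \<theta>_def by (simp add: subst_sum subst_mult subst_power subst_subst)
    then show ?thesis using c[of i] by (simp add: cong_mod_def)
  qed
  have homP: "right_homogeneous (q i) (P i)" for i
    unfolding P_def
  proof (rule right_homogeneous_sum)
    fix x
    show "right_homogeneous (q i) (in1 (c i x) * var (Inr x) ^ q i)"
      using right_homogeneous_mult[OF right_homogeneous_in1[of "c i x"]
          right_homogeneous_power[OF right_homogeneous_var[of x], of "q i"]] by simp
  qed
  have "incseq (\<lambda>n. ideal_gen (P ` {..<n}))"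
    unfolding incseq_def by (intro allI impI ideal_gen_mono image_mono) simp
  then obtain n where n: "\<And>m. m \<ge> n \<Longrightarrow> ideal_gen (P ` {..<m}) = ideal_gen (P ` {..<n})"
    using ideal_chain_stabilises[of "\<lambda>n. ideal_gen (P ` {..<n})", OF is_ideal_ideal_gen] by blast
  have "P n \<in> ideal_gen (P ` {..<Suc n})" by (intro ideal_gen_base) auto
  then have "P n \<in> ideal_gen (P ` {..<n})" using n[of "Suc n"] by simp
  then have "P n \<in> ideal_gen ({0} \<union> P ` {..<n})"
    using ideal_gen_mono[of "P ` {..<n}" "{0} \<union> P ` {..<n}"] by blast
  then obtain Q where Q: "P n = (\<Sum>j<n. Q j * P j)"
    using ideal_gen_Un_image[of "{0}" "{..<n}" "P n" P, OF is_idealI] by auto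
  have comp: "right_component (q n) (Q j * P j) = right_component (q n - q j) (Q j) * P j"
      if "j < n" for j
  proof -
    have "q n = (q n - q j) + q j" using strict_monoD[OF q that] by simp
    then show ?thesis
      using homP[of j, unfolded right_homogeneous_def, rule_format, of "q n - q j" "Q j"] by simp
  qed
  have "P n = right_component (q n) (P n)" using right_component_homogeneous[OF homP] by simp
  also have "\<dots> = (\<Sum>j<n. right_component (q n) (Q j * P j))"
      by (subst Q) (simp only: right_component_sum)
  also have "\<dots> = (\<Sum>j<n. right_component (q n - q j) (Q j) * P j)"
    by (rule sum.cong) (auto simp: comp)
  finally have Pn: "\<theta> (P n) = (\<Sum>j<n. \<theta> (right_component (q n - q j) (Q j)) * \<theta> (P j))"
    by (simp add: ring_map_sum[OF \<theta>] ring_map_mult[OF \<theta>])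
  define a where "a = (\<Sum>j<n. \<theta> (right_component (q n - q j) (Q j)))"
  have "eval_at e (\<theta> (right_component (q n - q j) (Q j))) = 0" if "j < n" for j
  proof -
    have "(\<lambda>z. eval_at e (case_sum var (\<lambda>x. var x - const (e x)) z)) = case_sum e (\<lambda>_. 0)"
      by (rule ext) (simp split: sum.split add: eval_at_simps)
    then show ?thesis
      unfolding \<theta>_def eval_at_subst using eval_at_right_component[of "q n - q j" e "Q j"]
        strict_monoD[OF q that] by simp
  qed
  then have "eval_at e a = 0" unfolding a_def by (simp add: eval_at_simps)
  moreover have "(1 - a) * b \<in> I"
  proof -
    have "cong_mod I b (\<theta> (P n))" by (rule \<theta>P)
    moreover have "cong_mod I (\<theta> (P n)) (\<Sum>j<n. \<theta> (right_component (q n - q j) (Q j)) * b)"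
      unfolding Pn by (intro cong_mod_sum[OF I] cong_mod_mult[OF I] cong_mod_refl[OF I]
          cong_mod_sym[OF I \<theta>P])
    ultimately have "cong_mod I b (a * b)"
      unfolding a_def sum_distrib_right by (rule cong_mod_trans[OF I])
    then show ?thesis by (simp add: cong_mod_def left_diff_distrib)
  qed
  ultimately show ?thesis using that by blast
qed

section \<open>Points of group schemes\<close>

text \<open>
  A morphism \<open>u\<close> from the closed subscheme of \<open>K\<close> to the closed subscheme of \<open>I\<close> is a tuple of
  polynomials that maps \<open>I\<close> into \<open>K\<close>; tuples congruent modulo \<open>K\<close> are the same morphism. The
  points of a group scheme over any \<open>K\<close> form a group, and this is the language in which Hopf
  algebra identities are verified below.
\<close>

definition point :: "('x::finite, 'k::field) mpoly set \<Rightarrow> ('y, 'k) mpoly set \<Rightarrow> ('x \<Rightarrow> ('y, 'k)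
    mpoly) \<Rightarrow> bool" where
  "point I K u \<longleftrightarrow> (\<forall>f\<in>I. subst u f \<in> K)"

definition pt_eq :: "('y, 'k::field) mpoly set \<Rightarrow> ('x \<Rightarrow> ('y, 'k) mpoly) \<Rightarrow> ('x \<Rightarrow> ('y, 'k) mpoly) \<Rightarrow>
    bool" where
  "pt_eq K u v \<longleftrightarrow> (\<forall>x. cong_mod K (u x) (v x))"

definition pmul ::
  "('x::finite, 'k::field) group_scheme \<Rightarrow> ('x \<Rightarrow> ('y, 'k) mpoly) \<Rightarrow> ('x \<Rightarrow> ('y, 'k) mpoly) \<Rightarrow> 'x \<Rightarrow>
      ('y, 'k) mpoly" where
  "pmul G u v = (\<lambda>x. subst (case_sum u v) (mlt G x))"

definition pone :: "('x::finite, 'k::field) group_scheme \<Rightarrow> 'x \<Rightarrow> ('y, 'k) mpoly" where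
  "pone G = (\<lambda>x. const (unt G x))"

definition pinv ::
  "('x::finite, 'k::field) group_scheme \<Rightarrow> ('x \<Rightarrow> ('y, 'k) mpoly) \<Rightarrow> 'x \<Rightarrow> ('y, 'k) mpoly" where
  "pinv G u = (\<lambda>x. subst u (ivs G x))"

lemma pointD: "point I K u \<Longrightarrow> f \<in> I \<Longrightarrow> subst u f \<in> K"
  by (simp add: point_def)

lemma point_antimono: "I' \<subseteq> I \<Longrightarrow> K \<subseteq> K' \<Longrightarrow> point I K u \<Longrightarrow> point I' K' u"
  by (auto simp: point_def)

lemma point_ideal_gen:
  fixes u :: "'x::finite \<Rightarrow> ('y, 'k::field) mpoly"
  assumes "is_ideal K"
  shows "point (ideal_gen S) K u \<longleftrightarrow> (\<forall>f\<in>S. subst u f \<in> K)"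
proof -
  have "is_ideal (subst u -` K)" by (rule ring_map_vimage_ideal[OF ring_map_subst assms])
  from ideal_gen_least[OF _ this, of S] show ?thesis
    by (auto simp: point_def intro: ideal_gen_base)
qed

lemma point_var: "point I I var"
  by (simp add: point_def)

lemma point_left: "point I (prod_ideal I J) (\<lambda>x. var (Inl x))"
  by (simp add: point_def in1_mem_prod_ideal)

lemma point_right: "point J (prod_ideal I J) (\<lambda>x. var (Inr x))"
  by (simp add: point_def in2_mem_prod_ideal)

lemma point_case_sum:
  "is_ideal K \<Longrightarrow> point I K u \<Longrightarrow> point J K v \<Longrightarrow> point (prod_ideal I J) K (case_sum u v)"
  unfolding point_def using subst_prod_ideal[of K I u J v] by blast

lemma point_comp:
  fixes v :: "'x::finite \<Rightarrow> ('y::finite, 'k::field) mpoly" and u :: "'y \<Rightarrow> ('z, 'k) mpoly"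
  shows "point I J v \<Longrightarrow> point J K u \<Longrightarrow> point I K (\<lambda>x. subst u (v x))"
  by (simp add: point_def flip: subst_subst)

lemma pt_eq_subst:
  fixes u v :: "'x::finite \<Rightarrow> ('y, 'k::field) mpoly"
  shows "is_ideal K \<Longrightarrow> pt_eq K u v \<Longrightarrow> cong_mod K (subst u f) (subst v f)"
  unfolding pt_eq_def by (rule cong_mod_subst) auto

lemma pt_eq_refl: "is_ideal K \<Longrightarrow> pt_eq K u u"
  by (simp add: pt_eq_def cong_mod_refl)

lemma pt_eq_sym: "is_ideal K \<Longrightarrow> pt_eq K u v \<Longrightarrow> pt_eq K v u"
  by (simp add: pt_eq_def cong_mod_sym)

lemma pt_eq_trans: "is_ideal K \<Longrightarrow> pt_eq K u v \<Longrightarrow> pt_eq K v w \<Longrightarrow> pt_eq K u w"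
  unfolding pt_eq_def using cong_mod_trans[of K] by blast

lemma point_pt_eq: "is_ideal K \<Longrightarrow> pt_eq K u v \<Longrightarrow> point I K u \<Longrightarrow> point I K v"
  unfolding point_def using pt_eq_subst[of K u v] cong_mod_mem[of K] by blast

lemma pt_eq_point:
  fixes w :: "'y::finite \<Rightarrow> ('z, 'k::field) mpoly"
  shows "pt_eq J u v \<Longrightarrow> point J K w \<Longrightarrow> pt_eq K (\<lambda>x. subst w (u x)) (\<lambda>x. subst w (v x))"
  by (simp add: pt_eq_def cong_mod_def point_def flip: subst_diff)

lemma subst_case_sum:
  "subst w (subst (case_sum u v) f) = subst (case_sum (\<lambda>x. subst w (u x)) (\<lambda>y. subst w (v y))) f"
  for u :: "'x::finite \<Rightarrow> ('z::finite, 'k::comm_ring_1) mpoly" and v :: "'y::finite \<Rightarrow> ('z, 'k) mpoly"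
  unfolding subst_subst by (rule arg_cong[where f = "\<lambda>g. subst g f"]) (auto split: sum.split)

lemma subst_pmul:
  "subst w (pmul G u v x) = pmul G (\<lambda>x. subst w (u x)) (\<lambda>x. subst w (v x)) x"
  for u :: "'x::finite \<Rightarrow> ('z::finite, 'k::field) mpoly"
  unfolding pmul_def by (rule subst_case_sum)

lemma subst_pone: "subst (w :: 'z::finite \<Rightarrow> ('y, 'k::field) mpoly) (pone G x) = pone G x"
  by (simp add: pone_def)

lemma subst_pinv:
  "subst w (pinv G u x) = pinv G (\<lambda>x. subst w (u x)) x"
  for u :: "'x::finite \<Rightarrow> ('z::finite, 'k::field) mpoly"
  by (simp add: pinv_def subst_subst)

lemma subst_of_pmul: "subst (pmul G u v) f = subst (case_sum u v) (subst (mlt G) f)"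
  by (simp add: pmul_def subst_subst)

lemma subst_of_pinv: "subst (pinv G u) f = subst u (subst (ivs G) f)"
  by (simp add: pinv_def subst_subst)

lemma mlt_eq_pmul: "mlt G = pmul G (\<lambda>x. var (Inl x)) (\<lambda>x. var (Inr x))"
proof -
  have "case_sum (\<lambda>x. var (Inl x)) (\<lambda>x. var (Inr x)) = (var :: _ \<Rightarrow> ('a + 'a, 'b) mpoly)"
    by (auto split: sum.split)
  then show ?thesis by (simp add: pmul_def)
qed

lemma ivs_eq_pinv: "ivs G = pinv G var"
  by (simp add: pinv_def)

lemma pt_eq_pmul:
  "is_ideal K \<Longrightarrow> pt_eq K u u' \<Longrightarrow> pt_eq K v v' \<Longrightarrow> pt_eq K (pmul G u v) (pmul G u' v')"
  unfolding pmul_def pt_eq_def by (auto intro!: cong_mod_subst split: sum.split)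

lemma pt_eq_pinv: "is_ideal K \<Longrightarrow> pt_eq K u u' \<Longrightarrow> pt_eq K (pinv G u) (pinv G u')"
  unfolding pinv_def pt_eq_def by (auto intro!: cong_mod_subst)

subsection \<open>The group of points\<close>

lemma alg_group_is_ideal: "alg_group G \<Longrightarrow> is_ideal (rel G)"
  by (simp add: alg_group_def)

lemma alg_group_mlt: "alg_group G \<Longrightarrow> f \<in> rel G \<Longrightarrow> subst (mlt G) f \<in> prod_ideal (rel G) (rel G)"
  by (simp add: alg_group_def)

lemma alg_group_unt: "alg_group G \<Longrightarrow> f \<in> rel G \<Longrightarrow> eval_at (unt G) f = 0"
  by (simp add: alg_group_def eval_at_def)

lemma alg_group_ivs: "alg_group G \<Longrightarrow> f \<in> rel G \<Longrightarrow> subst (ivs G) f \<in> rel G"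
  by (simp add: alg_group_def)

lemma alg_group_assoc_generic:
  assumes "alg_group G"
  defines "a \<equiv> \<lambda>x. var (Inl x)" and "b \<equiv> \<lambda>x. var (Inr (Inl x))" and "c \<equiv> \<lambda>x. var (Inr (Inr x))"
  shows "pt_eq (prod_ideal (rel G) (prod_ideal (rel G) (rel G)))
    (pmul G (pmul G a b) c) (pmul G a (pmul G b c))"
  using assms unfolding alg_group_def Let_def pt_eq_def pmul_def cong_mod_def by blast

lemma alg_group_unit_generic:
  assumes "alg_group G"
  shows "pt_eq (rel G) (pmul G (pone G) var) var" "pt_eq (rel G) (pmul G var (pone G)) var"
    "pt_eq (rel G) (pmul G (pinv G var) var) (pone G)"
        "pt_eq (rel G) (pmul G var (pinv G var)) (pone G)"
  using assms unfolding alg_group_def Let_def pt_eq_def pmul_def pone_def cong_mod_def ivs_eq_pinv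
  by blast+

context
  fixes G :: "('x::finite, 'k::field) group_scheme" and K :: "('y::finite, 'k) mpoly set"
  assumes G: "alg_group G" and K: "is_ideal K"
begin

lemma point_pmul: "point (rel G) K u \<Longrightarrow> point (rel G) K v \<Longrightarrow> point (rel G) K (pmul G u v)"
  unfolding point_def[of _ _ "pmul G u v"] subst_of_pmul
  using pointD[OF point_case_sum[OF K]] alg_group_mlt[OF G] by blast

lemma point_pone: "point (rel G) K (pone G)"
  unfolding point_def pone_def subst_const_point by (simp add: alg_group_unt[OF G] ideal_0[OF K])

lemma point_pinv: "point (rel G) K u \<Longrightarrow> point (rel G) K (pinv G u)"
  unfolding point_def[of _ _ "pinv G u"] subst_of_pinv using alg_group_ivs[OF G] pointD by blast

lemma pmul_assoc:
  assumes u: "point (rel G) K u" and v: "point (rel G) K v" and w: "point (rel G) K w"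
  shows "pt_eq K (pmul G (pmul G u v) w) (pmul G u (pmul G v w))"
  using pt_eq_point[OF alg_group_assoc_generic[OF G]
      point_case_sum[OF K u point_case_sum[OF K v w]]]
  by (simp add: subst_pmul)

lemma pmul_pone_left: "point (rel G) K u \<Longrightarrow> pt_eq K (pmul G (pone G) u) u"
  using pt_eq_point[OF alg_group_unit_generic(1)[OF G]] by (simp add: subst_pmul subst_pone)

lemma pmul_pone_right: "point (rel G) K u \<Longrightarrow> pt_eq K (pmul G u (pone G)) u"
  using pt_eq_point[OF alg_group_unit_generic(2)[OF G]] by (simp add: subst_pmul subst_pone)

lemma pmul_pinv_left: "point (rel G) K u \<Longrightarrow> pt_eq K (pmul G (pinv G u) u) (pone G)"
  using pt_eq_point[OF alg_group_unit_generic(3)[OF G]]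
      by (simp add: subst_pmul subst_pone subst_pinv)

lemma pmul_pinv_right: "point (rel G) K u \<Longrightarrow> pt_eq K (pmul G u (pinv G u)) (pone G)"
  using pt_eq_point[OF alg_group_unit_generic(4)[OF G]]
      by (simp add: subst_pmul subst_pone subst_pinv)

lemmas pt_rules = pt_eq_refl[OF K] pt_eq_pmul[OF K] pt_eq_pinv[OF K]

lemma pinv_pmul_cancel:
  assumes u: "point (rel G) K u" and v: "point (rel G) K v"
  shows "pt_eq K (pmul G (pinv G u) (pmul G u v)) v"
proof -
  have "pt_eq K (pmul G (pinv G u) (pmul G u v)) (pmul G (pmul G (pinv G u) u) v)"
    by (rule pt_eq_sym[OF K pmul_assoc[OF point_pinv[OF u] u v]])
  moreover have "pt_eq K (pmul G (pmul G (pinv G u) u) v) (pmul G (pone G) v)"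
    by (intro pt_rules pmul_pinv_left u)
  ultimately show ?thesis
    using pmul_pone_left[OF v] pt_eq_trans[OF K] by blast
qed

lemma pinv_unique:
  assumes u: "point (rel G) K u" and v: "point (rel G) K v"
    and uv: "pt_eq K (pmul G u v) (pone G)"
  shows "pt_eq K v (pinv G u)"
proof -
  have "pt_eq K v (pmul G (pinv G u) (pmul G u v))"
    by (rule pt_eq_sym[OF K pinv_pmul_cancel[OF u v]])
  moreover have "pt_eq K (pmul G (pinv G u) (pmul G u v)) (pmul G (pinv G u) (pone G))"
    by (intro pt_rules uv)
  ultimately show ?thesis
    using pmul_pone_right[OF point_pinv[OF u]] pt_eq_trans[OF K] by blast
qed

lemma pinv_pmul:
  assumes u: "point (rel G) K u" and v: "point (rel G) K v"
  shows "pt_eq K (pinv G (pmul G u v)) (pmul G (pinv G v) (pinv G u))"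
proof -
  let ?u' = "pinv G u" and ?v' = "pinv G v"
  note p = u v point_pinv[OF u] point_pinv[OF v]
  have "pt_eq K (pmul G (pmul G u v) (pmul G ?v' ?u')) (pmul G u (pmul G v (pmul G ?v' ?u')))"
    by (intro pmul_assoc point_pmul p)
  moreover have "pt_eq K (pmul G v (pmul G ?v' ?u')) (pmul G (pmul G v ?v') ?u')"
    by (rule pt_eq_sym[OF K pmul_assoc]) (rule p)+
  moreover have "pt_eq K (pmul G (pmul G v ?v') ?u') (pmul G (pone G) ?u')"
    by (intro pt_rules pmul_pinv_right p)
  moreover have "pt_eq K (pmul G (pone G) ?u') ?u'" by (intro pmul_pone_left p)
  ultimately have "pt_eq K (pmul G (pmul G u v) (pmul G ?v' ?u')) (pmul G u ?u')"
    using pt_eq_trans[OF K] pt_rules(1,2) by meson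
  then have "pt_eq K (pmul G (pmul G u v) (pmul G ?v' ?u')) (pone G)"
    using pmul_pinv_right[OF u] pt_eq_trans[OF K] by blast
  then have "pt_eq K (pmul G ?v' ?u') (pinv G (pmul G u v))"
    by (intro pinv_unique point_pmul p)
  then show ?thesis by (rule pt_eq_sym[OF K])
qed

lemma pmul_interchange:
  assumes u: "point (rel G) K u" and v: "point (rel G) K v"
    and w: "point (rel G) K w" and z: "point (rel G) K z"
    and vw: "pt_eq K (pmul G v w) (pmul G w v)"
  shows "pt_eq K (pmul G (pmul G u v) (pmul G w z)) (pmul G (pmul G u w) (pmul G v z))"
proof -
  note p = u v w z
  have 1: "pt_eq K (pmul G (pmul G u v) (pmul G w z)) (pmul G u (pmul G (pmul G v w) z))"
    if p: "point (rel G) K u" "point (rel G) K v" "point (rel G) K w" "point (rel G) K z"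
        for u v w z
  proof -
    have "pt_eq K (pmul G (pmul G u v) (pmul G w z)) (pmul G u (pmul G v (pmul G w z)))"
      by (intro pmul_assoc point_pmul p)
    moreover have "pt_eq K (pmul G u (pmul G v (pmul G w z))) (pmul G u (pmul G (pmul G v w) z))"
      by (intro pt_rules pt_eq_sym[OF K pmul_assoc] p)
    ultimately show ?thesis by (rule pt_eq_trans[OF K])
  qed
  have "pt_eq K (pmul G (pmul G u v) (pmul G w z)) (pmul G u (pmul G (pmul G v w) z))"
    by (rule 1) (rule p)+
  moreover have "pt_eq K (pmul G u (pmul G (pmul G v w) z)) (pmul G u (pmul G (pmul G w v) z))"
    by (intro pt_rules vw)
  moreover have "pt_eq K (pmul G u (pmul G (pmul G w v) z)) (pmul G (pmul G u w) (pmul G v z))"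
    by (rule pt_eq_sym[OF K 1]) (rule p)+
  ultimately show ?thesis using pt_eq_trans[OF K] by blast
qed

end

subsection \<open>Subgroups\<close>

lemma closed_subgroup_simps:
  assumes "closed_subgroup T G"
  shows "mlt T = mlt G" "unt T = unt G" "ivs T = ivs G"
proof -
  have T: "T = G\<lparr>rel := rel T\<rparr>" using assms by (simp add: closed_subgroup_def)
  show "mlt T = mlt G" "unt T = unt G" "ivs T = ivs G" by (subst T, simp)+
qed

lemma alg_groupI:
  fixes G :: "('x::finite, 'k::field) group_scheme"
  assumes "is_ideal (rel G)" and "point (rel G) (prod_ideal (rel G) (rel G)) (mlt G)"
    and "\<And>f. f \<in> rel G \<Longrightarrow> eval_at (unt G) f = 0" and "point (rel G) (rel G) (ivs G)"
    and "pt_eq (prod_ideal (rel G) (prod_ideal (rel G) (rel G)))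
      (pmul G (pmul G (\<lambda>x. var (Inl x)) (\<lambda>x. var (Inr (Inl x)))) (\<lambda>x. var (Inr (Inr x))))
      (pmul G (\<lambda>x. var (Inl x)) (pmul G (\<lambda>x. var (Inr (Inl x))) (\<lambda>x. var (Inr (Inr x)))))"
    and "pt_eq (rel G) (pmul G (pone G) var) var" "pt_eq (rel G) (pmul G var (pone G)) var"
    and "pt_eq (rel G) (pmul G (pinv G var) var) (pone G)"
    and "pt_eq (rel G) (pmul G var (pinv G var)) (pone G)"
  shows "alg_group G"
  using assms unfolding alg_group_def Let_def
  by (simp add: pt_eq_def cong_mod_def pmul_def pone_def pinv_def point_def eval_at_def)

lemma restrict_simps [simp]:
  "pmul (G\<lparr>rel := J\<rparr>) u v = pmul G u v" "pone (G\<lparr>rel := J\<rparr>) = pone G" "pinv (G\<lparr>rel := J\<rparr>) u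
      = pinv G u"
  by (simp_all add: pmul_def pone_def pinv_def)

lemma pt_eq_mono: "K \<subseteq> K' \<Longrightarrow> pt_eq K u v \<Longrightarrow> pt_eq K' u v"
  by (auto simp: pt_eq_def cong_mod_def)

lemma alg_group_restrict:
  assumes G: "alg_group G" and J: "is_ideal J" "rel G \<subseteq> J"
    and "point J (prod_ideal J J) (mlt G)" and "\<And>f. f \<in> J \<Longrightarrow> eval_at (unt G) f = 0"
    and "point J J (ivs G)"
  shows "alg_group (G\<lparr>rel := J\<rparr>)"
proof -
  have PP: "prod_ideal (rel G) (prod_ideal (rel G) (rel G)) \<subseteq> prod_ideal J (prod_ideal J J)"
    using J(2) by (intro prod_ideal_mono)
  show ?thesis
    using assms pt_eq_mono[OF PP alg_group_assoc_generic[OF G]] alg_group_unit_generic[OF G, THEN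
        pt_eq_mono[OF J(2)]]
    by (intro alg_groupI) simp_all
qed

section \<open>Frobenius kernels\<close>

lemma CHAR_mpoly: "CHAR(('x \<Rightarrow>\<^sub>0 nat) \<Rightarrow>\<^sub>0 'k::field) = CHAR('k)"
proof (rule CHAR_eqI)
  have of_nat: "(of_nat n :: ('x, 'k) mpoly) = const (of_nat n)" for n
    by (simp add: const_def)
  show "of_nat CHAR('k) = (0 :: ('x, 'k) mpoly)" by (simp add: of_nat)
  fix n assume "of_nat n = (0 :: ('x, 'k) mpoly)"
  then have "lookup (const (of_nat n) :: ('x, 'k) mpoly) 0 = 0" by (simp add: of_nat)
  then show "CHAR('k) dvd n" by (simp add: const_def lookup_of_nat of_nat_eq_0_iff_char_dvd)
qed

context
  fixes i q :: nat
  assumes char: "CHAR('k::field) > 0" and q: "q = CHAR('k) ^ i"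
begin

lemma frobenius_add: "(a + b) ^ q = a ^ q + (b :: ('x, 'k) mpoly) ^ q"
  using freshmans_dream'[of q i a b] prime_CHAR_semidom[where 'a = 'k] char
  by (simp add: CHAR_mpoly q)

lemma frobenius_diff: "(a - b) ^ q = a ^ q - (b :: ('x, 'k) mpoly) ^ q"
  using frobenius_add[of "a - b" b] by simp

text \<open>
  Raising to the power \<open>q\<close> is additive and multiplicative, so congruences between \<open>q\<close>-th powers
  propagate through all polynomials.
\<close>

lemma cong_mod_frobenius_subst:
  fixes u v :: "'x::finite \<Rightarrow> ('y, 'k) mpoly"
  assumes K: "is_ideal K" and "\<And>x. cong_mod K (u x ^ q) (v x ^ q)"
  shows "cong_mod K (subst u f ^ q) (subst v f ^ q)"
proof (induction f rule: mpoly_induct)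
  case (add f g)
  then show ?case by (simp add: subst_add frobenius_add cong_mod_add[OF K])
next
  case (mult f g)
  then show ?case by (simp add: subst_mult power_mult_distrib cong_mod_mult[OF K])
qed (use assms in \<open>simp_all add: cong_mod_refl[OF K]\<close>)

lemma rel_frobenius_kernel:
  fixes G :: "('x::finite, 'k) group_scheme"
  shows "rel (frobenius_kernel i G) = ideal_gen (rel G \<union> (\<lambda>x. (var x
      - const (unt G x)) ^ q) ` UNIV)"
proof -
  have "{var x ^ (CHAR('k) ^ i) - const (unt (frobenius_twist i G) x) | x. True}
      = (\<lambda>x. (var x - const (unt G x)) ^ q) ` UNIV"
    by (simp add: frobenius_twist_def base_change_def frobenius_diff const_power full_SetCompr_eq
        flip: q)
  then show ?thesis by (simp add: frobenius_kernel_def hom_kernel_def)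
qed

lemma point_frobenius_kernel:
  fixes G :: "('x::finite, 'k) group_scheme" and K :: "('y::finite, 'k) mpoly set"
  assumes K: "is_ideal K"
  shows "point (rel (frobenius_kernel i G)) K u \<longleftrightarrow>
    point (rel G) K u \<and> (\<forall>x. cong_mod K (u x ^ q) (pone G x ^ q))"
proof -
  have "subst u ((var x - const (unt G x)) ^ q) = u x ^ q - pone G x ^ q" for x
    by (simp add: subst_power subst_diff pone_def frobenius_diff)
  then show ?thesis
    unfolding rel_frobenius_kernel point_ideal_gen[OF K]
    unfolding point_def cong_mod_def ball_Un ball_simps by simp
qed

end

lemma frobenius_kernel_eq: "frobenius_kernel i G = G\<lparr>rel := rel (frobenius_kernel i G)\<rparr>"
  by (simp add: frobenius_kernel_def hom_kernel_def)

lemma frobenius_kernel_simps [simp]: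
  "mlt (frobenius_kernel i G) = mlt G" "unt (frobenius_kernel i G) = unt G"
  "ivs (frobenius_kernel i G) = ivs G"
  by (simp_all add: frobenius_kernel_def hom_kernel_def)

lemma is_ideal_frobenius_kernel: "is_ideal (rel (frobenius_kernel i G))"
  by (simp add: frobenius_kernel_def hom_kernel_def is_ideal_ideal_gen)

lemma rel_subset_frobenius_kernel: "rel G \<subseteq> rel (frobenius_kernel i G)"
  by (auto simp: frobenius_kernel_def hom_kernel_def intro: ideal_gen_base)

text \<open>
  The points of the \<open>i\<close>-th Frobenius kernel are the points whose \<open>q\<close>-th powers agree with those of
  the identity; by \<open>cong_mod_frobenius_subst\<close> products and inverses have this property again.
\<close>

lemma alg_group_frobenius_kernel:
  fixes G :: "('x::finite, 'k::field) group_scheme"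
  assumes char: "CHAR('k) > 0" and G: "alg_group G"
  shows "alg_group (frobenius_kernel i G)"
proof -
  define q where "q = CHAR('k) ^ i"
  let ?J = "rel (frobenius_kernel i G)"
  note pk = point_frobenius_kernel[OF char q_def, where G = G]
  have J: "is_ideal ?J" "rel G \<subseteq> ?J" by (rule is_ideal_frobenius_kernel
      rel_subset_frobenius_kernel)+
  have "point ?J (prod_ideal ?J ?J) (mlt G)"
  proof -
    let ?K = "prod_ideal ?J ?J" and ?a = "\<lambda>x. var (Inl x)" and ?b = "\<lambda>x. var (Inr x)"
    note K = is_ideal_prod_ideal[of ?J ?J]
    have ab: "point ?J ?K ?a" "point ?J ?K ?b" by (rule point_left point_right)+
    then have ab': "point (rel G) ?K ?a" "point (rel G) ?K ?b" using pk[OF K] by blast+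
    have "cong_mod ?K (pmul G ?a ?b x ^ q) (pone G x ^ q)" for x
    proof -
      have "cong_mod ?K (pmul G ?a ?b x ^ q) (pmul G (pone G) (pone G) x ^ q)"
        unfolding pmul_def
        by (rule cong_mod_frobenius_subst[OF char q_def K])
           (use ab pk[OF K] in \<open>auto split: sum.split\<close>)
      moreover have "cong_mod ?K (pmul G (pone G) (pone G) x) (pone G x)"
        using pmul_pone_left[OF G K point_pone[OF G K]] by (simp add: pt_eq_def)
      ultimately show ?thesis using cong_mod_trans[OF K] cong_mod_power[OF K] by blast
    qed
    then show ?thesis
      unfolding mlt_eq_pmul pk[OF K] using point_pmul[OF G K ab'] by blast
  qed
  moreover have "eval_at (unt G) f = 0" if "f \<in> ?J" for f
  proof -
    have "is_ideal (eval_at (unt G) -` {0})"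
      by (rule ring_map_vimage_ideal[OF ring_map_eval_at]) (rule is_idealI, auto)
    moreover have "rel G \<union> (\<lambda>x. (var x - const (unt G x)) ^ q) ` UNIV \<subseteq> eval_at (unt G) -` {0}"
      using char by (auto simp: alg_group_unt[OF G] eval_at_simps zero_power q_def)
    ultimately show ?thesis
      using that ideal_gen_least rel_frobenius_kernel[OF char q_def, of G] by blast
  qed
  moreover have "point ?J ?J (ivs G)"
  proof -
    have v: "point ?J ?J var" by (rule point_var)
    then have v': "point (rel G) ?J var" using pk[OF J(1)] by blast
    have "cong_mod ?J (pinv G var x ^ q) (pone G x ^ q)" for x
    proof -
      have "cong_mod ?J (pinv G var x ^ q) (pinv G (pone G) x ^ q)"
        unfolding pinv_def
        by (rule cong_mod_frobenius_subst[OF char q_def J(1)]) (use v pk[OF J(1)] in auto)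
      moreover have "cong_mod ?J (pinv G (pone G) x) (pone G x)"
        using pt_eq_sym[OF J(1) pinv_unique[OF G J(1) point_pone[OF G J(1)] point_pone[OF G J(1)]
            pmul_pone_left[OF G J(1) point_pone[OF G J(1)]]]] by (simp add: pt_eq_def)
      ultimately show ?thesis using cong_mod_trans[OF J(1)] cong_mod_power[OF J(1)] by blast
    qed
    then show ?thesis
      unfolding ivs_eq_pinv pk[OF J(1)] using point_pinv[OF G J(1) v'] by blast
  qed
  ultimately show ?thesis
    using alg_group_restrict[OF G J] frobenius_kernel_eq[of i G] by metis
qed

lemma closed_subgroup_alg_group:
  "closed_subgroup T G \<Longrightarrow> alg_group T" "closed_subgroup T G \<Longrightarrow> alg_group G"
  by (simp_all add: closed_subgroup_def)

lemma closed_subgroup_rel: "closed_subgroup T G \<Longrightarrow> rel G \<subseteq> rel T"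
  by (simp add: closed_subgroup_def)

lemma closed_subgroupI:
  assumes "alg_group G" "alg_group T" "rel G \<subseteq> rel T" "mlt T = mlt G" "unt T = unt G" "ivs T
      = ivs G"
  shows "closed_subgroup T G"
  using assms unfolding closed_subgroup_def by (cases T, cases G) auto

lemma closed_subgroup_trans:
  "closed_subgroup T S \<Longrightarrow> closed_subgroup S G \<Longrightarrow> closed_subgroup T G"
  by (rule closed_subgroupI)
     (auto simp: closed_subgroup_simps intro: closed_subgroup_alg_group dest: closed_subgroup_rel)

lemma closed_subgroup_frobenius_kernel:
  fixes G :: "('x::finite, 'k::field) group_scheme"
  assumes "CHAR('k) > 0" "alg_group G"
  shows "closed_subgroup (frobenius_kernel i G) G"
  by (rule closed_subgroupI) (simp_all add: assms alg_group_frobenius_kernel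
      rel_subset_frobenius_kernel)

lemma frobenius_kernel_mono:
  fixes G :: "('x::finite, 'k::field) group_scheme"
  assumes "CHAR('k) > 0" "closed_subgroup T G"
  shows "closed_subgroup (frobenius_kernel i T) (frobenius_kernel i G)"
proof (rule closed_subgroupI)
  show "rel (frobenius_kernel i G) \<subseteq> rel (frobenius_kernel i T)"
    unfolding rel_frobenius_kernel[OF assms(1) refl] closed_subgroup_simps[OF assms(2)]
    using closed_subgroup_rel[OF assms(2)] by (intro ideal_gen_mono) auto
qed (use assms in \<open>auto intro: alg_group_frobenius_kernel closed_subgroup_alg_group
      simp: closed_subgroup_simps[OF assms(2)]\<close>)

lemma decseq_frobenius_kernel:
  fixes G :: "('x::finite, 'k::field) group_scheme"
  assumes char: "CHAR('k) > 0"
  shows "decseq (\<lambda>i. rel (frobenius_kernel i G))"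
proof (rule decseq_SucI)
  fix i
  have "(var x - const (unt G x)) ^ (CHAR('k) ^ Suc i) \<in> rel (frobenius_kernel i G)" for x
  proof -
    have "(var x - const (unt G x)) ^ (CHAR('k) ^ Suc i)
        = (var x - const (unt G x)) ^ (CHAR('k) ^ i) * (var x
            - const (unt G x)) ^ (CHAR('k) ^ Suc i - CHAR('k) ^ i)"
      using char by (simp flip: power_add)
    moreover have "(var x - const (unt G x)) ^ (CHAR('k) ^ i) \<in> rel (frobenius_kernel i G)"
      unfolding rel_frobenius_kernel[OF char refl] by (intro ideal_gen_base) auto
    ultimately show ?thesis using ideal_mult_right[OF is_ideal_frobenius_kernel] by metis
  qed
  then show "rel (frobenius_kernel (Suc i) G) \<subseteq> rel (frobenius_kernel i G)"
    unfolding rel_frobenius_kernel[OF char refl, of "Suc i" G]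
    using rel_subset_frobenius_kernel[of G i]
    by (intro ideal_gen_least is_ideal_frobenius_kernel) auto
qed

section \<open>Prime ideals and connectedness\<close>

lemma exists_prime_ideal:
  fixes I :: "'a::comm_ring_1 set"
  assumes I: "is_ideal I" "1 \<notin> I"
  obtains P where "is_prime_ideal P" "I \<subseteq> P"
proof -
  let ?A = "{M. is_ideal M \<and> I \<subseteq> M \<and> 1 \<notin> M}"
  have "\<exists>M\<in>?A. \<forall>U\<in>?A. M \<subseteq> U \<longrightarrow> U = M"
  proof (rule subset_Zorn_nonempty)
    show "?A \<noteq> {}" using I by auto
  next
    fix C assume C: "C \<noteq> {}" "subset.chain ?A C"
    then have CA: "C \<subseteq> ?A" and tot: "\<And>U V. U \<in> C \<Longrightarrow> V \<in> C \<Longrightarrow> U \<subseteq> V \<or> V \<subseteq> U"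
      by (auto simp: subset_chain_def)
    have "is_ideal (\<Union>C)"
    proof (rule is_idealI)
      show "0 \<in> \<Union>C" using C(1) CA ideal_0 by blast
    next
      fix a b assume "a \<in> \<Union>C" "b \<in> \<Union>C"
      then obtain U V where UV: "U \<in> C" "V \<in> C" "a \<in> U" "b \<in> V" by auto
      then obtain W where "W \<in> C" "a \<in> W" "b \<in> W" using tot by blast
      then show "a + b \<in> \<Union>C" using CA ideal_add[of W] by blast
    next
      fix c a assume "a \<in> \<Union>C"
      then show "c * a \<in> \<Union>C" using CA ideal_mult_left by blast
    qed
    then show "\<Union>C \<in> ?A" using C(1) CA by auto
  qed
  then obtain M where M: "is_ideal M" "I \<subseteq> M" "1 \<notin> M"
    and max: "\<And>U. is_ideal U \<Longrightarrow> M \<subseteq> U \<Longrightarrow> 1 \<notin> U \<Longrightarrow> U = M" by auto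
  have "b \<in> M" if ab: "a * b \<in> M" and a: "a \<notin> M" for a b
  proof -
    let ?U = "ideal_gen (M \<union> id ` {a})"
    have "M \<subseteq> ?U" "a \<in> ?U" by (auto intro: ideal_gen_base)
    then have "1 \<in> ?U" using max[OF is_ideal_ideal_gen, of "M \<union> id ` {a}"] a by auto
    then obtain c where "1 - c a * a \<in> M" using ideal_gen_Un_image[OF M(1), of "{a}" 1 id] by auto
    then have "b * (1 - c a * a) + c a * (a * b) \<in> M"
      by (rule ideal_add[OF M(1) ideal_mult_left[OF M(1)] ideal_mult_left[OF M(1) ab]])
    then show "b \<in> M" by (simp add: algebra_simps)
  qed
  then have "is_prime_ideal M" using M by (auto simp: is_prime_ideal_def)
  then show ?thesis using that M by blast
qed

lemma mem_prime_power: "is_prime_ideal P \<Longrightarrow> a ^ n \<in> P \<Longrightarrow> a \<in> P"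
  by (induction n) (auto simp: is_prime_ideal_def)

lemma is_prime_ideal_eval_at: "is_prime_ideal {f. eval_at (e :: 'x::finite \<Rightarrow> 'k::field) f = 0}"
  unfolding is_prime_ideal_def
  by (auto intro!: is_idealI simp: eval_at_simps)

lemma topspace_zariski: "topspace (zariski I) = Spec I"
proof -
  have "openin (zariski I) (Spec I)"
    unfolding openin_zariski by (rule exI[of _ UNIV]) (auto simp: Spec_def is_prime_ideal_def)
  moreover have "U \<subseteq> Spec I" if "openin (zariski I) U" for U
    using that unfolding openin_zariski by auto
  ultimately show ?thesis unfolding topspace_def by blast
qed

text \<open>
  A prime ideal containing powers of all \<open>var x - const (e x)\<close> is the maximal ideal of \<open>e\<close>, so the
  underlying space has at most one point.
\<close>

lemma connected_if_infinitesimal: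
  fixes H :: "('x::finite, 'k::field) group_scheme"
  assumes "\<And>x. (var x - const (e x)) ^ n \<in> rel H"
  shows "connected_group H"
proof -
  have P: "P = {f. eval_at e f = 0}" if "P \<in> Spec (rel H)" for P
  proof -
    have P: "is_prime_ideal P" "rel H \<subseteq> P" using that by (auto simp: Spec_def)
    then have idl: "is_ideal P" by (simp add: is_prime_ideal_def)
    have "cong_mod P (var x) (const (e x))" for x
      using mem_prime_power[OF P(1)] assms P(2) unfolding cong_mod_def by blast
    then have "cong_mod P (subst var f) (subst (\<lambda>x. const (e x)) f)" for f
      by (rule cong_mod_subst[OF idl])
    then have "f \<in> P \<longleftrightarrow> const (eval_at e f) \<in> P" for f
      using cong_mod_mem[OF idl] by (simp add: subst_const_point)
    moreover have "const c \<in> P \<longleftrightarrow> c = 0" for c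
    proof
      assume "const c \<in> P"
      then have "const (inverse c * c) \<in> P" unfolding const_mult by (rule ideal_mult_left[OF idl])
      then show "c = 0" using P(1) by (cases "c = 0") (auto simp: is_prime_ideal_def)
    qed (simp add: ideal_0[OF idl])
    ultimately show ?thesis by auto
  qed
  then have "U = {} \<or> U = {{f. eval_at e f = 0}}" if "openin (zariski (rel H)) U" for U
    using openin_subset[OF that] unfolding topspace_zariski by blast
  then show ?thesis
    unfolding connected_group_def connected_space_def by (metis Int_absorb)
qed

lemma connected_frobenius_kernel:
  fixes G :: "('x::finite, 'k::field) group_scheme"
  assumes char: "CHAR('k) > 0"
  shows "connected_group (frobenius_kernel i G)"
  by (rule connected_if_infinitesimal[of "unt G" "CHAR('k) ^ i"])
     (auto simp: rel_frobenius_kernel[OF char refl] intro: ideal_gen_base)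

section \<open>The Frobenius kernels of a connected group are dense\<close>

lemma sliceL_mult_in2:
  assumes "lin_form \<phi>"
  shows "sliceL \<phi> (g * in2 f) = sliceL \<phi> g * f"
proof (induction g rule: tensor_induct)
  case (tensor a b)
  have "in1 a * in2 b * in2 f = in1 a * in2 (b * f)" by (simp add: subst_mult mult.assoc)
  then show ?case by (simp add: sliceL_tensor[OF assms] mult.assoc)
qed (simp_all add: sliceL_0 sliceL_add distrib_right)

lemma ideal_sum_decompose:
  assumes I: "is_ideal I" and J: "is_ideal J" and f: "f \<in> ideal_gen (I \<union> J)"
  obtains a where "a \<in> J" "f - a \<in> I"
proof -
  have "\<exists>a\<in>J. f - a \<in> I" using f
  proof (induction rule: ideal_gen_induct)
    case zero
    then show ?case by (intro bexI[of _ 0]) (auto intro: ideal_0[OF I] ideal_0[OF J])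
  next
    case (step c s b)
    then obtain a where a: "a \<in> J" "b - a \<in> I" by blast
    from step(1) show ?case
    proof
      assume "s \<in> I"
      then have "c * s + (b - a) \<in> I" using a by (intro ideal_add[OF I] ideal_mult_left[OF I])
      then show ?thesis using a by (intro bexI[of _ a]) (auto simp: algebra_simps)
    next
      assume "s \<in> J"
      then have "c * s + a \<in> J" using a by (intro ideal_add[OF J] ideal_mult_left[OF J])
      then show ?thesis using a by (intro bexI[of _ "c * s + a"]) (auto simp: algebra_simps)
    qed
  qed
  then show ?thesis using that by blast
qed

text \<open>
  Let \<open>I\<close> be the ideal of \<open>H\<close>, \<open>J\<close> the intersection of the ideals of the Frobenius kernels and \<open>N\<close>
  the annihilator of \<open>J\<close> modulo \<open>I\<close>. The open set where some element of \<open>N\<close> is invertible is where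
  \<open>J\<close> vanishes. It contains the identity by Krull's theorem. Since \<open>J\<close> defines a subgroup, it
  contains every point of this subgroup by translation, which in terms of ideals says that \<open>J\<close> and
  \<open>N\<close> generate the unit ideal. As \<open>J N\<close> is contained in \<open>I\<close>, the space of \<open>H\<close> is the disjoint
  union of the closed sets of \<open>J\<close> and \<open>N\<close>, and connectedness makes the second one empty.
\<close>

theorem frobenius_kernels_dense:
  fixes H :: "('x::finite, 'k::field) group_scheme"
  assumes char: "CHAR('k) > 0" and H: "alg_group H" and conn: "connected_group H"
  shows "(\<Inter>i. rel (frobenius_kernel i H)) = rel H"
proof
  show "rel H \<subseteq> (\<Inter>i. rel (frobenius_kernel i H))"
    using rel_subset_frobenius_kernel by blast
next
  define I where "I = rel H"
  define J where "J = (\<Inter>i. rel (frobenius_kernel i H))"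
  have I: "is_ideal I" unfolding I_def by (rule alg_group_is_ideal[OF H])
  have J: "is_ideal J" unfolding J_def by (rule is_ideal_Inter) (auto intro:
      is_ideal_frobenius_kernel)
  have IJ: "I \<subseteq> J" unfolding I_def J_def using rel_subset_frobenius_kernel by blast
  note Hi = alg_group_frobenius_kernel[OF char H]
  have HJ: "alg_group (H\<lparr>rel := J\<rparr>)"
  proof (rule alg_group_restrict[OF H J])
    show "rel H \<subseteq> J" using IJ by (simp add: I_def)
    show "point J (prod_ideal J J) (mlt H)" unfolding point_def
    proof
      fix f assume "f \<in> J"
      then have "subst (mlt H) f \<in> prod_ideal (rel (frobenius_kernel i H)) (rel (frobenius_kernel
          i H))" for i
        using alg_group_mlt[OF Hi, of f i] by (simp add: J_def)
      then show "subst (mlt H) f \<in> prod_ideal J J"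
        unfolding J_def
        by (intro prod_ideal_INT is_ideal_frobenius_kernel decseq_frobenius_kernel char)
    qed
    show "eval_at (unt H) f = 0" if "f \<in> J" for f
      using alg_group_unt[OF Hi, of f 0] that by (simp add: J_def)
    show "point J J (ivs H)"
      unfolding point_def J_def using alg_group_ivs[OF Hi] by auto
  qed

  \<comment> \<open>By Krull's theorem \<open>J\<close> vanishes near the identity: some \<open>b\<close> with \<open>b = 1\<close> there kills \<open>J\<close>.\<close>
  obtain b where b: "eval_at (unt H) b = 1" "\<And>f. f \<in> J \<Longrightarrow> b * f \<in> I"
  proof -
    have "prime CHAR('k)" using prime_CHAR_semidom char by blast
    then have "strict_mono (\<lambda>i. CHAR('k) ^ i)"
      by (intro strict_monoI power_strict_increasing prime_gt_1_nat)
    then have kr: "\<exists>a. eval_at (unt H) a = 0 \<and> (1 - a) * f \<in> I" if "f \<in> J" for f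
      using krull_intersection[OF I, of "\<lambda>i. CHAR('k) ^ i" f "unt H"] that
      unfolding J_def I_def by (auto simp: rel_frobenius_kernel[OF char refl])
    obtain A where A: "finite A" "A \<subseteq> J" "ideal_gen A = J" using hilbert_basis[OF J] by blast
    have "\<forall>f\<in>A. \<exists>a. eval_at (unt H) a = 0 \<and> (1 - a) * f \<in> I" using kr A(2) by blast
    from bchoice[OF this] obtain a where a: "\<And>f. f \<in> A \<Longrightarrow> eval_at (unt H) (a f) = 0"
      "\<And>f. f \<in> A \<Longrightarrow> (1 - a f) * f \<in> I" by blast
    define b where "b = (\<Prod>f\<in>A. 1 - a f)"
    have "eval_at (unt H) (\<Prod>f\<in>A'. 1 - a f) = 1" if "A' \<subseteq> A" for A'
      using finite_subset[OF that A(1)] that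
      by (induction rule: finite_induct)
         (auto simp: a eval_at_simps)
    then have "eval_at (unt H) b = 1" by (simp add: b_def)
    moreover have "b * f \<in> I" if "f \<in> J" for f
    proof -
      have "is_ideal ((*) b -` I)"
        by (rule is_idealI)
           (auto simp: ideal_0[OF I] distrib_left mult.left_commute intro: ideal_add[OF I]
               ideal_mult_left[OF I])
      moreover have "A \<subseteq> (*) b -` I"
      proof
        fix f assume f: "f \<in> A"
        have "b * f = (\<Prod>f\<in>A - {f}. 1 - a f) * ((1 - a f) * f)"
          unfolding b_def using prod.remove[OF A(1) f, of "\<lambda>f. 1 - a f"] by (simp add: ac_simps)
        then show "f \<in> (*) b -` I" using a(2)[OF f] ideal_mult_left[OF I] by simp
      qed
      ultimately show ?thesis using ideal_gen_least A(3) that by blast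
    qed
    ultimately show ?thesis using that by blast
  qed

  \<comment> \<open>For a point \<open>a\<close> of the subgroup of \<open>J\<close>, the translate \<open>b (a x)\<close> also kills \<open>J\<close>. Letting \<open>a\<close> be
      generic and then equal to the inverse of \<open>x\<close> turns \<open>b (a x)\<close> into the value
      of \<open>b\<close> at the identity, which is \<open>1\<close>.\<close>
  define N where "N = {u. \<forall>f\<in>J. u * f \<in> I}"
  have N: "is_ideal N"
    unfolding N_def by (rule is_idealI)
      (auto simp: ideal_0[OF I] distrib_right mult.assoc intro: ideal_add[OF I]
          ideal_mult_left[OF I])
  have IN: "I \<subseteq> N" unfolding N_def using ideal_mult_right[OF I] by blast
  have B: "subst (mlt H) b * in2 f \<in> prod_ideal J I" if f: "f \<in> J" for f
  proof -
    let ?K = "prod_ideal J I" and ?a = "\<lambda>x. var (Inl x)" and ?x = "\<lambda>x. var (Inr x)"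
    let ?y = "pmul H ?a ?x"
    note K = is_ideal_prod_ideal[of J I]
    have aJ: "point J ?K ?a" and x: "point I ?K ?x" by (rule point_left point_right)+
    have a: "point I ?K ?a" using aJ IJ by (auto intro: point_antimono)
    have y: "point I ?K ?y" using point_pmul[OF H K] a x by (simp add: I_def)
    let ?K' = "{g. subst ?y b * g \<in> ?K}"
    have K': "is_ideal ?K'"
      by (rule is_idealI)
         (auto simp: ideal_0[OF K] distrib_left mult.left_commute intro: ideal_add[OF K]
             ideal_mult_left[OF K])
    have "point J ?K (pinv H ?a)"
      using point_pinv[OF HJ K, of ?a] aJ by simp
    then have 1: "point J ?K' (pinv H ?a)"
      unfolding point_def using ideal_mult_left[OF K] by blast
    have 2: "point J ?K' ?y"
      unfolding point_def using b(2) y by (auto simp: point_def simp flip: subst_mult)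
    have "subst (mlt H) f \<in> prod_ideal J J" using alg_group_mlt[OF HJ, of f] f by simp
    then have "subst (pmul H (pinv H ?a) ?y) f \<in> ?K'"
      unfolding subst_of_pmul[of H "pinv H ?a"] by (rule pointD[OF point_case_sum[OF K' 1 2]])
    then have "subst ?y b * subst (pmul H (pinv H ?a) ?y) f \<in> ?K" by simp
    moreover have "cong_mod ?K (subst (pmul H (pinv H ?a) ?y) f) (subst ?x f)"
      using pinv_pmul_cancel[OF H K] a x by (intro pt_eq_subst[OF K]) (simp add: I_def)
    then have "cong_mod ?K (subst ?y b * subst (pmul H (pinv H ?a) ?y) f) (subst ?y b * subst ?x f)"
      by (intro cong_mod_mult[OF K] cong_mod_refl[OF K])
    ultimately show ?thesis
      using cong_mod_mem[OF K] unfolding mlt_eq_pmul[symmetric] by blast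
  qed
  have "subst (mlt H) b \<in> prod_ideal J N"
    unfolding mem_prod_ideal_iff_sliceL[OF J N]
  proof
    fix \<phi> assume \<phi>: "\<phi> \<in> annih J"
    then have lf: "lin_form \<phi>" by (simp add: annih_def)
    show "sliceL \<phi> (subst (mlt H) b) \<in> N"
      unfolding N_def using sliceL_mem[OF J I \<phi> B] by (simp add: sliceL_mult_in2[OF lf])
  qed
  moreover have "point (prod_ideal J N) (ideal_gen (J \<union> N)) (case_sum (pinv H var) var)"
  proof (rule point_case_sum[OF is_ideal_ideal_gen])
    show "point J (ideal_gen (J \<union> N)) (pinv H var)"
      using alg_group_ivs[OF HJ] by (auto simp: point_def ivs_eq_pinv[symmetric] intro:
          ideal_gen_base)
    show "point N (ideal_gen (J \<union> N)) var" by (auto simp: point_def intro: ideal_gen_base)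
  qed
  ultimately have "subst (pmul H (pinv H var) var) b \<in> ideal_gen (J \<union> N)"
    unfolding subst_of_pmul using pointD by blast
  moreover have "cong_mod (ideal_gen (J \<union> N)) (subst (pmul H (pinv H var) var) b) 1"
  proof -
    have "cong_mod I (subst (pmul H (pinv H var) var) b) (subst (pone H) b)"
      using alg_group_unit_generic(3)[OF H] by (intro pt_eq_subst[OF I]) (simp add: I_def)
    moreover have "subst (pone H) b = 1"
      unfolding pone_def subst_const_point using b(1) by simp
    moreover have "I \<subseteq> ideal_gen (J \<union> N)" using IJ by (auto intro: ideal_gen_base)
    ultimately show ?thesis using cong_mod_mono by metis
  qed
  ultimately have "1 \<in> ideal_gen (J \<union> N)" using cong_mod_mem[OF is_ideal_ideal_gen] by blast
  then obtain u where u: "u \<in> N" "1 - u \<in> J" by (rule ideal_sum_decompose[OF J N])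

  \<comment> \<open>Hence the closed subgroup of \<open>J\<close> is also open.\<close>
  let ?E1 = "{P \<in> Spec I. \<not> {u} \<subseteq> P}" and ?E2 = "{P \<in> Spec I. \<not> {1 - u} \<subseteq> P}"
  have uI: "u * (1 - u) \<in> I" using u by (simp add: N_def)
  have "Spec I \<subseteq> ?E1 \<union> ?E2"
  proof
    fix P assume P: "P \<in> Spec I"
    then have "is_ideal P" "1 \<notin> P" by (auto simp: Spec_def is_prime_ideal_def)
    then have "\<not> (u \<in> P \<and> 1 - u \<in> P)" using ideal_add[of P u "1 - u"] by auto
    then show "P \<in> ?E1 \<union> ?E2" using P by auto
  qed
  moreover have "?E1 \<inter> ?E2 = {}"
  proof -
    have "u \<in> P \<or> 1 - u \<in> P" if "P \<in> Spec I" for P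
      using that uI unfolding Spec_def is_prime_ideal_def by blast
    then show ?thesis by auto
  qed
  moreover have "openin (zariski I) ?E1" "openin (zariski I) ?E2"
    unfolding openin_zariski by blast+
  moreover have "?E1 \<noteq> {}"
  proof -
    have "eval_at (unt H) (1 - u) = 0" using alg_group_unt[OF HJ, of "1 - u"] u(2) by simp
    then have "eval_at (unt H) u = 1"
      by (simp add: eval_at_simps)
    then have "{f. eval_at (unt H) f = 0} \<in> ?E1"
      using is_prime_ideal_eval_at alg_group_unt[OF H] by (auto simp: Spec_def I_def)
    then show ?thesis by blast
  qed
  moreover have "E2 = {}" if "Spec I \<subseteq> E1 \<union> E2" "E1 \<inter> E2 = {}" "openin (zariski I) E1"
    "openin (zariski I) E2" "E1 \<noteq> {}" for E1 E2
    using conn that unfolding connected_group_def connected_space_def topspace_zariski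
        I_def[symmetric] by blast
  ultimately have E2: "?E2 = {}" by meson
  have "1 \<in> ideal_gen (I \<union> id ` {u})"
  proof (rule ccontr)
    assume "1 \<notin> ideal_gen (I \<union> id ` {u})"
    then obtain P where P: "is_prime_ideal P" "ideal_gen (I \<union> id ` {u}) \<subseteq> P"
      using exists_prime_ideal[OF is_ideal_ideal_gen] by blast
    have "I \<union> id ` {u} \<subseteq> P" using P(2) ideal_gen_base[of _ "I \<union> id ` {u}"] by blast
    then have "P \<in> Spec I" "u \<in> P" using P(1) by (auto simp: Spec_def)
    then have "1 - u \<in> P" using E2 by blast
    then show False
      using P(1) \<open>u \<in> P\<close> ideal_add[of P u "1 - u"] by (auto simp: is_prime_ideal_def)
  qed
  then obtain c where c: "1 - c u * u \<in> I" using ideal_gen_Un_image[OF I, of "{u}" 1 id] by auto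
  \<comment> \<open>\<open>u\<close> is a unit modulo \<open>I\<close> that kills \<open>J\<close>\<close>
  have "f \<in> I" if f: "f \<in> J" for f
  proof -
    have "u * f \<in> I" using u(1) f by (auto simp: N_def)
    then have "(1 - c u * u) * f + c u * (u * f) \<in> I"
      using ideal_add[OF I ideal_mult_right[OF I c] ideal_mult_left[OF I]] by blast
    then show ?thesis by (simp add: algebra_simps)
  qed
  then show "(\<Inter>i. rel (frobenius_kernel i H)) \<subseteq> rel H" unfolding I_def J_def by blast
qed

section \<open>Detecting diagonalisability\<close>

abbreviation lincomb :: "(('x, 'k::field) mpoly \<Rightarrow> 'k) \<Rightarrow> ('x, 'k) mpoly set \<Rightarrow> ('x, 'k) mpoly" where
  "lincomb c A \<equiv> \<Sum>\<chi>\<in>A. const (c \<chi>) * \<chi>"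

text \<open>
  Induction on \<open>B\<close>, adding one vector \<open>b\<close> to \<open>B\<close> at a level that works for \<open>B\<close>: two bad vectors
  \<open>v\<close> and \<open>v'\<close> at different later levels, both scaled to have coefficient \<open>1\<close> at \<open>b\<close>, differ by an
  element of the span of \<open>B\<close>, so they agree modulo the intersection, and \<open>v\<close> lies in all levels
  that contain \<open>v'\<close>.
\<close>

lemma finite_dim_chain:
  fixes J :: "nat \<Rightarrow> ('x, 'k::field) mpoly set"
  assumes J: "\<And>n. is_ideal (J n)" and dec: "decseq J" and B: "finite B"
  obtains i where "mp.span B \<inter> J i \<subseteq> (\<Inter>n. J n)"
proof -
  have mono: "J n \<subseteq> J m" if "m \<le> n" for m n using dec that by (auto simp: decseq_def)
  let ?W = "\<Inter>n. J n"
  have W: "is_ideal ?W" by (rule is_ideal_Inter) (use J in auto)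
  have "\<exists>i. mp.span B \<inter> J i \<subseteq> ?W" using B
  proof (induction B rule: finite_induct)
    case empty
    show ?case using ideal_0[OF W] by simp
  next
    case (insert b B)
    then obtain i where i: "mp.span B \<inter> J i \<subseteq> ?W" by blast
    show ?case
    proof (rule ccontr)
      assume neg: "\<not> ?thesis"
      \<comment> \<open>scaled to coefficient \<open>1\<close> at \<open>b\<close>, bad vectors differ by elements of the span of \<open>B\<close>\<close>
      have bad: "\<exists>v\<in>J j. v - b \<in> mp.span B \<and> v \<notin> ?W" if j: "i \<le> j" for j
      proof -
        obtain v where v: "v \<in> mp.span (insert b B)" "v \<in> J j" "v \<notin> ?W"
          using neg by blast
        obtain c where c: "v - const c * b \<in> mp.span B"
          using v(1) mp.span_breakdown_eq[of v b B] by blast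
        have "c \<noteq> 0"
        proof
          assume "c = 0"
          then have "v \<in> mp.span B" using c by simp
          then show False using i v mono[OF j] by blast
        qed
        then have inv: "const (inverse c) * const c = (1 :: ('x, 'k) mpoly)"
          by (simp flip: const_mult)
        have "const (inverse c) * v - b = const (inverse c) * (v - const c * b)"
          using inv by (simp add: right_diff_distrib flip: mult.assoc)
        then have "const (inverse c) * v - b \<in> mp.span B"
          using mp.span_scale[OF c, of "inverse c"] by simp
        moreover have "const (inverse c) * v \<in> J j" by (rule ideal_mult_left[OF J v(2)])
        moreover have "const (inverse c) * v \<notin> ?W"
        proof
          assume "const (inverse c) * v \<in> ?W"
          then have "const c * (const (inverse c) * v) \<in> ?W" by (rule ideal_mult_left[OF W])
          moreover have "const c * (const (inverse c) * v) = v"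
            using inv by (metis mult.assoc mult.commute mult_1)
          ultimately show False using v(3) by simp
        qed
        ultimately show ?thesis by blast
      qed
      obtain v where v: "v \<in> J i" "v - b \<in> mp.span B" "v \<notin> ?W" using bad[of i] by blast
      then obtain k where k: "v \<notin> J k" by blast
      obtain v' where v': "v' \<in> J (max i k)" "v' - b \<in> mp.span B" using bad[of "max i k"] by auto
      have v'i: "v' \<in> J i" "v' \<in> J k" using v'(1) mono[of i "max i k"] mono[of k "max i k"] by auto
      have "v - v' \<in> mp.span B" using mp.span_diff[OF v(2) v'(2)] by simp
      then have "v - v' \<in> J k" using i ideal_diff[OF J v(1) v'i(1)] by blast
      then show False using ideal_diffD[OF J _ v'i(2)] k by blast
    qed
  qed
  then show ?thesis using that by blast
qed

lemma slices_finite_dim: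
  fixes g :: "('x::finite + 'y::finite, 'k::field) mpoly"
  obtains A B where "finite A" "finite B" "\<And>\<psi>. lin_form \<psi> \<Longrightarrow> sliceR \<psi> g \<in> mp.span A"
    "\<And>\<phi>. lin_form \<phi> \<Longrightarrow> sliceL \<phi> g \<in> mp.span B"
proof -
  obtain n a b where g: "g = (\<Sum>i<(n::nat). in1 (a i) * in2 (b i))" using tensor_sum_form[of g]
      by auto
  have "sliceR \<psi> g \<in> mp.span (a ` {..<n})" if "lin_form \<psi>" for \<psi>
    unfolding g sliceR_sum sliceR_tensor[OF that]
    by (intro mp.span_sum mp.span_scale mp.span_base) auto
  moreover have "sliceL \<phi> g \<in> mp.span (b ` {..<n})" if "lin_form \<phi>" for \<phi>
    unfolding g sliceL_sum sliceL_tensor[OF that]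
    by (intro mp.span_sum mp.span_scale mp.span_base) auto
  ultimately show ?thesis using that[of "a ` {..<n}" "b ` {..<n}"] by simp
qed

text \<open>
  Local finiteness: a slice of \<open>f (x y)\<close> is a combination of translates of \<open>f\<close>, and finitely many
  functions suffice to write \<open>f (x y)\<close> as a sum of tensors. Applying this once more to each of
  these functions bounds the two-sided translates.
\<close>

lemma translates_finite_dim:
  fixes f :: "('x::finite, 'k::field) mpoly" and d :: "'x \<Rightarrow> ('x + 'x, 'k) mpoly"
  obtains B where "finite B" "f \<in> mp.span B"
    "\<And>\<psi>. lin_form \<psi> \<Longrightarrow> sliceR \<psi> (subst d f) \<in> mp.span B"
    "\<And>\<psi> \<psi>'. lin_form \<psi> \<Longrightarrow> lin_form \<psi>' \<Longrightarrow> sliceR \<psi>' (subst d (sliceR \<psi> (subst d f))) \<in> mp.span B"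
    "\<And>\<psi> \<phi>. lin_form \<psi> \<Longrightarrow> lin_form \<phi> \<Longrightarrow> sliceL \<phi> (subst d (sliceR \<psi> (subst d f))) \<in> mp.span B"
proof -
  obtain A where A: "finite A" "\<And>\<psi>. lin_form \<psi> \<Longrightarrow> sliceR \<psi> (subst d f) \<in> mp.span A"
    using slices_finite_dim[of "subst d f"] by metis
  have "\<forall>a. \<exists>B. finite B \<and> (\<forall>\<psi>. lin_form \<psi> \<longrightarrow> sliceR \<psi> (subst d a) \<in> mp.span B)
      \<and> (\<forall>\<phi>. lin_form \<phi> \<longrightarrow> sliceL \<phi> (subst d a) \<in> mp.span B)"
  proof
    fix a
    obtain B C where "finite B" "finite C" "\<And>\<psi>. lin_form \<psi> \<Longrightarrow> sliceR \<psi> (subst d a) \<in> mp.span B"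
      "\<And>\<phi>. lin_form \<phi> \<Longrightarrow> sliceL \<phi> (subst d a) \<in> mp.span C"
      by (rule slices_finite_dim[of "subst d a"]) blast
    then show "\<exists>B. finite B \<and> (\<forall>\<psi>. lin_form \<psi> \<longrightarrow> sliceR \<psi> (subst d a) \<in> mp.span B)
      \<and> (\<forall>\<phi>. lin_form \<phi> \<longrightarrow> sliceL \<phi> (subst d a) \<in> mp.span B)"
      using mp.span_mono[of B "B \<union> C"] mp.span_mono[of C "B \<union> C"]
      by (intro exI[of _ "B \<union> C"]) blast
  qed
  from choice[OF this] obtain S where S: "\<And>a. finite (S a)"
    "\<And>a \<psi>. lin_form \<psi> \<Longrightarrow> sliceR \<psi> (subst d a) \<in> mp.span (S a)"
    "\<And>a \<phi>. lin_form \<phi> \<Longrightarrow> sliceL \<phi> (subst d a) \<in> mp.span (S a)" by blast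
  define B where "B = insert f (A \<union> (\<Union>a\<in>A. S a))"
  have "finite B" unfolding B_def using A(1) S(1) by auto
  moreover have "f \<in> mp.span B" by (rule mp.span_base) (simp add: B_def)
  moreover have "mp.span A \<subseteq> mp.span B" by (rule mp.span_mono) (auto simp: B_def)
  moreover have SB: "mp.span (S a) \<subseteq> mp.span B" if "a \<in> A" for a
    by (rule mp.span_mono) (use that in \<open>auto simp: B_def\<close>)
  have "sliceR \<psi> (subst d v) \<in> mp.span B" if \<psi>: "lin_form \<psi>" and v: "v \<in> mp.span A" for \<psi> v
    using v
  proof (induction rule: mp.span_induct_alt)
    case base then show ?case by (simp add: subst_0 sliceR_0 mp.span_zero)
  next
    case (step c x y)
    have "sliceR \<psi> (subst d x) \<in> mp.span B" using S(2)[OF \<psi>] SB[OF step(1)] by blast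
    then show ?case
      by (simp add: subst_add subst_mult sliceR_add sliceR_const_mult mp.span_add mp.span_scale
          step(2))
  qed
  moreover have "sliceL \<phi> (subst d v) \<in> mp.span B" if \<phi>: "lin_form \<phi>" and v: "v \<in> mp.span A" for \<phi> v
    using v
  proof (induction rule: mp.span_induct_alt)
    case base then show ?case by (simp add: subst_0 sliceL_0 mp.span_zero)
  next
    case (step c x y)
    have "sliceL \<phi> (subst d x) \<in> mp.span B" using S(3)[OF \<phi>] SB[OF step(1)] by blast
    then show ?case
      by (simp add: subst_add subst_mult sliceL_add sliceL_const_mult mp.span_add mp.span_scale
          step(2))
  qed
  ultimately show ?thesis using that[of B] A(2) by blast
qed

text \<open>
  A morphism \<open>u\<close> from the closed subscheme of \<open>K\<close> to \<open>H\<close> along which the functions on \<open>H\<close> become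
  combinations of the functions in \<open>E\<close>, and along which the comultiplication of \<open>H\<close> treats the
  elements of \<open>E\<close> as group-like. A homomorphism from a diagonalisable group to \<open>H\<close> is an example;
  the definition refers only to the comultiplication of \<open>H\<close>, so that a product of two groups can
  serve as source through its ideal alone.
\<close>

definition diagonal_chart ::
  "('x::finite, 'k::field) group_scheme \<Rightarrow> ('y::finite, 'k) mpoly set \<Rightarrow> ('x \<Rightarrow> ('y, 'k) mpoly)
    \<Rightarrow> ('y, 'k) mpoly set \<Rightarrow> bool" where
  "diagonal_chart H K u E \<longleftrightarrow> is_ideal K \<and> point (rel H) K u \<and>
    (\<forall>g. \<exists>A c. finite A \<and> A \<subseteq> E \<and> cong_mod K (subst u g) (lincomb c A)) \<and>
    (\<forall>g A c. finite A \<and> A \<subseteq> E \<and> cong_mod K (subst u g) (lincomb c A) \<longrightarrow>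
      cong_mod (prod_ideal K K)
        (subst (case_sum (\<lambda>x. in1 (u x)) (\<lambda>x. in2 (u x))) (subst (mlt H) g))
        (\<Sum>\<chi>\<in>A. const (c \<chi>) * (in1 \<chi> * in2 \<chi>)))"

text \<open>
  Putting the identity for one argument gives \<open>v x = v 1 * v x\<close>, hence \<open>v 1 = 1\<close> unless \<open>v\<close>
  vanishes, and then \<open>v\<close> of the inverse is an inverse of \<open>v\<close>.
\<close>

lemma unit_if_multiplicative:
  fixes H :: "('x::finite, 'k::field) group_scheme"
  assumes H: "alg_group H" and v: "v \<notin> rel H"
    and mult: "subst (mlt H) v - in1 v * in2 v \<in> prod_ideal (rel H) (rel H)"
  shows "group_like H v"
proof -
  note I = alg_group_is_ideal[OF H]
  let ?e = "eval_at (unt H) v"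
  have eval: "cong_mod (rel H) (subst (pmul H a b) v) (subst a v * subst b v)"
    if "point (rel H) (rel H) a" "point (rel H) (rel H) b" for a b
  proof -
    have "subst (case_sum a b) (subst (mlt H) v - in1 v * in2 v) \<in> rel H"
      by (rule pointD[OF point_case_sum[OF I that] mult])
    then show ?thesis
      by (simp add: cong_mod_def subst_diff subst_mult subst_of_pmul) (simp add: subst_subst)
  qed
  have one: "subst (pone H) v = const ?e"
    unfolding pone_def by (rule subst_const_point)
  have "cong_mod (rel H) (subst (pmul H (pone H) var) v) (const ?e * v)"
    using eval[OF point_pone[OF H I] point_var] by (simp add: one)
  moreover have "cong_mod (rel H) (subst (pmul H (pone H) var) v) v"
    using pt_eq_subst[OF I alg_group_unit_generic(1)[OF H], of v] by simp
  ultimately have "cong_mod (rel H) v (const ?e * v)"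
    using cong_mod_sym[OF I] cong_mod_trans[OF I] by blast
  then have *: "const (1 - ?e) * v \<in> rel H"
    by (simp add: cong_mod_def const_diff left_diff_distrib)
  have e: "?e = 1"
  proof (rule ccontr)
    assume "?e \<noteq> 1"
    then have "const (inverse (1 - ?e)) * (const (1 - ?e) * v) = v"
      by (simp flip: mult.assoc const_mult)
    then show False using ideal_mult_left[OF I *, of "const (inverse (1 - ?e))"] v by simp
  qed
  have "cong_mod (rel H) (subst (pmul H var (pinv H var)) v) (v * subst (pinv H var) v)"
    using eval[OF point_var point_pinv[OF H I point_var]] by simp
  moreover have "cong_mod (rel H) (subst (pmul H var (pinv H var)) v) 1"
    using pt_eq_subst[OF I alg_group_unit_generic(4)[OF H], of v] by (simp add: one e)
  ultimately have "cong_mod (rel H) (v * subst (pinv H var) v) 1"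
    using cong_mod_sym[OF I] cong_mod_trans[OF I] by blast
  then show ?thesis using mult by (auto simp: group_like_def cong_mod_def)
qed

text \<open>
  In a shortest expansion \<open>\<Sum>\<chi>\<in>A. c \<chi> * \<chi>\<close> of \<open>f\<close> along a chart the elements of \<open>A\<close> are linearly
  independent, so that each has a dual functional. Applying it to the second factor of the
  comultiplication of \<open>f\<close> gives a function that restricts to \<open>\<chi>\<close> up to a factor. The chart is
  chosen injective on a finite-dimensional space that contains these functions and the slices of
  their comultiplications. This is enough to pull the multiplicativity of \<open>\<chi>\<close> back to \<open>H\<close>, first
  in one tensor factor and then in the other.
\<close>

theorem diagonalisable_if_charts:
  fixes H :: "('x::finite, 'k::field) group_scheme"
  assumes H: "alg_group H"
    and charts: "\<And>B. finite B \<Longrightarrow> \<exists>(K :: ('y::finite, 'k) mpoly set) u E.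
      diagonal_chart H K u E \<and> (\<forall>g\<in>mp.span B. subst u g \<in> K \<longrightarrow> g \<in> rel H)"
  shows "diagonalisable H"
  unfolding diagonalisable_def
proof
  fix f :: "('x, 'k) mpoly"
  note I = alg_group_is_ideal[OF H]
  obtain B where B: "finite B" "f \<in> mp.span B"
    "\<And>\<psi>. lin_form \<psi> \<Longrightarrow> sliceR \<psi> (subst (mlt H) f) \<in> mp.span B"
    "\<And>\<psi> \<psi>'. lin_form \<psi> \<Longrightarrow> lin_form \<psi>' \<Longrightarrow>
      sliceR \<psi>' (subst (mlt H) (sliceR \<psi> (subst (mlt H) f))) \<in> mp.span B"
    "\<And>\<psi> \<phi>. lin_form \<psi> \<Longrightarrow> lin_form \<phi> \<Longrightarrow>
      sliceL \<phi> (subst (mlt H) (sliceR \<psi> (subst (mlt H) f))) \<in> mp.span B"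
    by (rule translates_finite_dim[of f "mlt H"]) blast
  obtain K :: "('y, 'k) mpoly set" and u E where chart: "diagonal_chart H K u E"
    and inj: "\<And>g. g \<in> mp.span B \<Longrightarrow> subst u g \<in> K \<Longrightarrow> g \<in> rel H"
    using charts[OF B(1)] by blast
  have K: "is_ideal K" and u: "point (rel H) K u" using chart by (simp_all add: diagonal_chart_def)
  have spanning: "\<exists>A c. finite A \<and> A \<subseteq> E \<and> cong_mod K (subst u g) (lincomb c A)" for g
    using chart by (simp add: diagonal_chart_def)
  let ?\<Theta> = "subst (case_sum (\<lambda>x. in1 (u x)) (\<lambda>x. in2 (u x)))"
  have comult: "cong_mod (prod_ideal K K) (?\<Theta> (subst (mlt H) g)) (\<Sum>\<chi>\<in>A. const (c \<chi>) * (in1 \<chi> *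
      in2 \<chi>))"
    if "finite A" "A \<subseteq> E" "cong_mod K (subst u g) (lincomb c A)" for g A c
    using chart that by (simp add: diagonal_chart_def)

  \<comment> \<open>a shortest expansion of \<open>f\<close> along the chart\<close>
  let ?P = "\<lambda>n. \<exists>A c. finite A \<and> A \<subseteq> E \<and> card A = n \<and> cong_mod K (subst u f) (lincomb c A)"
  define n where "n = (LEAST n. ?P n)"
  have "\<exists>n. ?P n" using spanning[of f] by blast
  then have "?P n" unfolding n_def by (rule LeastI_ex)
  then obtain A c where A: "finite A" "A \<subseteq> E" "card A = n"
    and fA: "cong_mod K (subst u f) (lincomb c A)" by blast
  have minimal: False if "\<chi> \<in> A" "cong_mod K (subst u f) (lincomb d (A - {\<chi>}))" for \<chi> d
  proof -
    have "?P (card (A - {\<chi>}))" using that A by (intro exI[of _ "A - {\<chi>}"] exI[of _ d]) auto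
    then have "n \<le> card (A - {\<chi>})" unfolding n_def by (rule Least_le)
    then show False using that(1) A(1,3) card_Diff1_less[OF A(1) that(1)] by simp
  qed
  have split: "lincomb c A = const (c \<chi>) * \<chi> + lincomb c (A - {\<chi>})"
    if "\<chi> \<in> A" for \<chi> using sum.remove[OF A(1) that] by simp
  have c0: "c \<chi> \<noteq> 0" if "\<chi> \<in> A" for \<chi>
  proof
    assume "c \<chi> = 0"
    then have "cong_mod K (subst u f) (lincomb c (A - {\<chi>}))" using fA split[OF that] by simp
    then show False by (rule minimal[OF that])
  qed
  have dual: "\<exists>\<psi>\<in>annih K. \<psi> \<chi> = 1 \<and> (\<forall>\<eta>\<in>A - {\<chi>}. \<psi> \<eta> = 0)" and nz: "\<chi> \<notin> K" if \<chi>: "\<chi> \<in> A" for \<chi>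
  proof -
    have *: "\<chi> - lincomb d (A - {\<chi>}) \<notin> K" for d
    proof
      assume "\<chi> - lincomb d (A - {\<chi>}) \<in> K"
      then have "cong_mod K \<chi> (lincomb d (A - {\<chi>}))" by (simp add: cong_mod_def)
      then have "cong_mod K (lincomb c A)
          (const (c \<chi>) * lincomb d (A - {\<chi>}) + lincomb c (A - {\<chi>}))"
        unfolding split[OF \<chi>] by (intro cong_mod_add[OF K] cong_mod_mult[OF K] cong_mod_refl[OF K])
      moreover have "const (c \<chi>) * lincomb d (A - {\<chi>}) + lincomb c (A - {\<chi>})
          = (\<Sum>\<eta>\<in>A - {\<chi>}. const (c \<chi> * d \<eta> + c \<eta>) * \<eta>)"
        by (simp only: const_add const_mult distrib_right sum.distrib sum_distrib_left mult.assoc)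
      ultimately have "cong_mod K (subst u f) (\<Sum>\<eta>\<in>A - {\<chi>}. const (c \<chi> * d \<eta> + c \<eta>) * \<eta>)"
        using cong_mod_trans[OF K fA] by simp
      then show False by (rule minimal[OF \<chi>])
    qed
    from *[of "\<lambda>_. 0"] show "\<chi> \<notin> K" by simp
    obtain \<psi> where "\<psi> \<in> annih K" "\<psi> \<chi> = 1" "\<And>\<eta>. \<eta> \<in> A - {\<chi>} \<Longrightarrow> \<psi> \<eta> = 0"
      by (rule separating_form_modulo[OF K finite_Diff[OF A(1)] *]) blast
    then show "\<exists>\<psi>\<in>annih K. \<psi> \<chi> = 1 \<and> (\<forall>\<eta>\<in>A - {\<chi>}. \<psi> \<eta> = 0)" by blast
  qed

  \<comment> \<open>each element of the expansion is the restriction of a group-like slice of \<open>f (x y)\<close>\<close>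
  have lift: "\<exists>v. group_like H v \<and> v \<in> mp.span B \<and> cong_mod K (subst u v) \<chi>" if \<chi>: "\<chi> \<in> A" for \<chi>
  proof -
    obtain \<psi>0 where \<psi>0: "\<psi>0 \<in> annih K" "\<psi>0 \<chi> = 1" "\<forall>\<eta>\<in>A - {\<chi>}. \<psi>0 \<eta> = 0" using dual[OF \<chi>] by blast
    define \<psi> where "\<psi> = (\<lambda>g. \<psi>0 g / c \<chi>)"
    have \<psi>: "\<psi> \<in> annih K" "\<psi> \<chi> = 1 / c \<chi>" "\<And>\<eta>. \<eta> \<in> A - {\<chi>} \<Longrightarrow> \<psi> \<eta> = 0"
      using \<psi>0 by (auto simp: \<psi>_def annih_def lin_form_def add_divide_distrib)
    then have lf: "lin_form \<psi>" by (simp add: annih_def)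
    define \<psi>u where "\<psi>u = (\<lambda>g. \<psi> (subst u g))"
    have lfu: "lin_form \<psi>u" unfolding \<psi>u_def by (rule lin_form_subst[OF lf])
    define v where "v = sliceR \<psi>u (subst (mlt H) f)"
    have vB: "v \<in> mp.span B" unfolding v_def by (rule B(3)[OF lfu])
    have uv: "cong_mod K (subst u v) \<chi>"
    proof -
      have "subst u v = sliceR \<psi> (?\<Theta> (subst (mlt H) f))"
        unfolding v_def \<psi>u_def by (rule sliceR_subst[OF lf, symmetric])
      moreover have "sliceR \<psi> (?\<Theta> (subst (mlt H) f) - (\<Sum>\<eta>\<in>A. const (c \<eta>) * (in1 \<eta> * in2 \<eta>))) \<in> K"
        using comult[OF A(1,2) fA] by (intro sliceR_mem[OF K K \<psi>(1)]) (simp add: cong_mod_def)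
      moreover have "sliceR \<psi> (\<Sum>\<eta>\<in>A. const (c \<eta>) * (in1 \<eta> * in2 \<eta>)) =
          (\<Sum>\<eta>\<in>A. if \<eta> = \<chi> then \<chi> else 0)"
        unfolding sliceR_sum sliceR_const_mult sliceR_tensor[OF lf]
        by (rule sum.cong) (use \<psi> c0[OF \<chi>] in \<open>auto simp flip: mult.assoc const_mult\<close>)
      ultimately show ?thesis using A(1) \<chi> by (simp add: cong_mod_def sliceR_diff)
    qed
    \<comment> \<open>\<open>?w\<close> measures the failure of \<open>v\<close> to be multiplicative\<close>
    let ?w = "subst (mlt H) v - in1 v * in2 v"
    let ?M = "{g. subst u g \<in> K}"
    have M: "is_ideal ?M" using ring_map_vimage_ideal[OF ring_map_subst K, of u]
        by (simp add: vimage_def)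
    note KK = is_ideal_prod_ideal[of K K]
    have "cong_mod (prod_ideal K K) (?\<Theta> (subst (mlt H) v)) (in1 \<chi> * in2 \<chi>)"
      using comult[of "{\<chi>}" v "\<lambda>_. 1"] \<chi> A(2) uv by auto
    moreover have "cong_mod (prod_ideal K K) (?\<Theta> (in1 v * in2 v)) (in1 \<chi> * in2 \<chi>)"
    proof -
      have "?\<Theta> (in1 v * in2 v) = in1 (subst u v) * in2 (subst u v)"
        by (simp add: subst_mult subst_subst)
      moreover have "cong_mod (prod_ideal K K) (in1 (subst u v)) (in1 \<chi>)"
        "cong_mod (prod_ideal K K) (in2 (subst u v)) (in2 \<chi>)"
        using uv by (auto simp: cong_mod_def in1_mem_prod_ideal in2_mem_prod_ideal simp flip:
            subst_diff)
      ultimately show ?thesis using cong_mod_mult[OF KK] by metis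
    qed
    ultimately have "cong_mod (prod_ideal K K) (?\<Theta> (subst (mlt H) v)) (?\<Theta> (in1 v * in2 v))"
      using cong_mod_sym[OF KK] cong_mod_trans[OF KK] by blast
    then have "?\<Theta> ?w \<in> prod_ideal K K" by (simp add: cong_mod_def subst_diff)
    then have wM: "?w \<in> prod_ideal ?M ?M" by (rule prod_ideal_vimage[OF K K])
    \<comment> \<open>the slices of \<open>?w\<close> lie in the span of \<open>B\<close>, where the chart is injective\<close>
    have "sliceR \<psi>' ?w \<in> rel H" if \<psi>': "\<psi>' \<in> annih ?M" for \<psi>'
    proof -
      have lf': "lin_form \<psi>'" using \<psi>' by (simp add: annih_def)
      have "sliceR \<psi>' ?w = sliceR \<psi>' (subst (mlt H) v) - const (\<psi>' v) * v"
        by (simp add: sliceR_diff sliceR_tensor[OF lf'])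
      moreover have "sliceR \<psi>' (subst (mlt H) v) \<in> mp.span B" unfolding v_def
          by (rule B(4)[OF lfu lf'])
      ultimately have "sliceR \<psi>' ?w \<in> mp.span B"
        using mp.span_diff mp.span_scale[OF vB] by metis
      then show ?thesis using inj sliceR_mem[OF M M \<psi>' wM] by blast
    qed
    then have wIM: "?w \<in> prod_ideal (rel H) ?M" by (rule mem_prod_idealI_sliceR[OF I M])
    have "sliceL \<phi> ?w \<in> rel H" if \<phi>: "\<phi> \<in> annih (rel H)" for \<phi>
    proof -
      have lf': "lin_form \<phi>" using \<phi> by (simp add: annih_def)
      have "sliceL \<phi> ?w = sliceL \<phi> (subst (mlt H) v) - const (\<phi> v) * v"
        by (simp add: sliceL_diff sliceL_tensor[OF lf'])
      moreover have "sliceL \<phi> (subst (mlt H) v) \<in> mp.span B" unfolding v_def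
          by (rule B(5)[OF lfu lf'])
      ultimately have "sliceL \<phi> ?w \<in> mp.span B"
        using mp.span_diff mp.span_scale[OF vB] by metis
      then show ?thesis using inj sliceL_mem[OF I M \<phi> wIM] by blast
    qed
    then have "?w \<in> prod_ideal (rel H) (rel H)" unfolding mem_prod_ideal_iff_sliceL[OF I I] by blast
    moreover have "v \<notin> rel H"
      using uv nz[OF \<chi>] pointD[OF u, of v] cong_mod_mem[OF K uv] by blast
    ultimately have "group_like H v" by (intro unit_if_multiplicative[OF H])
    then show ?thesis using vB uv by blast
  qed
  from bchoice[of A "\<lambda>\<chi> v. group_like H v \<and> v \<in> mp.span B \<and> cong_mod K (subst u v) \<chi>"] lift
  obtain v where v: "\<And>\<chi>. \<chi> \<in> A \<Longrightarrow> group_like H (v \<chi>)" "\<And>\<chi>. \<chi> \<in> A \<Longrightarrow> v \<chi> \<in> mp.span B"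
    "\<And>\<chi>. \<chi> \<in> A \<Longrightarrow> cong_mod K (subst u (v \<chi>)) \<chi>" by blast
  let ?g = "\<Sum>\<chi>\<in>A. const (c \<chi>) * v \<chi>"
  have "f - ?g \<in> mp.span B"
    by (intro mp.span_diff B(2) mp.span_sum mp.span_scale v(2))
  moreover have "subst u (f - ?g) \<in> K"
  proof -
    have "subst u ?g = (\<Sum>\<chi>\<in>A. const (c \<chi>) * subst u (v \<chi>))" by (simp add: subst_sum subst_mult)
    moreover have "cong_mod K (\<Sum>\<chi>\<in>A. const (c \<chi>) * subst u (v \<chi>)) (lincomb c A)"
      by (intro cong_mod_sum[OF K] cong_mod_mult[OF K] cong_mod_refl[OF K] v(3))
    ultimately have "cong_mod K (subst u f) (subst u ?g)"
      using cong_mod_trans[OF K fA cong_mod_sym[OF K]] by simp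
    then show ?thesis by (simp add: cong_mod_def subst_diff)
  qed
  ultimately have "f - ?g \<in> rel H" by (rule inj)
  moreover have "?g \<in> mp.span {g. group_like H g}"
    by (intro mp.span_sum mp.span_scale mp.span_base) (simp add: v(1))
  ultimately show "\<exists>g\<in>mp.span {g. group_like H g}. f - g \<in> rel H" by blast
qed

lemma group_like_subgroup: "closed_subgroup T S \<Longrightarrow> group_like S f \<Longrightarrow> group_like T f"
  unfolding group_like_def closed_subgroup_simps
  using closed_subgroup_rel prod_ideal_mono[of "rel S" "rel T" "rel S" "rel T"] by blast

lemma diagonalisable_subgroup:
  assumes "closed_subgroup T S" "diagonalisable S"
  shows "diagonalisable T"
  unfolding diagonalisable_def
proof
  fix f
  obtain g where g: "g \<in> mp.span {g. group_like S g}" "f - g \<in> rel S"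
    using assms(2) unfolding diagonalisable_def by blast
  have "mp.span {g. group_like S g} \<subseteq> mp.span {g. group_like T g}"
    by (rule mp.span_mono) (auto intro: group_like_subgroup[OF assms(1)])
  then show "\<exists>g\<in>mp.span {g. group_like T g}. f - g \<in> rel T"
    using g closed_subgroup_rel[OF assms(1)] by blast
qed

lemma diagonalisable_expansion:
  assumes "diagonalisable T"
  obtains A c where "finite A" "\<And>\<chi>. \<chi> \<in> A \<Longrightarrow> group_like T \<chi>"
    "cong_mod (rel T) f (lincomb c A)"
proof -
  obtain g where g: "g \<in> mp.span {g. group_like T g}" "f - g \<in> rel T"
    using assms unfolding diagonalisable_def by blast
  then obtain A c where "finite A" "A \<subseteq> {g. group_like T g}" "g = lincomb c A"
    unfolding mp.span_explicit by blast
  then show ?thesis using that[of A c] g(2) by (auto simp: cong_mod_def)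
qed

lemma diagonal_chart_subgroup:
  assumes T: "closed_subgroup T H" and diag: "diagonalisable T"
  shows "diagonal_chart H (rel T) var {\<chi>. group_like T \<chi>}"
proof -
  note aT = closed_subgroup_alg_group(1)[OF T]
  note I = alg_group_is_ideal[OF aT]
  let ?P = "prod_ideal (rel T) (rel T)"
  have P: "is_ideal ?P" by (rule is_ideal_prod_ideal)
  have id: "case_sum (\<lambda>x. in1 (var x)) (\<lambda>x. in2 (var x)) = (var :: _ \<Rightarrow> ('a + 'a, 'b) mpoly)"
    by (auto split: sum.split)
  have "cong_mod ?P (subst (mlt H) g) (\<Sum>\<chi>\<in>A. const (c \<chi>) * (in1 \<chi> * in2 \<chi>))"
    if A: "A \<subseteq> {\<chi>. group_like T \<chi>}" and g: "cong_mod (rel T) g (lincomb c A)" for g A c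
  proof -
    have "subst (mlt H) (g - lincomb c A) \<in> ?P"
      using alg_group_mlt[OF aT] g closed_subgroup_simps[OF T] by (simp add: cong_mod_def)
    then have "cong_mod ?P (subst (mlt H) g) (\<Sum>\<chi>\<in>A. const (c \<chi>) * subst (mlt H) \<chi>)"
      by (simp add: cong_mod_def subst_diff subst_sum subst_mult)
    moreover have "cong_mod ?P (\<Sum>\<chi>\<in>A. const (c \<chi>) * subst (mlt H) \<chi>) (\<Sum>\<chi>\<in>A. const (c \<chi>) * (in1 \<chi>
        * in2 \<chi>))"
      using A closed_subgroup_simps[OF T]
      by (intro cong_mod_sum[OF P] cong_mod_mult[OF P] cong_mod_refl[OF P])
         (auto simp: group_like_def cong_mod_def)
    ultimately show ?thesis by (rule cong_mod_trans[OF P])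
  qed
  moreover have "\<exists>A c. finite A \<and> A \<subseteq> {\<chi>. group_like T \<chi>} \<and> cong_mod (rel T) g (lincomb c A)" for g
  proof -
    obtain A c where "finite A" "\<And>\<chi>. \<chi> \<in> A \<Longrightarrow> group_like T \<chi>"
      "cong_mod (rel T) g (lincomb c A)"
      by (rule diagonalisable_expansion[OF diag, of g]) blast
    then show ?thesis by (intro exI[of _ A] exI[of _ c]) auto
  qed
  ultimately show ?thesis
    unfolding diagonal_chart_def id
    using I closed_subgroup_rel[OF T] by (simp add: point_def subset_iff)
qed

text \<open>
  On a given finite-dimensional space of functions the restriction to some \<open>T i\<close> is injective, by
  \<open>finite_dim_chain\<close>.
\<close>

theorem diagonalisable_if_dense_chain:
  fixes H :: "('x::finite, 'k::field) group_scheme"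
  assumes H: "alg_group H" and T: "\<And>i. closed_subgroup (T i) H" and diag: "\<And>i. diagonalisable (T i)"
    and dec: "decseq (\<lambda>i. rel (T i))" and dense: "(\<Inter>i. rel (T i)) = rel H"
  shows "diagonalisable H"
proof (rule diagonalisable_if_charts[OF H, where 'y = 'x])
  fix B :: "('x, 'k) mpoly set" assume "finite B"
  then obtain i where "mp.span B \<inter> rel (T i) \<subseteq> (\<Inter>i. rel (T i))"
    using finite_dim_chain[of "\<lambda>i. rel (T i)", OF alg_group_is_ideal[OF
        closed_subgroup_alg_group(1)[OF T]] dec]
    by blast
  then have "diagonal_chart H (rel (T i)) var {\<chi>. group_like (T i) \<chi>} \<and>
      (\<forall>g\<in>mp.span B. subst var g \<in> rel (T i) \<longrightarrow> g \<in> rel H)"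
    using diagonal_chart_subgroup[OF T diag, of i] unfolding dense by auto
  then show "\<exists>K u E. diagonal_chart H (K :: ('x, 'k) mpoly set) u E \<and>
      (\<forall>g\<in>mp.span B. subst u g \<in> K \<longrightarrow> g \<in> rel H)"
    by (intro exI)
qed

section \<open>Extension of the base field\<close>

abbreviation pmap :: "('k::zero \<Rightarrow> 'l::zero) \<Rightarrow> ('x, 'k) mpoly \<Rightarrow> ('x, 'l) mpoly" where
  "pmap \<equiv> Poly_Mapping.map"

lemma lookup_pmap: "h 0 = 0 \<Longrightarrow> lookup (pmap h p) m = h (lookup p m)"
  by (simp add: map.rep_eq when_def)

lemma pmap_add:
  "h 0 = 0 \<Longrightarrow> (\<And>a b. h (a + b) = h a + h b) \<Longrightarrow> pmap h (p + q) = pmap h p + pmap h q"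
  by (rule poly_mapping_eqI) (simp add: lookup_pmap lookup_add)

lemma pmap_0 [simp]: "pmap h 0 = 0"
  by (simp add: map_eq_zero_iff)

lemma pmap_single: "h 0 = 0 \<Longrightarrow> pmap h (single m c) = single m (h c)"
  by (rule poly_mapping_eqI) (simp add: lookup_pmap lookup_single when_def)

lemma pmap_const: "h 0 = 0 \<Longrightarrow> pmap h (const c) = const (h c)"
  by (simp add: const_def pmap_single)

lemma pmap_var: "h 0 = 0 \<Longrightarrow> h 1 = 1 \<Longrightarrow> pmap h (var x) = var x"
  by (simp add: var_def pmap_single)

lemma ring_map_pmap:
  assumes h: "ring_map h"
  shows "ring_map (pmap h :: ('x, 'k::comm_ring_1) mpoly \<Rightarrow> ('x, 'l::comm_ring_1) mpoly)"
proof -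
  note hs = ring_map_0[OF h] ring_map_1[OF h] ring_map_add[OF h] ring_map_mult[OF h]
  have add: "pmap h (p + q) = pmap h p + pmap h q" for p q :: "('x, 'k) mpoly"
    by (rule pmap_add) (simp_all add: hs)
  have "pmap h (p * q) = pmap h p * pmap h q" for p q :: "('x, 'k) mpoly"
  proof (induction p rule: poly_mapping_add_induct)
    case (single m c)
    show ?case
      by (induction q rule: poly_mapping_add_induct)
         (simp_all add: pmap_single hs mult_single distrib_left add)
  qed (simp_all add: distrib_right add)
  then show ?thesis
    unfolding ring_map_def using pmap_const[of h 1] by (simp add: add hs)
qed

lemma pmap_subst:
  fixes u :: "'x::finite \<Rightarrow> ('y, 'k::comm_ring_1) mpoly"
  assumes h: "ring_map h"
  shows "pmap h (subst u f) = subst (\<lambda>x. pmap h (u x)) (pmap h f)"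
  by (rule ring_map_mpoly_eqI)
     (auto intro: ring_map_comp ring_map_subst ring_map_pmap h
       simp: pmap_const pmap_var ring_map_0[OF h] ring_map_1[OF h])

lemma eval_at_pmap:
  fixes e :: "'x::finite \<Rightarrow> 'k::comm_ring_1"
  assumes h: "ring_map h"
  shows "eval_at (\<lambda>x. h (e x)) (pmap h f) = h (eval_at e f)"
  by (rule ring_map_mpoly_eqI)
     (auto intro: ring_map_comp ring_map_eval_at ring_map_pmap h
       simp: pmap_const pmap_var ring_map_0[OF h] ring_map_1[OF h])

definition ext_ideal :: "('k::field \<Rightarrow> 'l::field) \<Rightarrow> ('x, 'k) mpoly set \<Rightarrow> ('x, 'l) mpoly set" where
  "ext_ideal h I = ideal_gen (pmap h ` I)"

lemma is_ideal_ext_ideal: "is_ideal (ext_ideal h I)"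
  unfolding ext_ideal_def by (rule is_ideal_ideal_gen)

lemma pmap_mem_ext_ideal: "f \<in> I \<Longrightarrow> pmap h f \<in> ext_ideal h I"
  unfolding ext_ideal_def by (rule ideal_gen_base) auto

lemma ext_ideal_mono: "I \<subseteq> J \<Longrightarrow> ext_ideal h I \<subseteq> ext_ideal h J"
  unfolding ext_ideal_def by (rule ideal_gen_mono) auto

lemma point_ext_ideal:
  fixes u :: "'x::finite \<Rightarrow> ('y, 'l::field) mpoly"
  shows "is_ideal K \<Longrightarrow> point (ext_ideal h I) K u \<longleftrightarrow> (\<forall>f\<in>I. subst u (pmap h f) \<in> K)"
  unfolding ext_ideal_def by (simp add: point_ideal_gen)

lemma base_change_simps [simp]:
  "rel (base_change h G) = ext_ideal h (rel G)" "mlt (base_change h G) = (\<lambda>x. pmap h (mlt G x))"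
  "unt (base_change h G) = (\<lambda>x. h (unt G x))" "ivs (base_change h G) = (\<lambda>x. pmap h (ivs G x))"
  by (simp_all add: base_change_def ext_ideal_def)

context
  fixes h :: "'k::field \<Rightarrow> 'l::field"
  assumes h: "ring_map h"
begin

lemma pmap_prod_ideal:
  fixes I :: "('x::finite, 'k) mpoly set" and J :: "('y::finite, 'k) mpoly set"
  assumes "g \<in> prod_ideal I J"
  shows "pmap h g \<in> prod_ideal (ext_ideal h I) (ext_ideal h J)"
proof (rule ring_map_prod_ideal[OF ring_map_pmap[OF h] is_ideal_prod_ideal _ _ assms])
  have [simp]: "pmap h (var z) = var z" for z :: 'z
    by (simp add: pmap_var ring_map_0[OF h] ring_map_1[OF h])
  show "pmap h (in1 f) \<in> prod_ideal (ext_ideal h I) (ext_ideal h J)" if "f \<in> I" for f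
    using that by (simp add: pmap_subst[OF h] pmap_var ring_map_0[OF h] ring_map_1[OF h]
        in1_mem_prod_ideal pmap_mem_ext_ideal)
  show "pmap h (in2 f) \<in> prod_ideal (ext_ideal h I) (ext_ideal h J)" if "f \<in> J" for f
    using that by (simp add: pmap_subst[OF h] pmap_var ring_map_0[OF h] ring_map_1[OF h]
        in2_mem_prod_ideal pmap_mem_ext_ideal)
qed

lemma prod_ideal_ext_ideal_subset:
  fixes I :: "('x::finite, 'k) mpoly set" and J :: "('y::finite, 'k) mpoly set"
  shows "prod_ideal (ext_ideal h I) (ext_ideal h J) \<subseteq> ext_ideal h (prod_ideal I J)"
proof
  fix g assume g: "g \<in> prod_ideal (ext_ideal h I) (ext_ideal h J)"
  note E = is_ideal_ext_ideal[of h "prod_ideal I J"]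
  have 1: "point (ext_ideal h I) (ext_ideal h (prod_ideal I J)) (\<lambda>x. var (Inl x))"
    unfolding point_ext_ideal[OF E]
  proof
    fix f assume "f \<in> I"
    then have "pmap h (in1 f :: ('x + 'y, 'k) mpoly) \<in> ext_ideal h (prod_ideal I J)"
      by (intro pmap_mem_ext_ideal in1_mem_prod_ideal)
    then show "in1 (pmap h f) \<in> ext_ideal h (prod_ideal I J)"
      by (simp add: pmap_subst[OF h] pmap_var ring_map_0[OF h] ring_map_1[OF h])
  qed
  have 2: "point (ext_ideal h J) (ext_ideal h (prod_ideal I J)) (\<lambda>x. var (Inr x))"
    unfolding point_ext_ideal[OF E]
  proof
    fix f assume "f \<in> J"
    then have "pmap h (in2 f :: ('x + 'y, 'k) mpoly) \<in> ext_ideal h (prod_ideal I J)"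
      by (intro pmap_mem_ext_ideal in2_mem_prod_ideal)
    then show "in2 (pmap h f) \<in> ext_ideal h (prod_ideal I J)"
      by (simp add: pmap_subst[OF h] pmap_var ring_map_0[OF h] ring_map_1[OF h])
  qed
  have "case_sum (\<lambda>x. var (Inl x)) (\<lambda>x. var (Inr x)) = (var :: _ \<Rightarrow> ('x + 'y, 'l) mpoly)"
    by (auto split: sum.split)
  then show "g \<in> ext_ideal h (prod_ideal I J)"
    using pointD[OF point_case_sum[OF E 1 2] g] by simp
qed

lemma pmap_pmul:
  "pmap h (pmul G u v x) = pmul (base_change h G) (\<lambda>x. pmap h (u x)) (\<lambda>x. pmap h (v x)) x"
proof -
  have "(\<lambda>z. pmap h (case_sum u v z)) = case_sum (\<lambda>x. pmap h (u x)) (\<lambda>x. pmap h (v x))"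
    by (auto split: sum.split)
  then show ?thesis by (simp add: pmul_def pmap_subst[OF h])
qed

lemma pmap_pone: "pmap h (pone G x) = pone (base_change h G) x"
  by (simp add: pone_def pmap_const ring_map_0[OF h])

lemma pmap_pinv: "pmap h (pinv G u x) = pinv (base_change h G) (\<lambda>x. pmap h (u x)) x"
  by (simp add: pinv_def pmap_subst[OF h])

lemma pt_eq_pmap:
  assumes "pt_eq K u v" "\<And>f. f \<in> K \<Longrightarrow> pmap h f \<in> K'"
  shows "pt_eq K' (\<lambda>x. pmap h (u x)) (\<lambda>x. pmap h (v x))"
  using assms by (auto simp: pt_eq_def cong_mod_def simp flip: ring_map_diff[OF ring_map_pmap[OF
      h]])

lemma alg_group_base_change:
  fixes G :: "('x::finite, 'k) group_scheme"
  assumes G: "alg_group G"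
  shows "alg_group (base_change h G)"
proof (rule alg_groupI)
  let ?G' = "base_change h G"
  note I = alg_group_is_ideal[OF G]
  note E = is_ideal_ext_ideal
  note ps = pmap_pmul pmap_pone pmap_pinv pmap_var[of h, OF ring_map_0[OF h] ring_map_1[OF h]]
  show "is_ideal (rel ?G')" by (simp add: E)
  show "point (rel ?G') (prod_ideal (rel ?G') (rel ?G')) (mlt ?G')"
    using alg_group_mlt[OF G] by (simp add: point_ext_ideal is_ideal_prod_ideal pmap_prod_ideal
        flip: pmap_subst[OF h])
  show "point (rel ?G') (rel ?G') (ivs ?G')"
    using alg_group_ivs[OF G] by (simp add: point_ext_ideal E pmap_mem_ext_ideal flip:
        pmap_subst[OF h])
  show "eval_at (unt ?G') f = 0" if "f \<in> rel ?G'" for f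
  proof -
    have "is_ideal (eval_at (\<lambda>x. h (unt G x)) -` {0})"
      by (rule ring_map_vimage_ideal[OF ring_map_eval_at]) (rule is_idealI, auto)
    moreover have "pmap h ` rel G \<subseteq> eval_at (\<lambda>x. h (unt G x)) -` {0}"
      using alg_group_unt[OF G] by (auto simp: eval_at_pmap[OF h] ring_map_0[OF h])
    ultimately have "ext_ideal h (rel G) \<subseteq> eval_at (\<lambda>x. h (unt G x)) -` {0}"
      unfolding ext_ideal_def by (rule ideal_gen_least[rotated])
    then show ?thesis using that by auto
  qed
  have P2: "pmap h g \<in> prod_ideal (rel ?G') (prod_ideal (rel ?G') (rel ?G'))"
    if "g \<in> prod_ideal (rel G) (prod_ideal (rel G) (rel G))" for g
  proof -
    have "ext_ideal h (prod_ideal (rel G) (rel G))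
        \<subseteq> prod_ideal (ext_ideal h (rel G)) (ext_ideal h (rel G))"
      unfolding ext_ideal_def[of h "prod_ideal _ _"]
      by (intro ideal_gen_least is_ideal_prod_ideal) (auto intro: pmap_prod_ideal)
    from prod_ideal_mono[OF subset_refl this] show ?thesis using pmap_prod_ideal[OF that] by auto
  qed
  show "pt_eq (prod_ideal (rel ?G') (prod_ideal (rel ?G') (rel ?G')))
      (pmul ?G' (pmul ?G' (\<lambda>x. var (Inl x)) (\<lambda>x. var (Inr (Inl x)))) (\<lambda>x. var (Inr (Inr x))))
      (pmul ?G' (\<lambda>x. var (Inl x)) (pmul ?G' (\<lambda>x. var (Inr (Inl x))) (\<lambda>x. var (Inr (Inr x)))))"
    using pt_eq_pmap[OF alg_group_assoc_generic[OF G] P2] by (simp only: ps)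
  show "pt_eq (rel ?G') (pmul ?G' (pone ?G') var) var"
    using pt_eq_pmap[OF alg_group_unit_generic(1)[OF G], of "ext_ideal h (rel G)"]
    by (simp only: ps pmap_mem_ext_ideal base_change_simps)
  show "pt_eq (rel ?G') (pmul ?G' var (pone ?G')) var"
    using pt_eq_pmap[OF alg_group_unit_generic(2)[OF G], of "ext_ideal h (rel G)"]
    by (simp only: ps pmap_mem_ext_ideal base_change_simps)
  show "pt_eq (rel ?G') (pmul ?G' (pinv ?G' var) var) (pone ?G')"
    using pt_eq_pmap[OF alg_group_unit_generic(3)[OF G], of "ext_ideal h (rel G)"]
    by (simp only: ps pmap_mem_ext_ideal base_change_simps)
  show "pt_eq (rel ?G') (pmul ?G' var (pinv ?G' var)) (pone ?G')"
    using pt_eq_pmap[OF alg_group_unit_generic(4)[OF G], of "ext_ideal h (rel G)"]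
    by (simp only: ps pmap_mem_ext_ideal base_change_simps)
qed

lemma closed_subgroup_base_change:
  "closed_subgroup T G \<Longrightarrow> closed_subgroup (base_change h T) (base_change h G)"
  by (rule closed_subgroupI)
     (auto intro!: alg_group_base_change ext_ideal_mono simp: closed_subgroup_simps
       dest: closed_subgroup_alg_group closed_subgroup_rel)

subsection \<open>Descent\<close>

text \<open>
  An extension field is a vector space over the base field. Applying its linear functionals to the
  coefficients brings polynomials back to the base field, and detects extended ideals.
\<close>

definition scalar_form :: "('l \<Rightarrow> 'k) \<Rightarrow> bool" where
  "scalar_form \<mu> \<longleftrightarrow> (\<forall>a b. \<mu> (a + b) = \<mu> a + \<mu> b) \<and> (\<forall>c a. \<mu> (h c * a) = c * \<mu> a)"

lemma scalar_form_0: "scalar_form \<mu> \<Longrightarrow> \<mu> 0 = 0"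
  unfolding scalar_form_def using ring_map_0[OF h] by (metis mult_zero_left)

lemma scalar_form_scale: "scalar_form \<mu> \<Longrightarrow> \<mu> (h c * a) = c * \<mu> a"
  by (simp add: scalar_form_def)

lemma pmap_scalar_add:
  assumes "scalar_form \<mu>"
  shows "pmap \<mu> (p + q) = pmap \<mu> p + pmap \<mu> q"
  using assms scalar_form_0[OF assms] by (intro pmap_add) (auto simp: scalar_form_def)

lemma pmap_scalar_mult:
  fixes F :: "('x, 'l) mpoly"
  assumes s: "scalar_form \<mu>"
  shows "pmap \<mu> (F * pmap h f) = pmap \<mu> F * f"
proof (induction F rule: poly_mapping_add_induct)
  case (single m c)
  show ?case
  proof (induction f rule: poly_mapping_add_induct)
    case (single n d)
    have "\<mu> (c * h d) = \<mu> c * d" using scalar_form_scale[OF s, of d c] by (simp add: mult.commute)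
    then show ?case by (simp add: pmap_single scalar_form_0[OF s] ring_map_0[OF h] mult_single)
  next
    case (add p q)
    then show ?case
      by (simp add: ring_map_add[OF ring_map_pmap[OF h]] distrib_left pmap_scalar_add[OF s])
  qed simp
qed (simp_all add: distrib_right pmap_scalar_add[OF s])

lemma ext_ideal_scalar_form:
  assumes I: "is_ideal I" and s: "scalar_form \<mu>" and F: "F \<in> ext_ideal h I"
  shows "pmap \<mu> F \<in> I"
  using F unfolding ext_ideal_def
proof (induction rule: ideal_gen_induct)
  case zero then show ?case by (simp add: ideal_0[OF I])
next
  case (step c s' b)
  then obtain f where "f \<in> I" "s' = pmap h f" by auto
  then show ?case
    using step(2) by (simp add: pmap_scalar_add[OF s] pmap_scalar_mult[OF s] ideal_add[OF I]
        ideal_mult_left[OF I])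
qed

lemma vector_space_ext: "vector_space (\<lambda>c l. h c * l)"
  by unfold_locales
     (simp_all add: distrib_left distrib_right ring_map_1[OF h] ring_map_add[OF h]
         ring_map_mult[OF h] mult.assoc)

text \<open>
  Expanding the coefficients of \<open>F\<close> in a basis of the extension writes \<open>F\<close> as a combination of
  polynomials over the base field, whose coefficient functions are scalar forms.
\<close>

lemma mem_ext_ideal_iff:
  fixes F :: "('x, 'l) mpoly"
  assumes I: "is_ideal I"
  shows "F \<in> ext_ideal h I \<longleftrightarrow> (\<forall>\<mu>. scalar_form \<mu> \<longrightarrow> pmap \<mu> F \<in> I)"
proof
  assume F: "\<forall>\<mu>. scalar_form \<mu> \<longrightarrow> pmap \<mu> F \<in> I"
  interpret L: vector_space "\<lambda>c l. h c * l" by (rule vector_space_ext)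
  define B where "B = L.extend_basis {}"
  have B: "L.independent B" "L.span B = UNIV"
    unfolding B_def using L.independent_extend_basis L.span_extend_basis L.independent_empty by auto
  define r where "r b l = L.representation B l b" for b l
  have r: "scalar_form (r b)" for b
    unfolding scalar_form_def r_def using B by (auto simp: L.representation_add
        L.representation_scale)
  have fin: "finite {b. r b l \<noteq> 0}" for l unfolding r_def by (rule L.finite_representation)
  have sum: "(\<Sum>b | r b l \<noteq> 0. b * h (r b l)) = l" for l
    using L.sum_nonzero_representation_eq[OF B(1), of l] B(2) by (simp add: r_def mult.commute)
  define C where "C = (\<Union>m\<in>keys F. {b. r b (lookup F m) \<noteq> 0})"
  have C: "finite C" unfolding C_def using fin by auto
  have "F = (\<Sum>b\<in>C. const b * pmap h (pmap (r b) F))"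
  proof (rule poly_mapping_eqI)
    fix m
    have lk: "lookup (const b * p) m = b * lookup p m" for b :: 'l and p :: "('x, 'l) mpoly"
      using lookup_single_mult[of 0 b p m] by (simp add: const_def)
    let ?l = "lookup F m"
    have "lookup (\<Sum>b\<in>C. const b * pmap h (pmap (r b) F)) m = (\<Sum>b\<in>C. b * h (r b ?l))"
      by (simp add: lookup_sum lk lookup_pmap ring_map_0[OF h] scalar_form_0[OF r])
    also have "\<dots> = (\<Sum>b | r b ?l \<noteq> 0. b * h (r b ?l))"
    proof (rule sum.mono_neutral_right[OF C])
      show "{b. r b ?l \<noteq> 0} \<subseteq> C"
      proof (cases "m \<in> keys F")
        case True then show ?thesis by (auto simp: C_def)
      next
        case False
        then show ?thesis by (auto simp: in_keys_iff scalar_form_0[OF r])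
      qed
    qed (auto simp: ring_map_0[OF h])
    also have "\<dots> = ?l" by (rule sum)
    finally show "?l = lookup (\<Sum>b\<in>C. const b * pmap h (pmap (r b) F)) m" ..
  qed
  moreover have "(\<Sum>b\<in>C. const b * pmap h (pmap (r b) F)) \<in> ext_ideal h I"
    using F r by (intro ideal_sum ideal_mult_left is_ideal_ext_ideal pmap_mem_ext_ideal) auto
  ultimately show "F \<in> ext_ideal h I" by simp
qed (use ext_ideal_scalar_form[OF I] in blast)

lemma scalar_form_retract: "\<exists>\<mu>. scalar_form \<mu> \<and> (\<forall>c. \<mu> (h c) = c)"
proof -
  interpret L: vector_space "\<lambda>c l. h c * l" by (rule vector_space_ext)
  have ind: "L.independent {1}" by simp
  define B where "B = L.extend_basis {1}"
  have B: "L.independent B" "L.span B = UNIV" "1 \<in> B"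
    unfolding B_def using L.independent_extend_basis[OF ind] L.span_extend_basis[OF ind]
      L.extend_basis_superset[OF ind] by auto
  let ?r = "\<lambda>l. L.representation B l 1"
  have r: "scalar_form ?r"
    unfolding scalar_form_def using B by (auto simp: L.representation_add L.representation_scale)
  have "?r 1 = 1" using L.representation_basis[OF B(1,3)] by simp
  then have "?r (h c) = c" for c using scalar_form_scale[OF r, of c 1] by simp
  then show ?thesis using r by (intro exI[of _ ?r]) simp
qed

lemma pmap_mem_ext_ideal_iff:
  assumes I: "is_ideal I"
  shows "pmap h f \<in> ext_ideal h I \<longleftrightarrow> f \<in> I"
proof
  assume f: "pmap h f \<in> ext_ideal h I"
  obtain \<mu> where l: "scalar_form \<mu>" "\<And>c. \<mu> (h c) = c" using scalar_form_retract by blast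
  have "pmap \<mu> (pmap h f) = f"
    by (rule poly_mapping_eqI) (simp add: lookup_pmap scalar_form_0[OF l(1)] ring_map_0[OF h] l(2))
  then show "f \<in> I" using ext_ideal_scalar_form[OF I l(1) f] by simp
qed (rule pmap_mem_ext_ideal)

lemma ext_ideal_INT:
  assumes I: "\<And>n::nat. is_ideal (I n)"
  shows "(\<Inter>n. ext_ideal h (I n)) = ext_ideal h (\<Inter>n. I n)"
proof -
  have J: "is_ideal (\<Inter>n. I n)" by (rule is_ideal_Inter) (use I in auto)
  show ?thesis by (auto simp: mem_ext_ideal_iff[OF I] mem_ext_ideal_iff[OF J])
qed

lemma pmap_scalar_subst:
  fixes u :: "'x::finite \<Rightarrow> ('y, 'k) mpoly"
  assumes s: "scalar_form \<mu>"
  shows "pmap \<mu> (subst (\<lambda>x. pmap h (u x)) F) = subst u (pmap \<mu> F)"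
proof (induction F rule: poly_mapping_add_induct)
  case (single m c)
  have "subst (\<lambda>x. pmap h (u x)) (single m c) = const c * pmap h (subst u (monom m))"
    unfolding single_eq_const_mult[of m c] pmap_subst[OF h]
    by (simp add: subst_mult pmap_single ring_map_0[OF h] ring_map_1[OF h])
  then have "pmap \<mu> (subst (\<lambda>x. pmap h (u x)) (single m c)) = const (\<mu> c) * subst u (monom m)"
    by (simp add: pmap_scalar_mult[OF s] pmap_const scalar_form_0[OF s])
  also have "\<dots> = subst u (pmap \<mu> (single m c))"
    unfolding pmap_single[of \<mu>, OF scalar_form_0[OF s]] single_eq_const_mult[of m "\<mu> c"]
    by (simp add: subst_mult)
  finally show ?case .
qed (simp_all add: subst_0 subst_add pmap_scalar_add[OF s])

end

section \<open>The product of two commuting subgroups\<close>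

lemma closed_subgroup_ops:
  assumes "closed_subgroup T G"
  shows "pmul T u v = pmul G u v" "pone T = pone G" "pinv T u = pinv G u"
  using closed_subgroup_simps[OF assms] by (simp_all add: pmul_def pone_def pinv_def)

lemma closed_subgroup_point:
  assumes T: "closed_subgroup T G" and u: "point (rel T) K u"
  shows "point (rel G) K u"
  using point_antimono[OF closed_subgroup_rel[OF T] subset_refl u] .

text \<open>
  The closed subschemes of \<open>I\<close> and \<open>J\<close> centralise each other, tested on the pair of generic
  points.
\<close>

definition commuting ::
  "('x::finite, 'k::field) group_scheme \<Rightarrow> ('x, 'k) mpoly set \<Rightarrow> ('x, 'k) mpoly set \<Rightarrow> bool" where
  "commuting G I J \<longleftrightarrow> pt_eq (prod_ideal I J)
     (pmul G (\<lambda>x. var (Inl x)) (\<lambda>x. var (Inr x))) (pmul G (\<lambda>x. var (Inr x)) (\<lambda>x. var (Inl x)))"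

lemma commuting_points:
  fixes K :: "('y::finite, 'k::field) mpoly set"
  assumes "commuting G I J" "is_ideal K" "point I K a" "point J K b"
  shows "pt_eq K (pmul G a b) (pmul G b a)"
  using pt_eq_point[OF assms(1)[unfolded commuting_def] point_case_sum[OF assms(2-4)]]
  by (simp add: subst_pmul)

text \<open>
  The ideal is the kernel of \<open>f \<mapsto> f (t s)\<close>, so this is the scheme-theoretic image of the
  multiplication map of the closed subschemes of \<open>I\<close> and \<open>J\<close>.
\<close>

definition product_group ::
  "('x::finite, 'k::field) group_scheme \<Rightarrow> ('x, 'k) mpoly set \<Rightarrow> ('x, 'k) mpoly set \<Rightarrow> ('x, 'k)
      group_scheme" where
  "product_group G I J = G\<lparr>rel := {f. subst (mlt G) f \<in> prod_ideal I J}\<rparr>"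

lemma product_group_simps [simp]:
  "mlt (product_group G I J) = mlt G" "unt (product_group G I J) = unt G"
  "ivs (product_group G I J) = ivs G"
  "rel (product_group G I J) = {f. subst (mlt G) f \<in> prod_ideal I J}"
  by (simp_all add: product_group_def)

lemma point_product_group:
  assumes "is_ideal K" "point I K a" "point J K b"
  shows "point (rel (product_group G I J)) K (pmul G a b)"
  using pointD[OF point_case_sum[OF assms]]
  by (simp add: point_def[of _ _ "pmul G a b"] subst_of_pmul)

context
  fixes G T S :: "('x::finite, 'k::field) group_scheme"
  assumes T: "closed_subgroup T G" and S: "closed_subgroup S G"
    and comm: "commuting G (rel T) (rel S)"
begin

private abbreviation "K \<equiv> prod_ideal (rel T) (rel S)"
\<comment> \<open>the coordinates of the generic point \<open>((t1, s1), (t2, s2))\<close> of \<open>(T \<times> S) \<times> (T \<times> S)\<close>\<close>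
private abbreviation "t1 \<equiv> \<lambda>x. var (Inl (Inl x))"
private abbreviation "s1 \<equiv> \<lambda>x. var (Inl (Inr x))"
private abbreviation "t2 \<equiv> \<lambda>x. var (Inr (Inl x))"
private abbreviation "s2 \<equiv> \<lambda>x. var (Inr (Inr x))"

private lemma idl: "is_ideal K" "is_ideal (prod_ideal K K)"
  by (rule is_ideal_prod_ideal)+

private lemma groups: "alg_group G" "alg_group T" "alg_group S"
  using T S by (auto simp: closed_subgroup_def)

private lemma generic_points:
  "point (rel T) (prod_ideal K K) t1" "point (rel S) (prod_ideal K K) s1"
  "point (rel T) (prod_ideal K K) t2" "point (rel S) (prod_ideal K K) s2"
  using point_comp[OF point_left[of "rel T" "rel S"] point_left[of K K]]
    point_comp[OF point_right[of "rel S" "rel T"] point_left[of K K]]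
    point_comp[OF point_left[of "rel T" "rel S"] point_right[of K K]]
    point_comp[OF point_right[of "rel S" "rel T"] point_right[of K K]]
  by simp_all

private lemma products:
  "point (rel T) (prod_ideal K K) (pmul G t1 t2)" "point (rel S) (prod_ideal K K) (pmul G s1 s2)"
  using point_pmul[OF groups(2) idl(2) generic_points(1,3)]
    point_pmul[OF groups(3) idl(2) generic_points(2,4)]
  by (simp_all add: closed_subgroup_ops[OF T] closed_subgroup_ops[OF S])

text \<open>The multiplication map \<open>T \<times> S \<rightarrow> G\<close> is a homomorphism because \<open>T\<close> and \<open>S\<close> commute.\<close>

lemma product_interchange:
  "cong_mod (prod_ideal K K)
    (subst (case_sum (\<lambda>x. in1 (mlt G x)) (\<lambda>x. in2 (mlt G x))) (subst (mlt G) f))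
    (subst (case_sum (pmul G t1 t2) (pmul G s1 s2)) (subst (mlt G) f))"
proof -
  have m: "(\<lambda>x. in1 (mlt G x)) = pmul G t1 s1" "(\<lambda>x. in2 (mlt G x)) = pmul G t2 s2"
    unfolding mlt_eq_pmul by (simp_all add: subst_pmul fun_eq_iff)
  have "pt_eq (prod_ideal K K) (pmul G s1 t2) (pmul G t2 s1)"
    by (rule pt_eq_sym[OF idl(2) commuting_points[OF comm idl(2) generic_points(3,2)]])
  then have "pt_eq (prod_ideal K K) (pmul G (pmul G t1 s1) (pmul G t2 s2))
      (pmul G (pmul G t1 t2) (pmul G s1 s2))"
    by (intro pmul_interchange[OF groups(1) idl(2)])
       (auto intro: generic_points closed_subgroup_point[OF T] closed_subgroup_point[OF S])
  from pt_eq_subst[OF idl(2) this, of f] show ?thesis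
    unfolding m subst_of_pmul[of G "pmul G t1 s1"] subst_of_pmul[of G "pmul G t1 t2"] .
qed

private lemma identity_point: "is_ideal M \<Longrightarrow> point (rel T) M (pone G)" "is_ideal M \<Longrightarrow>
    point (rel S) M (pone G)"
  for M :: "('y::finite, 'k) mpoly set"
  using point_pone[OF groups(2), of M] point_pone[OF groups(3), of M]
  by (simp_all add: closed_subgroup_ops[OF T] closed_subgroup_ops[OF S])

lemma product_group_subset: "rel (product_group G (rel T) (rel S)) \<subseteq> rel T"
  "rel (product_group G (rel T) (rel S)) \<subseteq> rel S"
proof -
  let ?R = "rel (product_group G (rel T) (rel S))"
  note I = alg_group_is_ideal[OF groups(2)] and J = alg_group_is_ideal[OF groups(3)]
  have "point ?R (rel T) (pmul G var (pone G))"
    by (rule point_product_group[OF I point_var identity_point(2)[OF I]])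
  moreover have "pt_eq (rel T) (pmul G var (pone G)) var"
    by (rule pmul_pone_right[OF groups(1) I closed_subgroup_point[OF T point_var]])
  ultimately have "point ?R (rel T) var" using point_pt_eq[OF I] by blast
  then show "?R \<subseteq> rel T" by (auto simp: point_def)
  have "point ?R (rel S) (pmul G (pone G) var)"
    by (rule point_product_group[OF J identity_point(1)[OF J] point_var])
  moreover have "pt_eq (rel S) (pmul G (pone G) var) var"
    by (rule pmul_pone_left[OF groups(1) J closed_subgroup_point[OF S point_var]])
  ultimately have "point ?R (rel S) var" using point_pt_eq[OF J] by blast
  then show "?R \<subseteq> rel S" by (auto simp: point_def)
qed

lemma alg_group_product: "alg_group (product_group G (rel T) (rel S))"
  unfolding product_group_def
proof (rule alg_group_restrict[OF groups(1)])
  let ?R = "{f. subst (mlt G) f \<in> K}"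
  show R: "is_ideal ?R"
    using ring_map_vimage_ideal[OF ring_map_subst idl(1), of "mlt G"] by (simp add: vimage_def)
  show "rel G \<subseteq> ?R"
    using alg_group_mlt[OF groups(1)] prod_ideal_mono[OF closed_subgroup_rel[OF T]
        closed_subgroup_rel[OF S]]
    by blast
  show "point ?R (prod_ideal ?R ?R) (mlt G)" unfolding point_def
  proof
    fix f assume "f \<in> ?R"
    then have "subst (case_sum (pmul G t1 t2) (pmul G s1 s2)) (subst (mlt G) f) \<in> prod_ideal K K"
      using pointD[OF point_case_sum[OF idl(2) products]] by simp
    then have "subst (case_sum (\<lambda>x. in1 (mlt G x)) (\<lambda>x. in2 (mlt G x))) (subst (mlt G) f)
        \<in> prod_ideal K K"
      using cong_mod_mem[OF idl(2) product_interchange] by blast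
    then show "subst (mlt G) f \<in> prod_ideal ?R ?R" by (rule prod_ideal_vimage[OF idl(1) idl(1)])
  qed
  show "eval_at (unt G) f = 0" if "f \<in> ?R" for f
    using product_group_subset(1) that alg_group_unt[OF groups(2)] closed_subgroup_simps[OF T]
        by auto
  show "point ?R ?R (ivs G)" unfolding point_def
  proof
    let ?t = "\<lambda>x. var (Inl x)" and ?s = "\<lambda>x. var (Inr x)"
    have p: "point (rel T) K ?t" "point (rel S) K ?s" by (rule point_left point_right)+
    have pG: "point (rel G) K ?t" "point (rel G) K ?s"
      by (rule closed_subgroup_point[OF T p(1)] closed_subgroup_point[OF S p(2)])+
    have pi: "point (rel T) K (pinv G ?t)" "point (rel S) K (pinv G ?s)"
      using point_pinv[OF groups(2) idl(1) p(1)] point_pinv[OF groups(3) idl(1) p(2)]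
      by (simp_all add: closed_subgroup_ops[OF T] closed_subgroup_ops[OF S])
    have "pt_eq K (pinv G (pmul G ?t ?s)) (pmul G (pinv G ?s) (pinv G ?t))"
      by (rule pinv_pmul[OF groups(1) idl(1) pG])
    moreover have "pt_eq K (pmul G (pinv G ?s) (pinv G ?t)) (pmul G (pinv G ?t) (pinv G ?s))"
      by (rule pt_eq_sym[OF idl(1) commuting_points[OF comm idl(1) pi]])
    ultimately have eq: "pt_eq K (pinv G (pmul G ?t ?s)) (pmul G (pinv G ?t) (pinv G ?s))"
      by (rule pt_eq_trans[OF idl(1)])
    fix f assume "f \<in> ?R"
    then have "subst (pmul G (pinv G ?t) (pinv G ?s)) f \<in> K"
      using pointD[OF point_product_group[OF idl(1) pi, of G], of f] by simp
    then have "subst (pinv G (pmul G ?t ?s)) f \<in> K"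
      using cong_mod_mem[OF idl(1) pt_eq_subst[OF idl(1) eq]] by blast
    then show "subst (ivs G) f \<in> ?R" by (simp add: subst_of_pinv flip: mlt_eq_pmul)
  qed
qed

lemma closed_subgroup_product:
  "closed_subgroup (product_group G (rel T) (rel S)) G"
  "closed_subgroup T (product_group G (rel T) (rel S))"
proof -
  have "rel G \<subseteq> rel (product_group G (rel T) (rel S))"
    using alg_group_mlt[OF groups(1)] prod_ideal_mono[OF closed_subgroup_rel[OF T]
        closed_subgroup_rel[OF S]]
    by auto
  then show "closed_subgroup (product_group G (rel T) (rel S)) G"
    by (intro closed_subgroupI alg_group_product groups) simp_all
  show "closed_subgroup T (product_group G (rel T) (rel S))"
    by (intro closed_subgroupI alg_group_product groups product_group_subset)
       (simp_all add: closed_subgroup_simps[OF T])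
qed

text \<open>
  The function \<open>f (t s)\<close> differs from \<open>f t\<close> by a function that vanishes for \<open>s = 1\<close>. If \<open>S\<close> is
  infinitesimal, this difference is nilpotent, so that \<open>T\<close> and the product group have the same
  underlying space.
\<close>

lemma connected_product:
  assumes char: "CHAR('k) > 0" and inf: "rel (frobenius_kernel i G) \<subseteq> rel S"
    and conn: "connected_group T"
  shows "connected_group (product_group G (rel T) (rel S))"
proof -
  define q where "q = CHAR('k) ^ i"
  let ?R = "rel (product_group G (rel T) (rel S))"
  let ?t = "\<lambda>x. var (Inl x)" and ?s = "\<lambda>x. var (Inr x)"
  have p: "point (rel T) K ?t" "point (rel S) K ?s" by (rule point_left point_right)+
  have "point (rel (frobenius_kernel i G)) K ?s" by (rule point_antimono[OF inf subset_refl p(2)])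
  then have sq: "cong_mod K (?s x ^ q) (pone G x ^ q)" for x
    using point_frobenius_kernel[OF char q_def idl(1), of G ?s] by simp
  have "f ^ q \<in> ?R" if f: "f \<in> rel T" for f
  proof -
    have "cong_mod K (pmul G ?t ?s x ^ q) (pmul G ?t (pone G) x ^ q)" for x
      unfolding pmul_def
      by (rule cong_mod_frobenius_subst[OF char q_def idl(1)])
         (auto split: sum.split simp: sq cong_mod_refl[OF idl(1)])
    then have "cong_mod K (subst (pmul G ?t ?s) f ^ q) (subst (pmul G ?t (pone G)) f ^ q)"
      by (rule cong_mod_frobenius_subst[OF char q_def idl(1)])
    moreover have "cong_mod K (subst (pmul G ?t (pone G)) f) (subst ?t f)"
      by (intro pt_eq_subst[OF idl(1)] pmul_pone_right[OF groups(1) idl(1)]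
          closed_subgroup_point[OF T p(1)])
    ultimately have "cong_mod K (subst (pmul G ?t ?s) f ^ q) (subst ?t f ^ q)"
      using cong_mod_trans[OF idl(1)] cong_mod_power[OF idl(1)] by blast
    moreover have "subst ?t f ^ q \<in> K"
    proof -
      have "subst ?t f * subst ?t f ^ (q - 1) \<in> K"
        by (rule ideal_mult_right[OF idl(1) pointD[OF p(1) f]])
      moreover have "q > 0" using char by (simp add: q_def)
      ultimately show ?thesis by (simp flip: power_Suc)
    qed
    ultimately have "subst (pmul G ?t ?s) f ^ q \<in> K" using cong_mod_mem[OF idl(1)] by blast
    then show ?thesis by (simp add: subst_power flip: mlt_eq_pmul)
  qed
  then have "rel T \<subseteq> P" if "is_prime_ideal P" "?R \<subseteq> P" for P
    using mem_prime_power[OF that(1)] that(2) by blast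
  then have "Spec ?R = Spec (rel T)"
    using product_group_subset(1) unfolding Spec_def by blast
  then have "zariski ?R = zariski (rel T)" by (simp add: zariski_def)
  then show ?thesis using conn by (simp add: connected_group_def)
qed

text \<open>
  The multiplication map from \<open>T \<times> S\<close> is a chart that is injective on all functions, with the
  products of a group-like function on \<open>T\<close> and one on \<open>S\<close>.
\<close>

lemma diagonalisable_product:
  assumes dT: "diagonalisable T" and dS: "diagonalisable S"
  shows "diagonalisable (product_group G (rel T) (rel S))"
proof (rule diagonalisable_if_charts[OF alg_group_product, where 'y = "'x + 'x"])
  let ?TS = "product_group G (rel T) (rel S)"
  let ?E = "{in1 \<alpha> * in2 \<beta> | \<alpha> \<beta>. group_like T \<alpha> \<and> group_like S \<beta>}"
  have span: "\<exists>s\<in>mp.span ?E. cong_mod K p s" for p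
  proof (induction p rule: tensor_induct)
    case zero
    show ?case using mp.span_zero cong_mod_refl[OF idl(1)] by blast
  next
    case (tensor a b)
    obtain A c where A: "finite A" "\<And>\<chi>. \<chi> \<in> A \<Longrightarrow> group_like T \<chi>"
      "cong_mod (rel T) a (lincomb c A)"
      by (rule diagonalisable_expansion[OF dT, of a]) blast
    obtain B d where B: "finite B" "\<And>\<chi>. \<chi> \<in> B \<Longrightarrow> group_like S \<chi>"
      "cong_mod (rel S) b (lincomb d B)"
      by (rule diagonalisable_expansion[OF dS, of b]) blast
    let ?s = "\<Sum>\<alpha>\<in>A. \<Sum>\<beta>\<in>B. const (c \<alpha>) * (const (d \<beta>) * (in1 \<alpha> * in2 \<beta>))"
    have "?s \<in> mp.span ?E"
      using A(2) B(2) by (intro mp.span_sum mp.span_scale mp.span_base) auto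
    moreover have "cong_mod K (in1 a) (in1 (lincomb c A))"
      using A(3) by (simp add: cong_mod_def in1_mem_prod_ideal flip: subst_diff)
    moreover have "cong_mod K (in2 b) (in2 (lincomb d B))"
      using B(3) by (simp add: cong_mod_def in2_mem_prod_ideal flip: subst_diff)
    moreover have "in1 (lincomb c A) * in2 (lincomb d B) = ?s"
    proof -
      have "const (c \<alpha>) * x * (const (d \<beta>) * y) = const (c \<alpha>) * (const (d \<beta>) * (x * y))"
        for \<alpha> \<beta> and x y :: "('x + 'x, 'k) mpoly"
        by (rule mult.assoc[THEN trans]) (rule arg_cong[OF mult.left_commute])
      then show ?thesis unfolding subst_sum subst_mult subst_const sum_product by (simp only:)
    qed
    ultimately show ?case using cong_mod_mult[OF idl(1)] by (metis (no_types, lifting))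
  next
    case (add p q)
    then show ?case using mp.span_add cong_mod_add[OF idl(1)] by blast
  qed
  have "\<exists>A c. finite A \<and> A \<subseteq> ?E \<and> cong_mod K (subst (mlt G) g) (lincomb c A)" for g
  proof -
    obtain s where s: "s \<in> mp.span ?E" "cong_mod K (subst (mlt G) g) s" using span by blast
    then obtain A c where "finite A" "A \<subseteq> ?E" "s = lincomb c A"
      unfolding mp.span_explicit by blast
    then show ?thesis using s(2) by blast
  qed
  moreover have "cong_mod (prod_ideal K K)
        (subst (case_sum (\<lambda>x. in1 (mlt G x)) (\<lambda>x. in2 (mlt G x))) (subst (mlt G) g))
        (\<Sum>\<chi>\<in>A. const (c \<chi>) * (in1 \<chi> * in2 \<chi>))"
    if A: "A \<subseteq> ?E" and g: "cong_mod K (subst (mlt G) g) (lincomb c A)" for g A c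
  proof -
    let ?\<Psi> = "subst (case_sum (pmul G t1 t2) (pmul G s1 s2))"
    have \<Psi>: "cong_mod (prod_ideal K K) (?\<Psi> \<chi>) (in1 \<chi> * in2 \<chi>)" if \<chi>E: "\<chi> \<in> ?E" for \<chi>
    proof -
      obtain \<alpha> \<beta> where \<chi>: "\<chi> = in1 \<alpha> * in2 \<beta>" "group_like T \<alpha>" "group_like S \<beta>"
        using \<chi>E by blast
      have "subst (case_sum t1 t2) (subst (mlt G) \<alpha> - in1 \<alpha> * in2 \<alpha>) \<in> prod_ideal K K"
        using \<chi>(2) closed_subgroup_simps[OF T]
        by (intro pointD[OF point_case_sum[OF idl(2) generic_points(1,3)]]) (simp add:
            group_like_def)
      then have 1: "cong_mod (prod_ideal K K) (subst (pmul G t1 t2) \<alpha>) (subst t1 \<alpha> * subst t2 \<alpha>)"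
        by (simp add: cong_mod_def subst_of_pmul subst_diff subst_mult) (simp add: subst_subst)
      have "subst (case_sum s1 s2) (subst (mlt G) \<beta> - in1 \<beta> * in2 \<beta>) \<in> prod_ideal K K"
        using \<chi>(3) closed_subgroup_simps[OF S]
        by (intro pointD[OF point_case_sum[OF idl(2) generic_points(2,4)]]) (simp add:
            group_like_def)
      then have 2: "cong_mod (prod_ideal K K) (subst (pmul G s1 s2) \<beta>) (subst s1 \<beta> * subst s2 \<beta>)"
        by (simp add: cong_mod_def subst_of_pmul subst_diff subst_mult) (simp add: subst_subst)
      have "?\<Psi> \<chi> = subst (pmul G t1 t2) \<alpha> * subst (pmul G s1 s2) \<beta>"
        unfolding \<chi>(1) by (simp add: subst_mult subst_subst)
      moreover have "in1 \<chi> * in2 \<chi> = (subst t1 \<alpha> * subst t2 \<alpha>) * (subst s1 \<beta> * subst s2 \<beta>)"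
        unfolding \<chi>(1) by (simp add: subst_mult subst_subst)
      ultimately show ?thesis using cong_mod_mult[OF idl(2) 1 2] by simp
    qed
    have "?\<Psi> (subst (mlt G) g - lincomb c A) \<in> prod_ideal K K"
      using g by (intro pointD[OF point_case_sum[OF idl(2) products]]) (simp add: cong_mod_def)
    then have "cong_mod (prod_ideal K K) (?\<Psi> (subst (mlt G) g)) (\<Sum>\<chi>\<in>A. const (c \<chi>) * ?\<Psi> \<chi>)"
      by (simp add: cong_mod_def subst_diff subst_sum subst_mult)
    moreover have "cong_mod (prod_ideal K K) (\<Sum>\<chi>\<in>A. const (c \<chi>) * ?\<Psi> \<chi>) (\<Sum>\<chi>\<in>A. const (c \<chi>) * (in1
        \<chi> * in2 \<chi>))"
      using A by (intro cong_mod_sum[OF idl(2)] cong_mod_mult[OF idl(2)] cong_mod_refl[OF idl(2)]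
          \<Psi>) blast
    ultimately show ?thesis
      using product_interchange[of g] cong_mod_trans[OF idl(2)] by blast
  qed
  ultimately have "diagonal_chart ?TS K (mlt G) ?E"
    unfolding diagonal_chart_def by (simp add: idl(1) point_def)
  then have "diagonal_chart ?TS K (mlt G) ?E \<and> (\<forall>g\<in>mp.span B. subst (mlt G) g \<in> K \<longrightarrow> g
      \<in> rel ?TS)" for B
    by simp
  then show "\<exists>(M :: ('x + 'x, 'k) mpoly set) u E. diagonal_chart ?TS M u E \<and>
      (\<forall>g\<in>mp.span B. subst u g \<in> M \<longrightarrow> g \<in> rel ?TS)" for B
    by (intro exI)
qed

end

section \<open>Groups of multiplicative type\<close>

lemma ring_map_to_ac: "ring_map to_ac"
  by (simp add: ring_map_def)

lemma multiplicative_type_subgroup: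
  "closed_subgroup T S \<Longrightarrow> multiplicative_type S \<Longrightarrow> multiplicative_type T"
  unfolding multiplicative_type_def
  using diagonalisable_subgroup closed_subgroup_base_change[OF ring_map_to_ac] by blast

text \<open>
  The comultiplication is symmetric on group-like functions, and these span.
\<close>

lemma commuting_diagonalisable:
  fixes S :: "('x::finite, 'k::field) group_scheme"
  assumes S: "alg_group S" and diag: "diagonalisable S"
  shows "commuting S (rel S) (rel S)"
  unfolding commuting_def pt_eq_def
proof
  fix x
  let ?P = "prod_ideal (rel S) (rel S)"
  let ?swap = "subst (case_sum (\<lambda>x. var (Inr x)) (\<lambda>x. var (Inl x)))"
  note P = is_ideal_prod_ideal[of "rel S" "rel S"]
  obtain A c where A: "\<And>\<chi>. \<chi> \<in> A \<Longrightarrow> group_like S \<chi>" "cong_mod (rel S) (var x) (lincomb c A)"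
    by (rule diagonalisable_expansion[OF diag, of "var x"]) blast
  let ?s = "\<Sum>\<chi>\<in>A. const (c \<chi>) * (in1 \<chi> * in2 \<chi>)"
  have "subst (mlt S) (var x - lincomb c A) \<in> ?P"
    by (rule alg_group_mlt[OF S]) (use A(2) in \<open>simp add: cong_mod_def\<close>)
  then have "cong_mod ?P (mlt S x) (\<Sum>\<chi>\<in>A. const (c \<chi>) * subst (mlt S) \<chi>)"
    by (simp add: cong_mod_def subst_diff subst_sum subst_mult)
  moreover have "cong_mod ?P (\<Sum>\<chi>\<in>A. const (c \<chi>) * subst (mlt S) \<chi>) ?s"
    using A(1) by (intro cong_mod_sum[OF P] cong_mod_mult[OF P] cong_mod_refl[OF P])
      (simp add: group_like_def cong_mod_def)
  ultimately have m: "cong_mod ?P (mlt S x) ?s" by (rule cong_mod_trans[OF P])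
  have "?swap (mlt S x - ?s) \<in> ?P"
    by (rule pointD[OF point_case_sum[OF P point_right point_left]]) (use m in \<open>simp add:
        cong_mod_def\<close>)
  moreover have "?swap (in1 \<chi> * in2 \<chi>) = (in1 \<chi> * in2 \<chi> :: ('x + 'x, 'k) mpoly)" for \<chi>
    by (simp add: subst_mult subst_subst mult.commute)
  then have "?swap ?s = ?s" by (simp add: subst_sum subst_mult[of _ "const _"])
  ultimately have "cong_mod ?P (?swap (mlt S x)) ?s" by (simp add: cong_mod_def subst_diff)
  then have "cong_mod ?P (mlt S x) (?swap (mlt S x))"
    using m cong_mod_sym[OF P] cong_mod_trans[OF P] by blast
  then show "cong_mod ?P (pmul S (\<lambda>x. var (Inl x)) (\<lambda>x. var (Inr x)) x) (pmul S (\<lambda>x. var (Inr x))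
      (\<lambda>x. var (Inl x)) x)"
    unfolding mlt_eq_pmul[symmetric] by (simp add: pmul_def)
qed

lemma commuting_base_change:
  fixes h :: "'k::field \<Rightarrow> 'l::field" and G :: "('x::finite, 'k) group_scheme"
  assumes h: "ring_map h"
  shows "commuting (base_change h G) (ext_ideal h I) (ext_ideal h J) \<longleftrightarrow> commuting G I J"
proof -
  let ?d = "\<lambda>x. pmul G (\<lambda>x. var (Inl x)) (\<lambda>x. var (Inr x)) x
      - pmul G (\<lambda>x. var (Inr x)) (\<lambda>x. var (Inl x)) x"
  have d: "pmul (base_change h G) (\<lambda>x. var (Inl x)) (\<lambda>x. var (Inr x)) x
      - pmul (base_change h G) (\<lambda>x. var (Inr x)) (\<lambda>x. var (Inl x)) x = pmap h (?d x)" for x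
    by (simp add: ring_map_diff[OF ring_map_pmap[OF h]] pmap_pmul[OF h] pmap_var ring_map_0[OF h]
        ring_map_1[OF h])
  have "pmap h (?d x) \<in> prod_ideal (ext_ideal h I) (ext_ideal h J) \<longleftrightarrow> ?d x \<in> prod_ideal I J" for x
    using pmap_prod_ideal[OF h] prod_ideal_ext_ideal_subset[OF h, of I J]
      pmap_mem_ext_ideal_iff[OF h is_ideal_prod_ideal[of I J]] by blast
  then show ?thesis unfolding commuting_def pt_eq_def cong_mod_def d by blast
qed

text \<open>
  Commutation is an equation between polynomials over the base field, so it descends from the
  algebraic closure.
\<close>

lemma commuting_multiplicative_type:
  assumes S: "alg_group S" and mult: "multiplicative_type S"
  shows "commuting S (rel S) (rel S)"
  using commuting_diagonalisable[OF alg_group_base_change[OF ring_map_to_ac S]] mult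
  by (simp add: multiplicative_type_def commuting_base_change[OF ring_map_to_ac])

lemma product_group_base_change:
  fixes h :: "'k::field \<Rightarrow> 'l::field" and G :: "('x::finite, 'k) group_scheme"
  assumes h: "ring_map h"
  shows "base_change h (product_group G I J) = product_group (base_change h G) (ext_ideal h I)
      (ext_ideal h J)"
proof -
  let ?R = "{f. subst (mlt G) f \<in> prod_ideal I J}"
  let ?R' = "{F. subst (\<lambda>x. pmap h (mlt G x)) F \<in> prod_ideal (ext_ideal h I) (ext_ideal h J)}"
  have R: "is_ideal ?R" and R': "is_ideal ?R'"
    using ring_map_vimage_ideal[OF ring_map_subst is_ideal_prod_ideal] by (simp_all add: vimage_def)
  have "ext_ideal h ?R \<subseteq> ?R'"
    unfolding ext_ideal_def[of h ?R]
    by (rule ideal_gen_least[OF _ R']) (auto simp: pmap_prod_ideal[OF h] simp flip: pmap_subst[OF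
        h])
  moreover have "F \<in> ext_ideal h ?R" if F: "F \<in> ?R'" for F
    unfolding mem_ext_ideal_iff[OF h R]
  proof (intro allI impI)
    fix \<mu> assume \<mu>: "scalar_form h \<mu>"
    have "subst (\<lambda>x. pmap h (mlt G x)) F \<in> ext_ideal h (prod_ideal I J)"
      using F prod_ideal_ext_ideal_subset[OF h] by blast
    from ext_ideal_scalar_form[OF h is_ideal_prod_ideal \<mu> this]
    show "pmap \<mu> F \<in> ?R" by (simp add: pmap_scalar_subst[OF h \<mu>])
  qed
  ultimately have "ext_ideal h ?R = ?R'" by blast
  then show ?thesis by (simp add: base_change_def product_group_def ext_ideal_def)
qed

lemma multiplicative_type_product:
  assumes T: "closed_subgroup T G" and S: "closed_subgroup S G" and comm: "commuting G (rel T)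
      (rel S)"
    and "multiplicative_type T" "multiplicative_type S"
  shows "multiplicative_type (product_group G (rel T) (rel S))"
  using diagonalisable_product[OF closed_subgroup_base_change[OF ring_map_to_ac T]
      closed_subgroup_base_change[OF ring_map_to_ac S]] assms
  by (simp add: multiplicative_type_def product_group_base_change[OF ring_map_to_ac]
      commuting_base_change[OF ring_map_to_ac])

text \<open>
  Density is proved over the base field, where \<open>T\<close> is assumed connected, and carried to the
  algebraic closure: extension of the ideals commutes with intersections.
\<close>

lemma multiplicative_type_if_frobenius_kernels:
  fixes T :: "('x::finite, 'k::field) group_scheme"
  assumes char: "CHAR('k) > 0" and T: "alg_group T" and conn: "connected_group T"
    and mult: "\<And>i. i \<ge> r \<Longrightarrow> multiplicative_type (frobenius_kernel i T)"
  shows "multiplicative_type T"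
  unfolding multiplicative_type_def
proof (rule diagonalisable_if_dense_chain[where T
    = "\<lambda>i. base_change to_ac (frobenius_kernel (r + i) T)"])
  show "alg_group (base_change to_ac T)" by (rule alg_group_base_change[OF ring_map_to_ac T])
  show "closed_subgroup (base_change to_ac (frobenius_kernel (r + i) T)) (base_change to_ac T)"
      for i
    by (rule closed_subgroup_base_change[OF ring_map_to_ac closed_subgroup_frobenius_kernel[OF
        char T]])
  show "diagonalisable (base_change to_ac (frobenius_kernel (r + i) T))" for i
    using mult[of "r + i"] by (simp add: multiplicative_type_def)
  have dec: "rel (frobenius_kernel j T) \<subseteq> rel (frobenius_kernel i T)" if "i \<le> j" for i j
    using decseqD[OF decseq_frobenius_kernel[OF char] that] .
  then show "decseq (\<lambda>i. rel (base_change to_ac (frobenius_kernel (r + i) T)))"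
    by (simp add: decseq_def ext_ideal_mono)
  have "(\<Inter>i. rel (frobenius_kernel (r + i) T)) = (\<Inter>i. rel (frobenius_kernel i T))"
  proof
    show "(\<Inter>i. rel (frobenius_kernel (r + i) T)) \<subseteq> (\<Inter>i. rel (frobenius_kernel i T))"
      using dec[of i "r + i" for i] by auto
  qed auto
  then show "(\<Inter>i. rel (base_change to_ac (frobenius_kernel (r + i) T))) = rel (base_change to_ac T)"
    using ext_ideal_INT[OF ring_map_to_ac, of "\<lambda>i. rel (frobenius_kernel (r + i) T)", OF
        is_ideal_frobenius_kernel]
      frobenius_kernels_dense[OF char T conn] by simp
qed

section \<open>Maximal toroids and Frobenius kernels\<close>

lemma toroid_frobenius_kernel:
  fixes T :: "('x::finite, 'k::field) group_scheme"
  assumes char: "CHAR('k) > 0" and T: "toroid T"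
  shows "toroid (frobenius_kernel i T)"
  using T multiplicative_type_subgroup[OF closed_subgroup_frobenius_kernel[OF char]]
  by (auto simp: toroid_def alg_group_frobenius_kernel[OF char] connected_frobenius_kernel[OF char])

lemma toroid_of_frobenius_kernel:
  fixes T G :: "('x::finite, 'k::field) group_scheme"
  assumes char: "CHAR('k) > 0" and T: "toroid_of T G"
  shows "toroid_of (frobenius_kernel i T) (frobenius_kernel i G)"
  using T frobenius_kernel_mono[OF char, of T G i] toroid_frobenius_kernel[OF char, of T i]
  by (simp add: toroid_of_def)

lemma closed_subgroup_eqI: "closed_subgroup T S \<Longrightarrow> rel S = rel T \<Longrightarrow> S = T"
  by (cases S, cases T) (simp add: closed_subgroup_def)

text \<open>
  The ideals of the centralisers of the Frobenius kernels of \<open>T\<close> form an ascending chain, which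
  stabilises. So for large \<open>i\<close> whatever commutes with the \<open>i\<close>-th kernel commutes with all of them,
  and these are dense in \<open>T\<close>.
\<close>

lemma commuting_from_frobenius_kernel:
  fixes G T :: "('x::finite, 'k::field) group_scheme"
  assumes char: "CHAR('k) > 0" and T: "alg_group T" and conn: "connected_group T"
  obtains r where "\<And>i J. i \<ge> r \<Longrightarrow> is_ideal J \<Longrightarrow> commuting G (rel (frobenius_kernel i T)) J \<Longrightarrow>
    commuting G (rel T) J"
proof -
  define d where "d x = pmul G (\<lambda>x. var (Inl x)) (\<lambda>x. var (Inr x)) x
      - pmul G (\<lambda>x. var (Inr x)) (\<lambda>x. var (Inl x)) x" for x
  let ?I = "\<lambda>i. rel (frobenius_kernel i T)"
  define C where "C i = ideal_gen {sliceL \<phi> (d x) | \<phi> x. \<phi> \<in> annih (?I i)}" for i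
  have C: "commuting G (?I i) J \<longleftrightarrow> C i \<subseteq> J" if J: "is_ideal J" for i J
  proof -
    have "commuting G (?I i) J \<longleftrightarrow> (\<forall>x. \<forall>\<phi>\<in>annih (?I i). sliceL \<phi> (d x) \<in> J)"
      unfolding commuting_def pt_eq_def cong_mod_def d_def
        mem_prod_ideal_iff_sliceL[OF is_ideal_frobenius_kernel J] ..
    also have "\<dots> \<longleftrightarrow> {sliceL \<phi> (d x) | \<phi> x. \<phi> \<in> annih (?I i)} \<subseteq> J" (is "_ \<longleftrightarrow> ?gens \<subseteq> J") by blast
    also have "\<dots> \<longleftrightarrow> C i \<subseteq> J"
      unfolding C_def
    proof
      show "ideal_gen ?gens \<subseteq> J" if "?gens \<subseteq> J" by (rule ideal_gen_least[OF that J])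
      show "?gens \<subseteq> J" if "ideal_gen ?gens \<subseteq> J" using that ideal_gen_base[of _ ?gens]
          by (meson subset_iff)
    qed
    finally show ?thesis .
  qed
  have inc: "incseq C"
    unfolding incseq_def C_def
  proof (intro allI impI ideal_gen_mono)
    fix i j :: nat assume "i \<le> j"
    then have "annih (?I i) \<subseteq> annih (?I j)"
      by (intro annih_antimono decseqD[OF decseq_frobenius_kernel[OF char]])
    then show "{sliceL \<phi> (d x) | \<phi> x. \<phi> \<in> annih (?I i)} \<subseteq> {sliceL \<phi> (d x) | \<phi> x. \<phi> \<in> annih (?I j)}"
      by blast
  qed
  obtain r where r: "\<And>i. i \<ge> r \<Longrightarrow> C i = C r"
  proof (rule ideal_chain_stabilises[of C])
    show "is_ideal (C n)" for n unfolding C_def by (rule is_ideal_ideal_gen)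
  qed (use inc in blast)+
  have "commuting G (rel T) J" if i: "i \<ge> r" and J: "is_ideal J" and comm: "commuting G (?I i) J"
      for i J
  proof -
    have "C j \<subseteq> J" for j
    proof -
      have "C j \<subseteq> C (max r j)" using inc by (simp add: incseq_def)
      also have "\<dots> = C i" using r[of "max r j"] r[OF i] by simp
      also have "\<dots> \<subseteq> J" using C[OF J] comm by simp
      finally show ?thesis .
    qed
    then have "commuting G (?I j) J" for j using C[OF J] by simp
    then have "d x \<in> prod_ideal (?I j) J" for x j
      by (simp add: commuting_def pt_eq_def cong_mod_def d_def)
    then have "d x \<in> prod_ideal (\<Inter>j. ?I j) (\<Inter>j::nat. J)" for x
      by (intro prod_ideal_INT is_ideal_frobenius_kernel J decseq_frobenius_kernel[OF char])
         (simp_all add: decseq_def)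
    then show ?thesis
      using frobenius_kernels_dense[OF char T conn]
      by (simp add: commuting_def pt_eq_def cong_mod_def d_def)
  qed
  then show ?thesis using that by blast
qed

lemma maximal_toroid_frobenius_kernels:
  fixes G T :: "('x::finite, 'k::field) group_scheme"
  assumes char: "CHAR('k) > 0" and max: "maximal_toroid_of T G"
  shows "\<exists>r>0. \<forall>i\<ge>r. maximal_toroid_of (frobenius_kernel i T) (frobenius_kernel i G)"
proof -
  have TG: "toroid_of T G" "closed_subgroup T G" "toroid T"
    and T: "alg_group T" "connected_group T" "multiplicative_type T"
    using max by (auto simp: maximal_toroid_of_def toroid_of_def toroid_def)
  have G: "alg_group G" by (rule closed_subgroup_alg_group(2)[OF TG(2)])
  obtain r where r: "\<And>i J. i \<ge> r \<Longrightarrow> is_ideal J \<Longrightarrow> commuting G (rel (frobenius_kernel i T)) J \<Longrightarrow>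
    commuting G (rel T) J"
    using commuting_from_frobenius_kernel[OF char T(1,2)] by blast
  have "maximal_toroid_of (frobenius_kernel i T) (frobenius_kernel i G)" if i: "i \<ge> Suc r" for i
    unfolding maximal_toroid_of_def
  proof (intro conjI notI)
    show "toroid_of (frobenius_kernel i T) (frobenius_kernel i G)"
      by (rule toroid_of_frobenius_kernel[OF char TG(1)])
  next
    assume "\<exists>S. toroid_of S (frobenius_kernel i G) \<and> closed_subgroup (frobenius_kernel i T) S
      \<and> S \<noteq> frobenius_kernel i T"
    then obtain S where S: "closed_subgroup S (frobenius_kernel i G)" "toroid S"
      "closed_subgroup (frobenius_kernel i T) S" "S \<noteq> frobenius_kernel i T"
      by (auto simp: toroid_of_def)
    have aS: "alg_group S" "multiplicative_type S" using S(2) by (auto simp: toroid_def)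
    have SG: "closed_subgroup S G"
      by (rule closed_subgroup_trans[OF S(1) closed_subgroup_frobenius_kernel[OF char G]])
    have "commuting S (rel S) (rel S)" by (rule commuting_multiplicative_type[OF aS])
    then have "commuting G (rel (frobenius_kernel i T)) (rel S)"
      using prod_ideal_mono[OF closed_subgroup_rel[OF S(3)] subset_refl, of "rel S"]
      unfolding commuting_def closed_subgroup_ops[OF SG] by (rule pt_eq_mono[rotated])
    then have comm: "commuting G (rel T) (rel S)"
      using i by (intro r[of i] alg_group_is_ideal[OF aS(1)]) auto
    \<comment> \<open>the maximality of \<open>T\<close> is applied to the product of \<open>T\<close> and \<open>S\<close>\<close>
    let ?P = "product_group G (rel T) (rel S)"
    have "toroid_of ?P G"
      unfolding toroid_of_def toroid_def
      using closed_subgroup_product(1)[OF TG(2) SG comm] alg_group_product[OF TG(2) SG comm]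
        connected_product[OF TG(2) SG comm char closed_subgroup_rel[OF S(1)] T(2)]
        multiplicative_type_product[OF TG(2) SG comm T(3) aS(2)] by blast
    moreover have "closed_subgroup T ?P" by (rule closed_subgroup_product(2)[OF TG(2) SG comm])
    ultimately have "?P = T" using max unfolding maximal_toroid_of_def by blast
    then have "rel T \<subseteq> rel S" using product_group_subset(2)[OF TG(2) SG comm] by simp
    then have "rel (frobenius_kernel i T) \<subseteq> rel S"
      unfolding rel_frobenius_kernel[OF char refl, of i T]
      using closed_subgroup_rel[OF S(1)] closed_subgroup_simps[OF TG(2)]
      unfolding rel_frobenius_kernel[OF char refl, of i G]
      by (intro ideal_gen_least alg_group_is_ideal[OF aS(1)]) (auto intro: ideal_gen_base)
    then have "rel S = rel (frobenius_kernel i T)" using closed_subgroup_rel[OF S(3)] by blast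
    then show False using closed_subgroup_eqI[OF S(3)] S(4) by blast
  qed
  then show ?thesis by (intro exI[of _ "Suc r"]) auto
qed

theorem corollary1p7:
  fixes G T :: "('x::finite, 'k::field) group_scheme"
  assumes "CHAR('k) > 0"
    and "alg_group G"
    and "closed_subgroup T G"
  shows "maximal_toroid_of T G \<longleftrightarrow>
    connected_group T \<and>
    (\<exists>r::nat. r > 0 \<and>
      (\<forall>i\<ge>r. maximal_toroid_of (frobenius_kernel i T) (frobenius_kernel i G)))"
proof
  assume max: "maximal_toroid_of T G"
  then have "connected_group T" by (simp add: maximal_toroid_of_def toroid_of_def toroid_def)
  then show "connected_group T \<and>
    (\<exists>r::nat. r > 0 \<and>
      (\<forall>i\<ge>r. maximal_toroid_of (frobenius_kernel i T) (frobenius_kernel i G)))"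
    using maximal_toroid_frobenius_kernels[OF assms(1) max] by blast
next
  assume "connected_group T \<and>
    (\<exists>r::nat. r > 0 \<and>
      (\<forall>i\<ge>r. maximal_toroid_of (frobenius_kernel i T) (frobenius_kernel i G)))"
  then obtain r where conn: "connected_group T"
    and max: "\<And>i. i \<ge> r \<Longrightarrow> maximal_toroid_of (frobenius_kernel i T) (frobenius_kernel i G)" by blast
  note char = assms(1)
  have T: "alg_group T" by (rule closed_subgroup_alg_group(1)[OF assms(3)])
  have "multiplicative_type (frobenius_kernel i T)" if "i \<ge> r" for i
    using max[OF that] by (simp add: maximal_toroid_of_def toroid_of_def toroid_def)
  then have "multiplicative_type T"
    by (rule multiplicative_type_if_frobenius_kernels[OF char T conn])
  then have "toroid_of T G" using T conn assms(3) by (simp add: toroid_of_def toroid_def)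
  moreover have "S = T" if S: "toroid_of S G" and TS: "closed_subgroup T S" for S
  proof -
    have "frobenius_kernel i S = frobenius_kernel i T" if "i \<ge> r" for i
      using max[OF that] toroid_of_frobenius_kernel[OF char S] frobenius_kernel_mono[OF char TS]
      unfolding maximal_toroid_of_def by blast
    then have eq: "rel (frobenius_kernel i S) = rel (frobenius_kernel i T)" if "i \<ge> r" for i
      using that by simp
    have sub: "rel S \<subseteq> rel T" by (rule closed_subgroup_rel[OF TS])
    have "rel T \<subseteq> rel (frobenius_kernel i S)" for i
    proof -
      have "rel T \<subseteq> rel (frobenius_kernel (max r i) S)"
        using eq[of "max r i"] rel_subset_frobenius_kernel by auto
      also have "\<dots> \<subseteq> rel (frobenius_kernel i S)"
        by (rule decseqD[OF decseq_frobenius_kernel[OF char]]) simp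
      finally show ?thesis .
    qed
    then have "rel T \<subseteq> (\<Inter>i. rel (frobenius_kernel i S))" by blast
    also have "\<dots> = rel S"
      using S by (intro frobenius_kernels_dense[OF char]) (auto simp: toroid_of_def toroid_def)
    finally have "rel S = rel T" using sub by blast
    then show "S = T" by (rule closed_subgroup_eqI[OF TS])
  qed
  ultimately show "maximal_toroid_of T G" unfolding maximal_toroid_of_def by blast
qed

end
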